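(* Let $m\ge 2$ and let $\Gamma$ be a discrete subgroup of $\mathrm{SO}_+(m,1)$ acting on $\mathbb{H}_{\mathbb{R}}^m$ whose limit set is the whole sphere $\mathbb{S}^{m-1}$. Let $\Omega\subset\mathbb{P}_{\mathbb{C}}^m$ be the Kulkarni discontinuity region of $\iota(\Gamma)$ acting on $\mathbb{P}_{\mathbb{C}}^m$. Then there exists an $\mathrm{SO}_+(m,1)$-equivariant smooth fibre bundle $\Pi:\Omega\to\mathbb{H}_{\mathbb{R}}^{m}$.
   Context: $\mathbb{C}^{m,1}$ is $\mathbb{C}^{m+1}$ with the Hermitian form $\langle \mathbf{z},\mathbf{w}\rangle=z_1\overline{w_1}+\cdots+z_m\overline{w_m}-z_{m+1}\overline{w_{m+1}}$, and $\mathbb{P}_{\mathbb{C}}^m$ is its projectivization, with $[\mathbf z]$ the class of $\mathbf z\neq \mathbf 0$. $\mathbb{H}_{\mathbb{C}}^m=\{[\mathbf z]:\langle\mathbf z,\mathbf z\rangle<0\}$, $\partial\mathbb{H}_{\mathbb{C}}^m=\{[\mathbf z]:\langle\mathbf z,\mathbf z\rangle=0\}$, $\mathbb{P}_{\mathbb{R}}^m\subset\mathbb{P}_{\mathbb{C}}^m$ is the set of points having real homogeneous coordinates, $\mathbb{H}_{\mathbb{R}}^m=\mathbb{H}_{\mathbb{C}}^m\cap\mathbb{P}_{\mathbb{R}}^m$ and $\partial\mathbb{H}_{\mathbb{R}}^m=\partial\mathbb{H}_{\mathbb{C}}^m\cap\mathbb{P}_{\mathbb{R}}^m\cong\mathbb{S}^{m-1}$.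 $\mathrm{SO}_+(m,1)$ is the group of real $(m+1)\times(m+1)$ matrices giving the orientation preserving isometries of $\mathbb{H}_{\mathbb{R}}^m$; the limit set of a discrete subgroup $\Gamma$ is the set of accumulation points in $\mathbb{S}^{m-1}$ of an orbit $\Gamma\cdot \mathbf z$, $\mathbf z\in\mathbb{H}_{\mathbb{R}}^m$. Here $\iota:\mathrm{SO}_+(m,1)\to\mathrm{SU}(m,1)$ is the inclusion (a real matrix regarded as a complex matrix), and matrices act projectively on $\mathbb{P}_{\mathbb{C}}^m$. Kulkarni limit set: for a discrete group $G$ acting on $X=\mathbb{P}_{\mathbb{C}}^m$, let $L_0$ be the closure of the set of points with infinite isotropy group, $L_1$ the closure of the set of cluster points of orbits $Gz$, $z\in X\setminus L_0$, and $L_2$ the closure of the set of cluster points of the families $\{gK\}_{g\in G}$, $K$ ranging over compact subsets of $X\setminus(L_0\cup L_1)$. The Kulkarni limit set is $\Lambda_{Kul}(G)=L_0\cup L_1\cup L_2$ and the Kulkarni discontinuity region is $X\setminus\Lambda_{Kul}(G)$. By a known result of Cano, Liu and López, for the groups considered here $\Lambda_{Kul}(\iota(\Gamma))=\bigcup_{p\in\partial\mathbb{H}_{\mathbb{R}}^m}H_p$, where $H_p=\{[\mathbf w]\in\mathbb{P}_{\mathbb{C}}^m:\langle\mathbf p,\mathbf w\rangle=0\}$ is the complex projective hyperplane tangent to $\partial\mathbb{H}_{\mathbb{C}}^m$ at $p=[\mathbf p]$. In particular $\Omega$ is invariant under $\mathrm{SO}_+(m,1)$. *)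

theory Defs
  imports "HOL-Analysis.Analysis" "HOL-Algebra.Group"
begin

section \<open>Complex projective space\<close>

(* The m + 1 coordinates are indexed by 'm option with CARD('m) = m:
   Some j stands for the j-th of the m positive coordinates and None for the
   (m+1)-st, negative, one. *)

definition proj_rel :: "complex ^ ('m::finite option) \<Rightarrow> complex ^ ('m option) \<Rightarrow> bool" where
  "proj_rel z w \<longleftrightarrow> z \<noteq> 0 \<and> w \<noteq> 0 \<and> (\<exists>c. w = c *s z)"

lemma part_equivp_proj_rel: "part_equivp (proj_rel :: complex ^ ('m::finite option) \<Rightarrow> _)"
proof (rule part_equivpI)
  have "proj_rel (1 :: complex ^ ('m option)) 1"
    unfolding proj_rel_def by (auto intro!: exI[of _ 1])
  then show "\<exists>z :: complex ^ ('m option). proj_rel z z" by blast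
  show "symp (proj_rel :: complex ^ ('m option) \<Rightarrow> _)"
  proof (rule sympI)
    fix z w :: "complex ^ ('m option)"
    assume "proj_rel z w"
    then obtain c where c: "w = c *s z" "z \<noteq> 0" "w \<noteq> 0" unfolding proj_rel_def by blast
    then have "c \<noteq> 0" by auto
    then have "z = inverse c *s w" using c by (simp add: vector_smult_assoc)
    with c show "proj_rel w z" unfolding proj_rel_def by blast
  qed
  show "transp (proj_rel :: complex ^ ('m option) \<Rightarrow> _)"
    by (rule transpI) (auto simp: proj_rel_def vector_smult_assoc)
qed

quotient_type 'm cproj = "complex ^ ('m::finite option)" / partial: proj_rel
  morphisms rep_cproj proj
  by (rule part_equivp_proj_rel)

(* proj z is the class of z; it is meaningful only for z nonzero. *)

lemma proj_eq_iff: "z \<noteq> 0 \<Longrightarrow> w \<noteq> 0 \<Longrightarrow> proj z = proj w \<longleftrightarrow> (\<exists>c. w = c *s z)"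
  using Quotient_rel[OF Quotient_cproj, of z w]
  by (auto simp: proj_rel_def intro: exI[of _ 1])

lemma proj_rep_cproj [simp]: "proj (rep_cproj p) = p"
  by (rule Quotient_abs_rep[OF Quotient_cproj])

lemma rep_cproj_nonzero [simp]: "rep_cproj p \<noteq> 0"
  using Quotient_rep_reflp[OF Quotient_cproj, of p] by (simp add: proj_rel_def)

instantiation cproj :: (finite) topological_space
begin

definition open_cproj :: "'a cproj set \<Rightarrow> bool" where
  "open_cproj U \<longleftrightarrow> open {z. z \<noteq> 0 \<and> proj z \<in> U}"

instance
proof
  have "{z :: complex ^ ('a option). z \<noteq> 0 \<and> proj z \<in> UNIV} = - {0}" by auto
  then show "open (UNIV :: 'a cproj set)" unfolding open_cproj_def by (simp add: open_Compl)
next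
  fix S T :: "'a cproj set"
  assume "open S" "open T"
  then have "open ({z. z \<noteq> 0 \<and> proj z \<in> S} \<inter> {z. z \<noteq> 0 \<and> proj z \<in> T})"
    unfolding open_cproj_def by (rule open_Int)
  also have "{z. z \<noteq> 0 \<and> proj z \<in> S} \<inter> {z. z \<noteq> 0 \<and> proj z \<in> T} = {z. z \<noteq> 0 \<and> proj z \<in> S \<inter> T}"
    by auto
  finally show "open (S \<inter> T)" unfolding open_cproj_def .
next
  fix K :: "'a cproj set set"
  assume "\<forall>S\<in>K. open S"
  then have "open (\<Union>S\<in>K. {z. z \<noteq> 0 \<and> proj z \<in> S})"
    unfolding open_cproj_def by blast
  also have "(\<Union>S\<in>K. {z. z \<noteq> 0 \<and> proj z \<in> S}) = {z. z \<noteq> 0 \<and> proj z \<in> \<Union>K}" by auto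
  finally show "open (\<Union>K)" unfolding open_cproj_def .
qed

end

(* Projective action of a matrix, meaningful for invertible matrices. *)
definition pact :: "complex ^ ('m::finite option) ^ ('m option) \<Rightarrow> 'm cproj \<Rightarrow> 'm cproj" where
  "pact A p = proj (A *v rep_cproj p)"

lemma pact_proj:
  assumes "invertible A" "z \<noteq> 0"
  shows "pact A (proj z) = proj (A *v z)"
proof -
  have nz: "A *v x \<noteq> 0" if "x \<noteq> 0" for x
    using assms(1) that inj_matrix_vector_mult[of A] by (metis injD matrix_vector_mult_0_right)
  obtain c where "rep_cproj (proj z) = c *s z"
    using proj_eq_iff[of z "rep_cproj (proj z)"] assms(2) by auto
  then have "A *v rep_cproj (proj z) = c *s (A *v z)"
    by (simp add: vector_scalar_commute)
  then show ?thesis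
    unfolding pact_def using nz assms(2) proj_eq_iff[of "A *v z" "A *v rep_cproj (proj z)"]
    by fastforce
qed


section \<open>Complex and real hyperbolic space\<close>

definition herm :: "complex ^ ('m::finite option) \<Rightarrow> complex ^ ('m option) \<Rightarrow> complex" where
  "herm z w = (\<Sum>j\<in>UNIV. z $ Some j * cnj (w $ Some j)) - z $ None * cnj (w $ None)"

definition HC :: "'m::finite cproj set" where
  "HC = {proj z |z. z \<noteq> 0 \<and> Re (herm z z) < 0}"

definition bdHC :: "'m::finite cproj set" where
  "bdHC = {proj z |z. z \<noteq> 0 \<and> herm z z = 0}"

definition PR :: "'m::finite cproj set" where
  "PR = {proj z |z. z \<noteq> 0 \<and> (\<forall>i. z $ i \<in> \<real>)}"

definition HR :: "'m::finite cproj set" where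
  "HR = HC \<inter> PR"

definition bdHR :: "'m::finite cproj set" where
  "bdHR = bdHC \<inter> PR"


section \<open>The group \<open>SO\<^sub>+(m,1)\<close>, its discrete subgroups and their limit sets\<close>

definition lor :: "real ^ ('m::finite option) \<Rightarrow> real ^ ('m option) \<Rightarrow> real" where
  "lor x y = (\<Sum>j\<in>UNIV. x $ Some j * y $ Some j) - x $ None * y $ None"

(* Among the matrices preserving the form, those with positive last diagonal entry
   preserve each sheet of the hyperboloid, and those with determinant 1 among
   these act on it preserving orientation. *)
definition SO_plus :: "(real ^ ('m::finite option) ^ ('m option)) monoid" where
  "SO_plus = \<lparr>carrier = {A. (\<forall>x y. lor (A *v x) (A *v y) = lor x y) \<and> det A = 1
                          \<and> A $ None $ None > 0},
              mult = (**), one = mat 1\<rparr>"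

definition cmat :: "real ^ 'n ^ 'k \<Rightarrow> complex ^ 'n ^ 'k" where
  "cmat A = (\<chi> i j. complex_of_real (A $ i $ j))"

definition discrete_subgroup :: "(real ^ ('m::finite option) ^ ('m option)) set \<Rightarrow> bool" where
  "discrete_subgroup \<Gamma> \<longleftrightarrow> subgroup \<Gamma> SO_plus \<and> discrete \<Gamma>"

(* For discrete groups the accumulation points on the boundary do not depend on the
   base point z of the orbit. *)
definition limit_set :: "(real ^ ('m::finite option) ^ ('m option)) set \<Rightarrow> 'm cproj set" where
  "limit_set \<Gamma> = {p \<in> bdHR. \<exists>z\<in>HR. p islimpt ((\<lambda>g. pact (cmat g) z) ` \<Gamma>)}"


section \<open>The Kulkarni limit set\<close>

(* p is a cluster point of the family of sets g K, g in G, if every neighbourhood of p meets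
   g K for infinitely many g.  The cluster points of an orbit G z are those of
   the family g {z}; if z has finite isotropy group, these are the accumulation points of
   the set G z. *)
definition cluster_points ::
  "(complex ^ ('m::finite option) ^ ('m option)) set \<Rightarrow> 'm cproj set \<Rightarrow> 'm cproj set" where
  "cluster_points G K =
     {p. \<forall>U. open U \<and> p \<in> U \<longrightarrow> infinite {g \<in> G. pact g ` K \<inter> U \<noteq> {}}}"

definition Kul_L0 :: "(complex ^ ('m::finite option) ^ ('m option)) set \<Rightarrow> 'm cproj set" where
  "Kul_L0 G = closure {z. infinite {g \<in> G. pact g z = z}}"

definition Kul_L1 :: "(complex ^ ('m::finite option) ^ ('m option)) set \<Rightarrow> 'm cproj set" where
  "Kul_L1 G = closure (\<Union>z \<in> - Kul_L0 G. cluster_points G {z})"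

definition Kul_L2 :: "(complex ^ ('m::finite option) ^ ('m option)) set \<Rightarrow> 'm cproj set" where
  "Kul_L2 G = closure (\<Union>K \<in> {K. compact K \<and> K \<subseteq> - (Kul_L0 G \<union> Kul_L1 G)}. cluster_points G K)"

definition Kul_limit_set :: "(complex ^ ('m::finite option) ^ ('m option)) set \<Rightarrow> 'm cproj set" where
  "Kul_limit_set G = Kul_L0 G \<union> Kul_L1 G \<union> Kul_L2 G"

definition Kul_region :: "(complex ^ ('m::finite option) ^ ('m option)) set \<Rightarrow> 'm cproj set" where
  "Kul_region G = - Kul_limit_set G"


section \<open>Smooth manifolds and smooth fibre bundles\<close>

(* Continuous differentiability of order k on an open set S, by iterated directional derivatives. *)
primrec Ck_on :: "nat \<Rightarrow> 'a::euclidean_space set \<Rightarrow> ('a \<Rightarrow> 'b::euclidean_space) \<Rightarrow> bool" where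
  "Ck_on 0 S f \<longleftrightarrow> continuous_on S f"
| "Ck_on (Suc k) S f \<longleftrightarrow> (\<forall>x\<in>S. f differentiable (at x)) \<and>
     (\<forall>v. Ck_on k S (\<lambda>x. frechet_derivative f (at x) v))"

definition smooth_on :: "'a::euclidean_space set \<Rightarrow> ('a \<Rightarrow> 'b::euclidean_space) \<Rightarrow> bool" where
  "smooth_on S f \<longleftrightarrow> (\<forall>k. Ck_on k S f)"

record ('a, 'e) mfd =
  mtop :: "'a topology"
  charts :: "('a set \<times> ('a \<Rightarrow> 'e)) set"

definition smooth_manifold :: "('a, 'e::euclidean_space) mfd \<Rightarrow> bool" where
  "smooth_manifold M \<longleftrightarrow>
     Hausdorff_space (mtop M) \<and> second_countable (mtop M) \<and>
     \<Union> (fst ` charts M) = topspace (mtop M) \<and>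
     (\<forall>(U, \<phi>) \<in> charts M. openin (mtop M) U \<and> open (\<phi> ` U) \<and>
        homeomorphic_map (subtopology (mtop M) U) (top_of_set (\<phi> ` U)) \<phi>) \<and>
     (\<forall>(U, \<phi>) \<in> charts M. \<forall>(V, \<psi>) \<in> charts M.
        smooth_on (\<phi> ` (U \<inter> V)) (\<psi> \<circ> inv_into U \<phi>))"

definition smooth_map ::
  "('a, 'e::euclidean_space) mfd \<Rightarrow> ('b, 'f::euclidean_space) mfd \<Rightarrow> ('a \<Rightarrow> 'b) \<Rightarrow> bool" where
  "smooth_map M N f \<longleftrightarrow>
     continuous_map (mtop M) (mtop N) f \<and>
     (\<forall>(U, \<phi>) \<in> charts M. \<forall>(V, \<psi>) \<in> charts N.
        smooth_on (\<phi> ` (U \<inter> f -` V)) (\<psi> \<circ> f \<circ> inv_into U \<phi>))"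

definition diffeo ::
  "('a, 'e::euclidean_space) mfd \<Rightarrow> ('b, 'f::euclidean_space) mfd \<Rightarrow> ('a \<Rightarrow> 'b) \<Rightarrow> bool" where
  "diffeo M N f \<longleftrightarrow>
     bij_betw f (topspace (mtop M)) (topspace (mtop N)) \<and>
     smooth_map M N f \<and> smooth_map N M (inv_into (topspace (mtop M)) f)"

(* The open submanifold on an open subset W. *)
definition restrict_mfd :: "('a, 'e) mfd \<Rightarrow> 'a set \<Rightarrow> ('a, 'e) mfd" where
  "restrict_mfd M W =
     \<lparr>mtop = subtopology (mtop M) W, charts = (\<lambda>(U, \<phi>). (U \<inter> W, \<phi>)) ` charts M\<rparr>"

definition prod_mfd :: "('a, 'e) mfd \<Rightarrow> ('b, 'f) mfd \<Rightarrow> ('a \<times> 'b, 'e \<times> 'f) mfd" where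
  "prod_mfd M N =
     \<lparr>mtop = prod_topology (mtop M) (mtop N),
      charts = (\<lambda>((U, \<phi>), (V, \<psi>)). (U \<times> V, map_prod \<phi> \<psi>)) ` (charts M \<times> charts N)\<rparr>"

definition smooth_fibre_bundle ::
  "('a, 'e::euclidean_space) mfd \<Rightarrow> ('b, 'f::euclidean_space) mfd \<Rightarrow> ('c, 'g::euclidean_space) mfd
    \<Rightarrow> ('a \<Rightarrow> 'b) \<Rightarrow> bool" where
  "smooth_fibre_bundle E B F \<pi> \<longleftrightarrow>
     smooth_manifold E \<and> smooth_manifold B \<and> smooth_manifold F \<and>
     smooth_map E B \<pi> \<and> \<pi> ` topspace (mtop E) = topspace (mtop B) \<and>
     (\<forall>b \<in> topspace (mtop B). \<exists>U h. openin (mtop B) U \<and> b \<in> U \<and>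
        diffeo (restrict_mfd E {x \<in> topspace (mtop E). \<pi> x \<in> U}) (prod_mfd (restrict_mfd B U) F) h \<and>
        (\<forall>x \<in> topspace (mtop E). \<pi> x \<in> U \<longrightarrow> fst (h x) = \<pi> x))"


section \<open>The manifolds \<open>\<P>\<^sub>\<complex>\<^sup>m\<close> and \<open>\<H>\<^sub>\<real>\<^sup>m\<close>\<close>

(* The standard affine chart on the locus where the i-th homogeneous coordinate is nonzero:
   divide by it and omit it.  For i = Some k the slot k freed in this way holds the
   coordinate None. *)
definition affine_chart :: "'m::finite option \<Rightarrow> 'm cproj \<Rightarrow> complex ^ 'm" where
  "affine_chart i p =
     (\<chi> j. rep_cproj p $ (if Some j = i then None else Some j) / rep_cproj p $ i)"

lemma affine_chart_proj:
  assumes "z \<noteq> 0"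
  shows "affine_chart i (proj z) = (\<chi> j. z $ (if Some j = i then None else Some j) / z $ i)"
proof -
  obtain c where c: "rep_cproj (proj z) = c *s z"
    using proj_eq_iff[of z "rep_cproj (proj z)"] assms by auto
  moreover have "c \<noteq> 0" using c rep_cproj_nonzero[of "proj z"] by auto
  ultimately show ?thesis by (simp add: affine_chart_def vec_eq_iff)
qed

definition CP_mfd :: "('m::finite cproj, complex ^ 'm) mfd" where
  "CP_mfd = \<lparr>mtop = euclidean,
             charts = (\<lambda>i. ({proj z |z. z \<noteq> 0 \<and> z $ i \<noteq> 0}, affine_chart i)) ` UNIV\<rparr>"

(* HR lies in the locus where the coordinate None is nonzero, and there the affine chart takes
   real values on real points: this is the Klein ball model, the structure of an open
   subset of real projective space. *)
definition HR_mfd :: "('m::finite cproj, real ^ 'm) mfd" where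
  "HR_mfd = \<lparr>mtop = subtopology euclidean HR,
             charts = {(HR, \<lambda>p. \<chi> j. Re (affine_chart None p $ j))}\<rparr>"

definition SO_equivariant :: "'m::finite cproj set \<Rightarrow> ('m cproj \<Rightarrow> 'm cproj) \<Rightarrow> bool" where
  "SO_equivariant X f \<longleftrightarrow>
     (\<forall>g \<in> carrier SO_plus. \<forall>x \<in> X.
        pact (cmat g) x \<in> X \<and> f (pact (cmat g) x) = pact (cmat g) (f x))"

end

theory Submission
  imports Defs
begin

text \<open>
  Let q be the complex quadratic extension of the Lorentzian form and h the Hermitian norm. A vector z can be
  rotated by a phase to x + i y with x, y orthogonal, and comparing h(z) with |q(z)| decides whether some real null
  vector is orthogonal to z: this is not the case exactly if h < |q|, or if m = 2 and h > |q|. If h < |q|, one of x, y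
  is timelike and \<open>[z] \<mapsto> [|q(z)| z - q(z) cnj z]\<close> projects \<open>[z]\<close> to it; if m = 2 and h > |q|, then x and y span a
  spacelike plane and \<open>[z]\<close> is projected to its timelike normal. The projection commutes with all Lorentz
  transformations, and boosts trivialise it globally.

  That the Kulkarni limit set is the union of the tangent hyperplanes rests on the fact that divergent sequences in
  the group converge, after normalisation, to maps of rank one \<open>x \<mapsto> lor q x p\<close> with p and q null. Hence
  sets \<open>gK\<close> can only accumulate on tangent hyperplanes unless K meets the boundary sphere, which is itself in the limit
  set. Conversely, since the limit set is the whole sphere, all pairs (p, q) occur, and by Brouwer's theorem the
  pairs of fixed points of loxodromic elements are dense. Powers of a loxodromic element return arbitrarily close to the
  identity on the complement of its axis, so the complement consists of limit points.
\<close>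

section \<open>The topology of projective space\<close>

text \<open>Everything is done on lifts z, where h and |q| both scale by |c|^2 under z -> c z, so
  projective questions become Lorentzian linear algebra. Recurrence alone does not exhibit a limit
  point; it yields a dichotomy between two points v + b q and v + a p: a sequence converging to the
  first is moved by powers of g to one converging to the second. With a = b = 0 this captures the
  complement of the axis. For m >= 3 these complements approximate every point of a tangent
  hyperplane, but for m = 2 they contain only real points, and the others need two nearby
  hyperplanes played off against each other. That all pairs (p, q) occur requires composing limits
  of rank one, which fails when the inner directions coincide; excluding a common fixed point of the
  group removes this obstacle. The fibre over the centre of the ball is R^m, joined for m = 2 by a
  complex projective line without its real points; this second piece comes from the second
  inequality between h and |q|.\<close>

lemma proj_eq_iff_nz:
  assumes "z \<noteq> 0" "w \<noteq> 0"
  shows "proj z = proj w \<longleftrightarrow> (\<exists>c. c \<noteq> 0 \<and> w = c *s z)"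
  using assms proj_eq_iff[of z w] by auto

lemma proj_scale [simp]:
  assumes "c \<noteq> 0" "z \<noteq> 0"
  shows "proj (c *s z) = proj z"
  using assms proj_eq_iff[of z "c *s z"] by auto

lemma proj_scaleR:
  assumes "c \<noteq> 0" "z \<noteq> 0"
  shows "proj (c *\<^sub>R z) = proj z"
proof -
  have "c *\<^sub>R z = complex_of_real c *s z"
    by (simp add: vec_eq_iff complex_eq_iff)
  with assms show ?thesis by simp
qed

lemma proj_cases:
  obtains z where "z \<noteq> 0" "p = proj z"
  by (metis proj_rep_cproj rep_cproj_nonzero)

lemma open_cproj_iff: "open U \<longleftrightarrow> open {z. z \<noteq> 0 \<and> proj z \<in> U}"
  by (simp add: open_cproj_def)

text \<open>The saturation of the image is a union of rescaled copies of the open set. Openness of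
  \<open>proj\<close> transfers countable bases and later shows that both pieces of the fibre are
  open.\<close>

lemma open_proj_image:
  assumes "open S"
  shows "open (proj ` (S - {0}))"
proof -
  have "{z. z \<noteq> 0 \<and> proj z \<in> proj ` (S - {0})} = (\<Union>c\<in>-{0}. (*s) c ` (S - {0}))"
  proof (intro equalityI subsetI)
    fix z assume "z \<in> {z. z \<noteq> 0 \<and> proj z \<in> proj ` (S - {0})}"
    then have "z \<noteq> 0" "proj z \<in> proj ` (S - {0})" by auto
    then obtain w where w: "z \<noteq> 0" "w \<in> S - {0}" "proj w = proj z" by (metis imageE)
    then obtain c where "c \<noteq> 0" "z = c *s w" using proj_eq_iff_nz[of w z] by auto
    with w show "z \<in> (\<Union>c\<in>-{0}. (*s) c ` (S - {0}))" by blast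
  next
    fix z assume "z \<in> (\<Union>c\<in>-{0}. (*s) c ` (S - {0}))"
    then obtain c w where "c \<noteq> 0" "w \<in> S - {0}" "z = c *s w" by auto
    then show "z \<in> {z. z \<noteq> 0 \<and> proj z \<in> proj ` (S - {0})}" by auto
  qed
  moreover have "open ((*s) c ` (S - {0}))" if "c \<noteq> 0" for c :: complex
  proof -
    have "(*s) c ` (S - {0}) = (*s) (inverse c) -` (S - {0})"
    proof (intro equalityI subsetI)
      fix z assume "z \<in> (*s) (inverse c) -` (S - {0})"
      moreover have "z = c *s (inverse c *s z)" using that by (simp add: vector_smult_assoc)
      ultimately show "z \<in> (*s) c ` (S - {0})" by blast
    qed (use that in \<open>auto simp: vector_smult_assoc\<close>)
    moreover have "continuous_on UNIV ((*s) (inverse c) :: complex ^ ('a option) \<Rightarrow> _)"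
      unfolding vector_scalar_mult_def by (intro continuous_intros)
    ultimately show ?thesis
      using assms by (simp add: open_delete continuous_on_open_vimage[of UNIV])
  qed
  ultimately show ?thesis by (subst open_cproj_iff) (auto intro!: open_UN)
qed

lemma continuous_on_proj: "continuous_on (- {0}) proj"
proof -
  have "open (proj -` B \<inter> - {0})" if "open B" for B :: "'a cproj set"
  proof -
    have "proj -` B \<inter> - {0} = {z. z \<noteq> 0 \<and> proj z \<in> B}" by auto
    with that show ?thesis by (simp add: open_cproj_iff)
  qed
  then show ?thesis by (subst continuous_on_open_vimage) auto
qed

text \<open>Universal property of the quotient topology. As V is open, so is its preimage, and
  relative openness there is plain openness.\<close>

lemma continuous_on_cprojI:
  assumes "open V" "continuous_on {z. z \<noteq> 0 \<and> proj z \<in> V} (\<lambda>z. f (proj z))"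
  shows "continuous_on V f"
proof (subst continuous_on_open_vimage[OF assms(1)], intro allI impI)
  fix B :: "'b set" assume "open B"
  let ?S = "{z. z \<noteq> 0 \<and> proj z \<in> V}"
  have "open ?S" using assms(1) by (simp add: open_cproj_iff)
  then have "open ((\<lambda>z. f (proj z)) -` B \<inter> ?S)"
    using assms(2) \<open>open B\<close> by (simp add: continuous_on_open_vimage)
  moreover have "(\<lambda>z. f (proj z)) -` B \<inter> ?S = {z. z \<noteq> 0 \<and> proj z \<in> f -` B \<inter> V}" by auto
  ultimately show "open (f -` B \<inter> V)" by (simp add: open_cproj_iff)
qed

lemma tendsto_proj:
  assumes "(f \<longlongrightarrow> z) F" "z \<noteq> 0"
  shows "((\<lambda>x. proj (f x)) \<longlongrightarrow> proj z) F"
proof -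
  have "isCont proj z"
    using continuous_on_proj continuous_on_eq_continuous_at[of "- {0}" proj] assms(2)
    by (auto simp: open_Compl)
  with assms(1) show ?thesis by (rule isCont_tendsto_compose[rotated])
qed

lemma continuous_on_proj_compose:
  assumes "continuous_on S f" "\<And>x. x \<in> S \<Longrightarrow> f x \<noteq> 0"
  shows "continuous_on S (\<lambda>x. proj (f x))"
  using assms by (auto simp: continuous_on_def intro: tendsto_proj)

lemma norm_vector_scalar_mult: "norm (c *s z) = cmod c * norm (z :: complex ^ 'n)"
  by (simp add: norm_vec_def norm_mult L2_set_right_distrib)

text \<open>The orthogonal projector onto the line p embeds projective space into a space of matrices, which gives the Hausdorff property.\<close>

definition line_projector :: "'m::finite cproj \<Rightarrow> complex ^ ('m option) ^ ('m option)" where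
  "line_projector p = (\<chi> i j. rep_cproj p $ i * cnj (rep_cproj p $ j) / of_real ((norm (rep_cproj p))\<^sup>2))"

lemma line_projector_proj:
  assumes "z \<noteq> 0"
  shows "line_projector (proj z) = (\<chi> i j. z $ i * cnj (z $ j) / of_real ((norm z)\<^sup>2))"
proof -
  obtain c where c: "c \<noteq> 0" "rep_cproj (proj z) = c *s z"
    using proj_eq_iff_nz[of z "rep_cproj (proj z)"] assms by auto
  have "complex_of_real ((cmod c)\<^sup>2) = c * cnj c" by (rule complex_norm_square)
  then have "complex_of_real ((norm (rep_cproj (proj z)))\<^sup>2) = (c * cnj c) * of_real ((norm z)\<^sup>2)"
    unfolding c(2) norm_vector_scalar_mult power_mult_distrib of_real_mult by simp
  then have "rep_cproj (proj z) $ i * cnj (rep_cproj (proj z) $ j) / of_real ((norm (rep_cproj (proj z)))\<^sup>2)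
    = z $ i * cnj (z $ j) / of_real ((norm z)\<^sup>2)" for i j
    using c by (simp add: field_simps)
  then show ?thesis by (simp only: line_projector_def)
qed

lemma continuous_on_line_projector: "continuous_on UNIV line_projector"
proof (rule continuous_on_cprojI)
  have "continuous_on {z. z \<noteq> 0}
     (\<lambda>z :: complex ^ ('a option). (\<chi> i j. z $ i * cnj (z $ j) / of_real ((norm z)\<^sup>2)) :: complex ^ ('a option) ^ ('a option))"
    by (intro continuous_intros) auto
  then have "continuous_on {z :: complex ^ ('a option). z \<noteq> 0} (\<lambda>z. line_projector (proj z))"
    by (rule continuous_on_eq) (simp add: line_projector_proj)
  then show "continuous_on {z :: complex ^ ('a option). z \<noteq> 0 \<and> proj z \<in> UNIV} (\<lambda>z. line_projector (proj z))"
    by simp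
qed auto

lemma inj_line_projector: "inj line_projector"
proof (rule injI)
  fix p q :: "'a cproj" assume eq: "line_projector p = line_projector q"
  obtain z where z: "z \<noteq> 0" "p = proj z" by (rule proj_cases)
  obtain w where w: "w \<noteq> 0" "q = proj w" by (rule proj_cases)
  obtain j where j: "z $ j \<noteq> 0" using z by (auto simp: vec_eq_iff)
  define A where "A = cnj (z $ j) / of_real ((norm z)\<^sup>2)"
  define B where "B = cnj (w $ j) / of_real ((norm w)\<^sup>2)"
  have e: "z $ i * A = w $ i * B" for i
    using eq z w by (simp add: line_projector_proj vec_eq_iff A_def B_def)
  have "A \<noteq> 0" using j z by (simp add: A_def)
  then have "B \<noteq> 0" using e[of j] j by auto
  then have "w $ i = (A / B) * z $ i" for i
    using e[of i] by (simp add: field_simps)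
  then have "w = (A / B) *s z" by (simp add: vec_eq_iff)
  then have "\<exists>c. w = c *s z" by (rule exI)
  then show "p = q" using proj_eq_iff[OF z(1) w(1)] z(2) w(2) by simp
qed

instance cproj :: (finite) t2_space
proof
  fix p q :: "'a cproj" assume "p \<noteq> q"
  then have "line_projector p \<noteq> line_projector q" using inj_line_projector by (auto dest: injD)
  then obtain U V where UV: "open U" "open V" "line_projector p \<in> U" "line_projector q \<in> V" "U \<inter> V = {}"
    using hausdorff[OF \<open>line_projector p \<noteq> line_projector q\<close>] by auto
  have "open (line_projector -` U)" "open (line_projector -` V)"
    using continuous_on_line_projector UV by (auto simp: continuous_on_open_vimage)
  then show "\<exists>U V. open U \<and> open V \<and> p \<in> U \<and> q \<in> V \<and> U \<inter> V = {}"
    using UV by (intro exI[of _ "line_projector -` U"] exI[of _ "line_projector -` V"]) auto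
qed

instance cproj :: (finite) second_countable_topology
proof
  obtain B :: "(complex ^ ('a option)) set set" where B: "countable B" "topological_basis B"
    using ex_countable_basis by blast
  let ?C = "(\<lambda>S. proj ` (S - {0})) ` B"
  have "topological_basis ?C"
  proof (rule topological_basisI)
    fix S assume "S \<in> ?C"
    then show "open S" using B topological_basis_open by (auto intro!: open_proj_image)
  next
    fix U :: "'a cproj set" and p assume U: "open U" "p \<in> U"
    obtain z where z: "z \<noteq> 0" "p = proj z" by (rule proj_cases)
    then obtain S where S: "S \<in> B" "z \<in> S" "S \<subseteq> {z. z \<noteq> 0 \<and> proj z \<in> U}"
      using topological_basisE[OF B(2), of "{z. z \<noteq> 0 \<and> proj z \<in> U}" z] U
      by (auto simp: open_cproj_iff)
    then show "\<exists>B'\<in>?C. p \<in> B' \<and> B' \<subseteq> U" using z by blast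
  qed
  then show "\<exists>B :: 'a cproj set set. countable B \<and> open = generate_topology B"
    using B(1) by (intro exI[of _ ?C]) (auto simp: topological_basis_imp_subbasis)
qed

section \<open>Affine charts and lifts of convergent sequences\<close>

definition affine_dom :: "'m::finite option \<Rightarrow> 'm cproj set" where
  "affine_dom i = {proj z |z. z \<noteq> 0 \<and> z $ i \<noteq> 0}"

lemma proj_in_affine_dom:
  assumes "z \<noteq> 0"
  shows "proj z \<in> affine_dom i \<longleftrightarrow> z $ i \<noteq> 0"
proof
  assume "proj z \<in> affine_dom i"
  then obtain w where w: "w \<noteq> 0" "w $ i \<noteq> 0" "proj w = proj z" by (auto simp: affine_dom_def)
  then obtain c where "c \<noteq> 0" "z = c *s w" using proj_eq_iff_nz[of w z] assms by auto
  then show "z $ i \<noteq> 0" using w by simp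
qed (use assms in \<open>auto simp: affine_dom_def\<close>)

lemma open_affine_dom: "open (affine_dom i :: 'm::finite cproj set)"
proof -
  have "{z :: complex ^ ('m option). z \<noteq> 0 \<and> proj z \<in> affine_dom i} = {z. z $ i \<noteq> 0}"
    by (metis (lifting) proj_in_affine_dom zero_index)
  moreover have "open {z :: complex ^ ('m option). z $ i \<noteq> 0}"
    by (intro open_Collect_neq continuous_intros)
  ultimately show ?thesis by (simp add: open_cproj_iff)
qed

lemma continuous_on_affine_chart: "continuous_on (affine_dom i) (affine_chart i)"
proof (rule continuous_on_cprojI[OF open_affine_dom])
  have "continuous_on {z. z $ i \<noteq> 0}
     (\<lambda>z :: complex ^ ('a option). (\<chi> j. z $ (if Some j = i then None else Some j) / z $ i) :: complex ^ 'a)"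
    by (intro continuous_intros) auto
  then have "continuous_on {z. z $ i \<noteq> 0} (\<lambda>z. affine_chart i (proj z))"
    by (rule continuous_on_eq) (subst affine_chart_proj, auto)
  moreover have "{z :: complex ^ ('a option). z \<noteq> 0 \<and> proj z \<in> affine_dom i} = {z. z $ i \<noteq> 0}"
    by (metis (lifting) proj_in_affine_dom zero_index)
  ultimately show "continuous_on {z :: complex ^ ('a option). z \<noteq> 0 \<and> proj z \<in> affine_dom i} (\<lambda>z. affine_chart i (proj z))"
    by simp
qed

text \<open>The section of \<open>affine_chart i\<close> with i-th coordinate 1. For i = Some k the
  coordinate None is read from slot k, matching the convention of the chart; for i = None the branch
  with \<open>the i\<close> is never reached.\<close>

definition affine_lift :: "'m::finite option \<Rightarrow> complex ^ 'm \<Rightarrow> complex ^ ('m option)" where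
  "affine_lift i y = (\<chi> k. if k = i then 1 else case k of None \<Rightarrow> y $ the i | Some j \<Rightarrow> y $ j)"

lemma affine_lift_nth [simp]: "affine_lift i y $ i = 1"
  by (simp add: affine_lift_def)

lemma affine_lift_nonzero [simp]: "affine_lift i y \<noteq> 0"
  using affine_lift_nth[of i y] by (metis zero_index zero_neq_one)

lemma affine_chart_lift [simp]: "affine_chart i (proj (affine_lift i y)) = y"
  by (subst affine_chart_proj) (auto simp: vec_eq_iff affine_lift_def)

lemma affine_lift_chart:
  assumes "z $ i \<noteq> 0"
  shows "affine_lift i (affine_chart i (proj z)) = inverse (z $ i) *s z"
proof -
  have "z \<noteq> 0" using assms by auto
  then show ?thesis using assms
    by (cases i) (auto simp: affine_chart_proj vec_eq_iff affine_lift_def field_simps split: option.splits)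
qed

lemma proj_affine_lift_chart:
  assumes "p \<in> affine_dom i"
  shows "proj (affine_lift i (affine_chart i p)) = p"
proof -
  obtain z where "z \<noteq> 0" "z $ i \<noteq> 0" "p = proj z" using assms by (auto simp: affine_dom_def)
  then show ?thesis by (simp add: affine_lift_chart)
qed

lemma proj_affine_lift_in [simp]: "proj (affine_lift i y) \<in> affine_dom i"
  by (simp add: proj_in_affine_dom)

lemma continuous_on_affine_lift: "continuous_on S (affine_lift i)"
  unfolding affine_lift_def
proof (intro continuous_intros)
  fix k show "continuous_on S (\<lambda>y. if k = i then 1 else case k of None \<Rightarrow> y $ the i | Some j \<Rightarrow> y $ j)"
    by (cases "k = i"; cases k) (auto intro!: continuous_intros)
qed

text \<open>Rescale the affine lift in a chart with z_i nonzero by z_i. The sequence enters the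
  chart domain only eventually, hence the eventual form.\<close>

lemma tendsto_proj_lift:
  assumes "(\<lambda>n. p n) \<longlonglongrightarrow> proj z" "z \<noteq> 0"
  obtains w where "w \<longlonglongrightarrow> z" "\<forall>\<^sub>F n in sequentially. w n \<noteq> 0 \<and> proj (w n) = p n"
proof -
  obtain i where i: "z $ i \<noteq> 0" using assms(2) by (auto simp: vec_eq_iff)
  let ?w = "\<lambda>n. z $ i *s affine_lift i (affine_chart i (p n))"
  have zd: "proj z \<in> affine_dom i" using i assms(2) by (simp add: proj_in_affine_dom)
  have ev: "\<forall>\<^sub>F n in sequentially. p n \<in> affine_dom i"
    using topological_tendstoD[OF assms(1) open_affine_dom zd] .
  have "isCont (affine_chart i) (proj z)"
    using continuous_on_affine_chart zd open_affine_dom continuous_on_eq_continuous_at by blast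
  then have "(\<lambda>n. affine_chart i (p n)) \<longlonglongrightarrow> affine_chart i (proj z)"
    using assms(1) by (rule isCont_tendsto_compose)
  moreover have "isCont (affine_lift i) y" for y
    using continuous_on_affine_lift[of UNIV] continuous_on_eq_continuous_at by blast
  ultimately have "(\<lambda>n. affine_lift i (affine_chart i (p n))) \<longlonglongrightarrow> affine_lift i (affine_chart i (proj z))"
    by (rule isCont_tendsto_compose[rotated])
  then have "?w \<longlonglongrightarrow> z $ i *s affine_lift i (affine_chart i (proj z))"
    unfolding vector_scalar_mult_def by (intro tendsto_intros)
  also have "z $ i *s affine_lift i (affine_chart i (proj z)) = z"
    using i by (simp add: affine_lift_chart vector_smult_assoc)
  finally have "?w \<longlonglongrightarrow> z" .
  moreover have "\<forall>\<^sub>F n in sequentially. ?w n \<noteq> 0 \<and> proj (?w n) = p n"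
    using ev by eventually_elim (use i in \<open>simp add: proj_affine_lift_chart\<close>)
  ultimately show ?thesis using that by blast
qed

text \<open>Allows subsequences to be extracted on the unit sphere upstairs. K is closed by the
  Hausdorff property.\<close>

lemma compact_unit_lifts:
  assumes "compact K"
  shows "compact {z :: complex ^ ('m::finite option). norm z = 1 \<and> proj z \<in> K}"
proof -
  have "closed K" using assms by (rule compact_imp_closed)
  then have "open {z :: complex ^ ('m option). z \<noteq> 0 \<and> proj z \<in> - K}" using open_cproj_iff[of "- K"] by (simp add: open_Compl)
  then have "compact (sphere 0 1 \<inter> - {z :: complex ^ ('m option). z \<noteq> 0 \<and> proj z \<in> - K})"
    by (intro compact_Int_closed) auto
  also have "sphere 0 1 \<inter> - {z :: complex ^ ('m option). z \<noteq> 0 \<and> proj z \<in> - K} = {z. norm z = 1 \<and> proj z \<in> K}"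
    by auto
  finally show ?thesis .
qed

lemma unit_lift:
  obtains z where "norm z = 1" "proj z = p"
proof -
  obtain w where w: "w \<noteq> 0" "p = proj w" by (rule proj_cases)
  have "norm (of_real (inverse (norm w)) *s w) = 1" using w by (simp add: norm_vector_scalar_mult norm_inverse)
  moreover have "proj (of_real (inverse (norm w)) *s w) = p" using w by simp
  ultimately show ?thesis using that by blast
qed

section \<open>The Lorentzian form\<close>

definition signature :: "'m option \<Rightarrow> real" where
  "signature i = (case i of None \<Rightarrow> - 1 | Some _ \<Rightarrow> 1)"

lemma signature_simps [simp]: "signature None = - 1" "signature (Some j) = 1"
  by (simp_all add: signature_def)

lemma signature_square [simp]: "signature i * signature i = 1"
  by (cases i) auto

text \<open>Translates between the form and the Euclidean inner product, so that Cauchy-Schwarz and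
  dimension counts become available.\<close>

definition flip :: "real ^ ('m::finite option) \<Rightarrow> real ^ ('m option)" where
  "flip x = (\<chi> i. signature i * x $ i)"

lemma flip_nth [simp]: "flip x $ i = signature i * x $ i"
  by (simp add: flip_def)

lemma flip_flip [simp]: "flip (flip x) = x"
  by (simp add: vec_eq_iff mult.assoc[symmetric])

lemma flip_eq_0_iff [simp]: "flip x = 0 \<longleftrightarrow> x = 0"
  by (metis flip_flip flip_nth mult_zero_right vec_eq_iff zero_index)

lemma sum_option: "(\<Sum>i\<in>UNIV. f i) = f None + (\<Sum>j\<in>UNIV. f (Some (j :: 'm::finite)))"
  by (simp add: UNIV_option_conv sum.reindex)

lemma norm_flip [simp]: "norm (flip x) = norm x"
proof -
  have "(signature i * x $ i)\<^sup>2 = (x $ i)\<^sup>2" for i by (cases i) auto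
  then show ?thesis by (simp add: norm_vec_def L2_set_def)
qed

lemma lor_inner: "lor x y = flip x \<bullet> y"
  by (simp add: lor_def inner_vec_def sum_option)

lemma lor_inner2: "lor x y = x \<bullet> flip y"
  by (simp add: lor_def inner_vec_def sum_option)

lemma bounded_linear_flip: "bounded_linear flip"
proof
  show "flip (x + y) = flip x + flip y" for x y by (simp add: vec_eq_iff algebra_simps)
  show "flip (r *\<^sub>R x) = r *\<^sub>R flip x" for r x by (simp add: vec_eq_iff)
  show "\<exists>K. \<forall>x. norm (flip x) \<le> norm x * K" by (intro exI[of _ 1]) simp
qed

lemma bounded_bilinear_lor: "bounded_bilinear lor"
  unfolding lor_inner[abs_def]
  by (rule bounded_bilinear.comp1[OF bounded_bilinear_inner bounded_linear_flip])

interpretation lor: bounded_bilinear lor by (rule bounded_bilinear_lor)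

lemmas lor_simps = lor.add_left lor.add_right lor.diff_left lor.diff_right lor.scaleR_left lor.scaleR_right
  lor.zero_left lor.zero_right lor.minus_left lor.minus_right lor.sum_left lor.sum_right
declare lor.zero_left [simp] lor.zero_right [simp]
declare lor.tendsto [tendsto_intros] lor.continuous_on [continuous_intros]

lemma lor_commute: "lor x y = lor y x"
  by (simp add: lor_def mult.commute)

lemma lor_nondegenerate: "(\<And>x. lor x y = 0) \<Longrightarrow> y = 0"
  by (metis flip_flip inner_eq_zero_iff lor_inner)

lemma abs_lor_le: "\<bar>lor x y\<bar> \<le> norm x * norm y"
  by (metis lor_inner Cauchy_Schwarz_ineq2 norm_flip)

definition tvec :: "real ^ ('m::finite option)" where
  "tvec = axis None 1"

definition space_part :: "real ^ ('m::finite option) \<Rightarrow> real ^ 'm" where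
  "space_part x = (\<chi> j. x $ Some j)"

lemma space_part_nth [simp]: "space_part x $ j = x $ Some j"
  by (simp add: space_part_def)

lemma lor_space_part: "lor x y = space_part x \<bullet> space_part y - x $ None * y $ None"
  by (simp add: lor_def inner_vec_def)

lemma lor_self: "lor x x = (norm (space_part x))\<^sup>2 - (x $ None)\<^sup>2"
  unfolding lor_space_part power2_norm_eq_inner by (simp add: power2_eq_square)

lemma lor_tvec [simp]: "lor tvec x = - x $ None" "lor x tvec = - x $ None"
  by (simp_all add: lor_def tvec_def axis_def)

lemma tvec_nth [simp]: "tvec $ None = 1" "tvec $ Some j = 0"
  by (simp_all add: tvec_def axis_def)

lemma norm_vec_option: "(norm (x :: real ^ ('m::finite option)))\<^sup>2 = (norm (space_part x))\<^sup>2 + (x $ None)\<^sup>2"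
  unfolding power2_norm_eq_inner by (simp add: inner_vec_def sum_option power2_eq_square)

lemma tvec_nonzero [simp]: "tvec \<noteq> 0"
  by (metis tvec_nth(1) zero_index zero_neq_one)

text \<open>Orthogonality equates the products of the time coordinates and of the space parts;
  Cauchy-Schwarz then bounds the time coordinate of x by a multiple of its space part, with a factor
  below 1 because t is timelike.\<close>

lemma timelike_orthogonal:
  assumes "lor t t < 0" "lor t x = 0"
  shows "lor x x \<ge> (1 - (norm (space_part t))\<^sup>2 / (t $ None)\<^sup>2) * (norm (space_part x))\<^sup>2"
    and "(norm (space_part t))\<^sup>2 / (t $ None)\<^sup>2 < 1"
proof -
  have t: "(norm (space_part t))\<^sup>2 < (t $ None)\<^sup>2" using assms(1) by (simp add: lor_self)
  then have pos: "(t $ None)\<^sup>2 > 0" using zero_le_power2 order_le_less_trans by blast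
  then show "(norm (space_part t))\<^sup>2 / (t $ None)\<^sup>2 < 1" using t by simp
  have "(t $ None * x $ None)\<^sup>2 = (space_part t \<bullet> space_part x)\<^sup>2"
    using assms(2) by (simp add: lor_space_part)
  also have "\<dots> \<le> (norm (space_part t))\<^sup>2 * (norm (space_part x))\<^sup>2"
    by (metis Cauchy_Schwarz_ineq power2_norm_eq_inner)
  finally have "(x $ None)\<^sup>2 \<le> (norm (space_part t))\<^sup>2 / (t $ None)\<^sup>2 * (norm (space_part x))\<^sup>2"
    using pos by (simp add: power_mult_distrib field_simps)
  then show "lor x x \<ge> (1 - (norm (space_part t))\<^sup>2 / (t $ None)\<^sup>2) * (norm (space_part x))\<^sup>2"
    by (simp add: lor_self algebra_simps)
qed

lemma timelike_orthogonal_bound: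
  assumes "lor t t < 0"
  obtains c where "c > 0" "\<And>x. lor t x = 0 \<Longrightarrow> lor x x \<ge> c * (norm x)\<^sup>2"
proof -
  define r where "r = (norm (space_part t))\<^sup>2 / (t $ None)\<^sup>2"
  have r: "0 \<le> r" "r < 1" using timelike_orthogonal(2)[OF assms, of 0] by (simp_all add: r_def)
  \<comment> \<open>The factor 1/2 appears because the squared norm of x is at most twice that of
    its space part.\<close>
  show ?thesis
  proof (rule that[of "(1 - r) / 2"])
    show "(1 - r) / 2 > 0" using r by simp
    fix x assume "lor t x = 0"
    then have le: "lor x x \<ge> (1 - r) * (norm (space_part x))\<^sup>2"
      using timelike_orthogonal(1)[OF assms] by (simp add: r_def)
    then have "lor x x \<ge> 0" using r by (meson dual_order.trans mult_nonneg_nonneg zero_le_power2 diff_ge_0_iff_ge less_imp_le)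
    then have "(x $ None)\<^sup>2 \<le> (norm (space_part x))\<^sup>2" by (simp add: lor_self)
    then have "(norm x)\<^sup>2 \<le> 2 * (norm (space_part x))\<^sup>2" by (simp add: norm_vec_option)
    then have "(1 - r) / 2 * (norm x)\<^sup>2 \<le> (1 - r) / 2 * (2 * (norm (space_part x))\<^sup>2)"
      using r by (intro mult_left_mono) auto
    with le show "lor x x \<ge> (1 - r) / 2 * (norm x)\<^sup>2" by simp
  qed
qed

lemma timelike_orthogonal_pos:
  assumes "lor t t < 0" "lor t x = 0" "x \<noteq> 0"
  shows "lor x x > 0"
proof -
  obtain c where c: "c > 0" "\<And>x. lor t x = 0 \<Longrightarrow> lor x x \<ge> c * (norm x)\<^sup>2"
    using timelike_orthogonal_bound[OF assms(1)] by blast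
  have "c * (norm x)\<^sup>2 > 0" using c(1) assms(3) by simp
  with c(2)[OF assms(2)] show ?thesis by linarith
qed

lemma null_nth_None:
  assumes "lor p p = 0" "p \<noteq> 0"
  shows "p $ None \<noteq> 0"
proof
  assume "p $ None = 0"
  then have "lor tvec p = 0" by simp
  then show False using timelike_orthogonal_pos[of tvec p] assms by simp
qed

text \<open>Subtracting the multiple of p with the same time coordinate keeps the value of the form
  and leaves a vector orthogonal to \<open>tvec\<close>, where the form is positive
  definite.\<close>

lemma null_orthogonal:
  assumes "lor p p = 0" "p \<noteq> 0" "lor p x = 0"
  shows "lor x x \<ge> 0" and "lor x x = 0 \<Longrightarrow> \<exists>c. x = c *\<^sub>R p"
proof -
  define c where "c = x $ None / p $ None"
  define y where "y = x - c *\<^sub>R p"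
  have "lor tvec y = 0" using null_nth_None[OF assms(1,2)] by (simp add: y_def c_def)
  then have y: "y = 0 \<or> lor y y > 0" using timelike_orthogonal_pos[of tvec y] by auto
  moreover have xy: "lor x x = lor y y" using assms by (simp add: y_def lor_simps lor_commute[of x p])
  ultimately show "lor x x \<ge> 0" by auto
  assume "lor x x = 0"
  then have "y = 0" using xy y by simp
  then show "\<exists>c. x = c *\<^sub>R p" by (auto simp: y_def)
qed

lemma null_null_orthogonal:
  assumes "lor p p = 0" "p \<noteq> 0" "lor q q = 0" "lor p q = 0"
  shows "\<exists>c. q = c *\<^sub>R p"
  using null_orthogonal(2)[of p q] assms by auto

text \<open>Depending on the sign of \<open>lor p q\<close>, one of p + q and p - q is timelike, and
  its orthogonal complement contains that of p and q.\<close>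

lemma null_pair_complement:
  assumes "lor p p = 0" "lor q q = 0" "lor p q \<noteq> 0"
  obtains c where "c > 0" "\<And>x. lor p x = 0 \<Longrightarrow> lor q x = 0 \<Longrightarrow> lor x x \<ge> c * (norm x)\<^sup>2"
proof -
  define t where "t = p - (sgn (lor p q)) *\<^sub>R q"
  have "lor t t = - 2 * \<bar>lor p q\<bar>"
    using assms by (simp add: t_def lor_simps lor_commute[of q p] abs_sgn algebra_simps)
  then have "lor t t < 0" using assms by simp
  then obtain c where "c > 0" "\<And>x. lor t x = 0 \<Longrightarrow> lor x x \<ge> c * (norm x)\<^sup>2"
    using timelike_orthogonal_bound by blast
  then show ?thesis by (intro that[of c]) (auto simp: t_def lor_simps)
qed

text \<open>Fewer than m + 1 vectors cannot span; flipping them trades the form for the inner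
  product.\<close>

lemma exists_lor_orthogonal:
  fixes S :: "(real ^ ('m::finite option)) set"
  assumes "finite S" "card S < CARD('m) + 1"
  shows "\<exists>s. s \<noteq> 0 \<and> (\<forall>x\<in>S. lor x s = 0)"
proof -
  have "dim (flip ` S) \<le> card (flip ` S)" using assms by (intro dim_le_card') auto
  also have "\<dots> \<le> card S" using assms by (intro card_image_le)
  also have "\<dots> < DIM(real ^ ('m option))" using assms by simp
  finally have "dim (flip ` S) < DIM(real ^ ('m option))" .
  then have "span (flip ` S) \<noteq> UNIV" by (metis dim_UNIV dim_span less_irrefl)
  then obtain s where "s \<noteq> 0" "\<And>x. x \<in> span (flip ` S) \<Longrightarrow> orthogonal s x"
    using orthogonal_to_subspace_exists[OF \<open>dim (flip ` S) < _\<close>] by blast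
  then have "s \<noteq> 0 \<and> (\<forall>x\<in>S. lor x s = 0)"
    by (auto simp: lor_inner orthogonal_def inner_commute[of _ s] intro: span_base)
  then show ?thesis by blast
qed

section \<open>Real and imaginary parts of complex vectors\<close>

definition cplx :: "real ^ 'n \<Rightarrow> real ^ 'n \<Rightarrow> complex ^ 'n" where
  "cplx x y = (\<chi> i. Complex (x $ i) (y $ i))"

definition re_vec :: "complex ^ 'n \<Rightarrow> real ^ 'n" where
  "re_vec z = (\<chi> i. Re (z $ i))"

definition im_vec :: "complex ^ 'n \<Rightarrow> real ^ 'n" where
  "im_vec z = (\<chi> i. Im (z $ i))"

abbreviation real_vec :: "real ^ 'n \<Rightarrow> complex ^ 'n" where
  "real_vec x \<equiv> cplx x 0"

lemma cplx_nth [simp]: "cplx x y $ i = Complex (x $ i) (y $ i)"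
  by (simp add: cplx_def)

lemma re_vec_nth [simp]: "re_vec z $ i = Re (z $ i)"
  by (simp add: re_vec_def)

lemma im_vec_nth [simp]: "im_vec z $ i = Im (z $ i)"
  by (simp add: im_vec_def)

lemma cplx_re_im [simp]: "cplx (re_vec z) (im_vec z) = z"
  by (simp add: vec_eq_iff complex_eq_iff)

lemma re_vec_cplx [simp]: "re_vec (cplx x y) = x" and im_vec_cplx [simp]: "im_vec (cplx x y) = y"
  by (simp_all add: vec_eq_iff)

lemma cplx_eq_0_iff [simp]: "cplx x y = 0 \<longleftrightarrow> x = 0 \<and> y = 0"
  by (auto simp: vec_eq_iff complex_eq_iff)

lemma re_vec_simps [simp]:
  "re_vec (z + w) = re_vec z + re_vec w" "re_vec (z - w) = re_vec z - re_vec w"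
  "re_vec (c *s z) = Re c *\<^sub>R re_vec z - Im c *\<^sub>R im_vec z" "re_vec 0 = 0" "re_vec (r *\<^sub>R z) = r *\<^sub>R re_vec z"
  by (simp_all add: vec_eq_iff)

lemma im_vec_simps [simp]:
  "im_vec (z + w) = im_vec z + im_vec w" "im_vec (z - w) = im_vec z - im_vec w"
  "im_vec (c *s z) = Re c *\<^sub>R im_vec z + Im c *\<^sub>R re_vec z" "im_vec 0 = 0" "im_vec (r *\<^sub>R z) = r *\<^sub>R im_vec z"
  by (simp_all add: vec_eq_iff)

lemma complex_vec_eq_iff: "z = w \<longleftrightarrow> re_vec z = re_vec w \<and> im_vec z = im_vec w"
  by (metis cplx_re_im)

lemma cmat_mult_vec: "cmat A *v z = cplx (A *v re_vec z) (A *v im_vec z)"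
  by (simp add: vec_eq_iff complex_eq_iff matrix_vector_mult_def cmat_def)

lemma re_vec_cmat [simp]: "re_vec (cmat A *v z) = A *v re_vec z"
  and im_vec_cmat [simp]: "im_vec (cmat A *v z) = A *v im_vec z"
  by (simp_all add: cmat_mult_vec)

lemma cmat_mult: "cmat (A ** B) = cmat A ** cmat B"
  by (simp add: vec_eq_iff cmat_def matrix_matrix_mult_def)

lemma cmat_one: "cmat (mat 1) = mat 1"
  by (simp add: vec_eq_iff cmat_def mat_def)

lemma inj_cmat: "inj cmat"
  by (rule injI) (simp add: vec_eq_iff cmat_def)

lemma bounded_linear_re_vec: "bounded_linear (re_vec :: complex ^ 'n::finite \<Rightarrow> _)"
  unfolding linear_conv_bounded_linear[symmetric] by (rule linearI) simp_all

lemma bounded_linear_im_vec: "bounded_linear (im_vec :: complex ^ 'n::finite \<Rightarrow> _)"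
  unfolding linear_conv_bounded_linear[symmetric] by (rule linearI) simp_all

lemmas re_vec_tendsto [tendsto_intros] = bounded_linear.tendsto[OF bounded_linear_re_vec]
lemmas im_vec_tendsto [tendsto_intros] = bounded_linear.tendsto[OF bounded_linear_im_vec]

lemma cplx_tendsto [tendsto_intros]:
  assumes "(f \<longlongrightarrow> x) F" "(g \<longlongrightarrow> y) F"
  shows "((\<lambda>n. cplx (f n) (g n)) \<longlongrightarrow> cplx x y) F"
  unfolding cplx_def using assms
  by (intro tendsto_intros tendsto_Complex)

section \<open>The orthogonal group of the form\<close>

definition lorentz :: "real ^ ('m::finite option) ^ ('m option) \<Rightarrow> bool" where
  "lorentz A \<longleftrightarrow> (\<forall>x y. lor (A *v x) (A *v y) = lor x y)"

text \<open>The adjoint with respect to the form. It inverts Lorentz matrices but, unlike the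
  inverse, it is linear and preserves the norm, so it passes to limits of normalised
  sequences.\<close>

definition lor_adj :: "real ^ ('m::finite option) ^ ('m option) \<Rightarrow> real ^ ('m option) ^ ('m option)" where
  "lor_adj A = (\<chi> i j. signature i * signature j * A $ j $ i)"

lemma lor_adj_mult: "lor_adj A *v x = flip (transpose A *v flip x)"
  by (simp add: lor_adj_def vec_eq_iff matrix_vector_mult_def transpose_def sum_distrib_left mult_ac)

lemma lor_adj: "lor (lor_adj A *v x) y = lor x (A *v y)"
  by (simp add: lor_adj_mult lor_inner dot_lmul_matrix)

lemma lor_adj2: "lor x (lor_adj A *v y) = lor (A *v x) y"
  by (metis lor_adj lor_commute)

lemma norm_lor_adj [simp]: "norm (lor_adj A) = norm A"
proof -
  have "norm (lor_adj A) = norm (transpose A)"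
  proof -
    have "(signature i * signature j * A $ j $ i)\<^sup>2 = (A $ j $ i)\<^sup>2" for i j
      by (cases i; cases j) auto
    then show ?thesis by (simp add: norm_vec_def L2_set_def lor_adj_def transpose_def sum_nonneg)
  qed
  also have "\<dots> = norm A"
    by (simp add: norm_vec_def L2_set_def transpose_def sum_nonneg) (subst sum.swap, rule refl)
  finally show ?thesis .
qed

lemma lorentz_adj_left:
  assumes "lorentz A"
  shows "lor_adj A ** A = mat 1"
proof -
  have "lor_adj A *v (A *v y) - y = 0" for y
  proof (rule lor_nondegenerate)
    fix x show "lor x (lor_adj A *v (A *v y) - y) = 0"
      using assms by (simp add: lor_simps lor_adj2 lorentz_def)
  qed
  then show ?thesis by (simp add: matrix_eq matrix_vector_mul_assoc[symmetric])
qed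

lemma lorentz_adj_right:
  assumes "lorentz A"
  shows "A ** lor_adj A = mat 1"
  using lorentz_adj_left[OF assms] by (simp add: matrix_left_right_inverse)

lemma lorentz_adj_mult [simp]:
  assumes "lorentz A"
  shows "lor_adj A *v (A *v x) = x" "A *v (lor_adj A *v x) = x"
  using assms by (simp_all add: matrix_vector_mul_assoc lorentz_adj_left lorentz_adj_right)

lemma lorentz_lor: "lorentz A \<Longrightarrow> lor (A *v x) (A *v y) = lor x y"
  by (simp add: lorentz_def)

lemma lorentz_lor_adj:
  assumes "lorentz A"
  shows "lorentz (lor_adj A)"
  unfolding lorentz_def using assms by (metis lorentz_adj_mult(2) lorentz_lor)

lemma lorentz_mult:
  assumes "lorentz A" "lorentz B"
  shows "lorentz (A ** B)"
  using assms by (simp add: lorentz_def matrix_vector_mul_assoc[symmetric])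

lemma lorentz_one [simp]: "lorentz (mat 1)"
  by (simp add: lorentz_def)

lemma lorentz_eq_0_iff [simp]:
  assumes "lorentz A"
  shows "A *v x = 0 \<longleftrightarrow> x = 0"
  by (metis assms lorentz_adj_mult(1) matrix_vector_mult_0_right)

lemma lorentz_invertible_cmat:
  assumes "lorentz A"
  shows "invertible (cmat A)"
  unfolding invertible_def
  by (metis assms cmat_mult cmat_one lorentz_adj_left lorentz_adj_right)

lemma cmat_eq_0_iff [simp]:
  assumes "lorentz A"
  shows "cmat A *v z = 0 \<longleftrightarrow> z = 0"
  using assms by (simp add: complex_vec_eq_iff)

lemma pact_cmat:
  assumes "lorentz A" "z \<noteq> 0"
  shows "pact (cmat A) (proj z) = proj (cmat A *v z)"
  using assms by (intro pact_proj lorentz_invertible_cmat)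

section \<open>Points of projective space in terms of real vectors\<close>

lemma herm_self: "herm z z = of_real (lor (re_vec z) (re_vec z) + lor (im_vec z) (im_vec z))"
proof -
  have "z $ i * cnj (z $ i) = of_real ((Re (z $ i))\<^sup>2 + (Im (z $ i))\<^sup>2)" for i
    by (simp add: complex_mult_cnj)
  then show ?thesis
    by (simp add: herm_def lor_def power2_eq_square sum.distrib)
qed

lemma herm_scale: "herm (c *s z) (c *s z) = of_real ((cmod c)\<^sup>2) * herm z z"
proof -
  have "herm (c *s z) (c *s z) = c * cnj c * herm z z"
    by (simp add: herm_def algebra_simps sum_distrib_left)
  then show ?thesis by (simp only: complex_norm_square)
qed

lemma PR_real_vec: "PR = {proj (real_vec x) |x. x \<noteq> 0}"
proof (intro equalityI subsetI)
  fix p :: "'a cproj" assume "p \<in> PR"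
  then obtain z where z: "z \<noteq> 0" "p = proj z" "\<And>i. z $ i \<in> \<real>" by (auto simp: PR_def)
  then have "z = real_vec (re_vec z)" by (simp add: vec_eq_iff complex_eq_iff complex_is_Real_iff)
  with z(1,2) show "p \<in> {proj (real_vec x) |x. x \<noteq> 0}" by (metis (mono_tags, lifting) cplx_eq_0_iff mem_Collect_eq)
next
  fix p :: "'a cproj" assume "p \<in> {proj (real_vec x) |x. x \<noteq> 0}"
  then obtain x where "x \<noteq> 0" "p = proj (real_vec x)" by auto
  moreover have "\<forall>i. real_vec x $ i \<in> \<real>" by (simp add: complex_is_Real_iff)
  ultimately show "p \<in> PR" unfolding PR_def by (auto intro!: exI[of _ "real_vec x"] simp del: cplx_nth)
qed

lemma proj_in_HC:
  assumes "z \<noteq> 0"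
  shows "proj z \<in> HC \<longleftrightarrow> Re (herm z z) < 0"
proof
  assume "proj z \<in> HC"
  then obtain w where w: "w \<noteq> 0" "Re (herm w w) < 0" "proj w = proj z" by (auto simp: HC_def)
  then obtain c where c: "c \<noteq> 0" "z = c *s w" using proj_eq_iff_nz[of w z] assms by auto
  then have "Re (herm z z) = (cmod c)\<^sup>2 * Re (herm w w)" by (simp only: herm_scale Re_complex_of_real times_complex.sel Im_complex_of_real)
  then show "Re (herm z z) < 0" using w c by (simp add: mult_pos_neg)
qed (use assms in \<open>auto simp: HC_def\<close>)

lemma proj_in_bdHC:
  assumes "z \<noteq> 0"
  shows "proj z \<in> bdHC \<longleftrightarrow> herm z z = 0"
proof
  assume "proj z \<in> bdHC"
  then obtain w where w: "w \<noteq> 0" "herm w w = 0" "proj w = proj z" by (auto simp: bdHC_def)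
  then obtain c where c: "c \<noteq> 0" "z = c *s w" using proj_eq_iff_nz[of w z] assms by auto
  then show "herm z z = 0" using w by (simp add: herm_scale)
qed (use assms in \<open>auto simp: bdHC_def\<close>)

lemma HR_real_vec: "HR = {proj (real_vec x) |x. lor x x < 0}"
proof (intro equalityI subsetI)
  fix p :: "'a cproj" assume "p \<in> HR"
  then show "p \<in> {proj (real_vec x) |x. lor x x < 0}"
    by (auto simp: HR_def PR_real_vec proj_in_HC herm_self)
next
  fix p :: "'a cproj" assume "p \<in> {proj (real_vec x) |x. lor x x < 0}"
  then obtain x where x: "lor x x < 0" "p = proj (real_vec x)" by auto
  then have "x \<noteq> 0" by auto
  with x show "p \<in> HR" by (auto simp: HR_def PR_real_vec proj_in_HC herm_self)
qed

lemma bdHR_real_vec: "bdHR = {proj (real_vec p) |p. p \<noteq> 0 \<and> lor p p = 0}"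
  by (auto simp: bdHR_def PR_real_vec proj_in_bdHC herm_self)

text \<open>The union of the hyperplanes \<open>H\<^sub>p\<close>: a real vector p is orthogonal to w if and only if it is orthogonal to the
  real and imaginary parts of w.\<close>

definition tangent_set :: "'m::finite cproj set" where
  "tangent_set = {proj z |z. z \<noteq> 0 \<and>
     (\<exists>p. p \<noteq> 0 \<and> lor p p = 0 \<and> lor p (re_vec z) = 0 \<and> lor p (im_vec z) = 0)}"

lemma proj_in_tangent_set:
  assumes "z \<noteq> 0"
  shows "proj z \<in> tangent_set \<longleftrightarrow>
    (\<exists>p. p \<noteq> 0 \<and> lor p p = 0 \<and> lor p (re_vec z) = 0 \<and> lor p (im_vec z) = 0)" (is "_ \<longleftrightarrow> ?R")
proof
  assume "proj z \<in> tangent_set"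
  then obtain w p where w: "w \<noteq> 0" "proj w = proj z"
    and p: "p \<noteq> 0" "lor p p = 0" "lor p (re_vec w) = 0" "lor p (im_vec w) = 0"
    unfolding tangent_set_def by auto
  obtain c where "z = c *s w" using proj_eq_iff_nz[of w z] assms w by auto
  then show ?R using p by (intro exI[of _ p]) (simp add: lor_simps)
qed (use assms in \<open>auto simp: tangent_set_def\<close>)

lemma bdHR_subset_tangent_set: "bdHR \<subseteq> tangent_set"
  by (auto simp: bdHR_real_vec proj_in_tangent_set)

lemma tangent_set_invariant:
  assumes "lorentz A" "p \<in> tangent_set"
  shows "pact (cmat A) p \<in> tangent_set"
proof -
  obtain z where z: "z \<noteq> 0" "p = proj z" by (rule proj_cases)
  then obtain n where n: "n \<noteq> 0" "lor n n = 0" "lor n (re_vec z) = 0" "lor n (im_vec z) = 0"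
    using assms(2) by (auto simp: proj_in_tangent_set)
  show ?thesis unfolding z(2) pact_cmat[OF assms(1) z(1)]
    using z n assms(1) by (subst proj_in_tangent_set) (auto simp: lorentz_lor intro!: exI[of _ "A *v n"])
qed

lemma compact_null_unit: "compact {p. norm p = 1 \<and> lor p p = 0}"
proof -
  have "closed {p :: real ^ ('a option). lor p p = 0}"
    by (intro closed_Collect_eq continuous_intros)
  then have "compact (sphere 0 1 \<inter> {p :: real ^ ('a option). lor p p = 0})"
    by (intro compact_Int_closed) auto
  also have "sphere 0 1 \<inter> {p :: real ^ ('a option). lor p p = 0} = {p. norm p = 1 \<and> lor p p = 0}" by auto
  finally show ?thesis .
qed

text \<open>The null vectors witnessing membership can be normalised into a compact set, and a limit
  of them witnesses membership of the limit point.\<close>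

lemma closed_tangent_set: "closed (tangent_set :: 'm::finite cproj set)"
  unfolding closed_sequential_limits
proof (intro allI impI, elim conjE)
  fix x :: "nat \<Rightarrow> 'm cproj" and l
  assume x: "\<forall>n. x n \<in> tangent_set" "x \<longlonglongrightarrow> l"
  obtain z where z: "z \<noteq> 0" "l = proj z" by (rule proj_cases)
  obtain w where w: "w \<longlonglongrightarrow> z" "\<forall>\<^sub>F n in sequentially. w n \<noteq> 0 \<and> proj (w n) = x n"
    using tendsto_proj_lift x(2) z by blast
  obtain N where N: "\<And>n. n \<ge> N \<Longrightarrow> w n \<noteq> 0 \<and> proj (w n) = x n"
    using w(2) by (auto simp: eventually_sequentially)
  have "\<exists>p. norm p = 1 \<and> lor p p = 0 \<and> lor p (re_vec (w (n + N))) = 0 \<and> lor p (im_vec (w (n + N))) = 0" for n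
  proof -
    have "proj (w (n + N)) \<in> tangent_set" "w (n + N) \<noteq> 0" using N[of "n + N"] x by auto
    then obtain p where "p \<noteq> 0" "lor p p = 0" "lor p (re_vec (w (n + N))) = 0" "lor p (im_vec (w (n + N))) = 0"
      by (auto simp: proj_in_tangent_set)
    then show ?thesis by (intro exI[of _ "inverse (norm p) *\<^sub>R p"]) (simp add: lor_simps)
  qed
  then obtain p where p: "\<And>n. norm (p n) = 1 \<and> lor (p n) (p n) = 0 \<and>
      lor (p n) (re_vec (w (n + N))) = 0 \<and> lor (p n) (im_vec (w (n + N))) = 0"
    by metis
  then obtain q r where q: "norm q = 1" "lor q q = 0" "strict_mono r" "(p \<circ> r) \<longlonglongrightarrow> q"
    using compact_null_unit[unfolded compact_def, rule_format, of p] by auto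
  have wr: "(\<lambda>n. w (r n + N)) \<longlonglongrightarrow> z"
    using LIMSEQ_subseq_LIMSEQ[OF LIMSEQ_ignore_initial_segment[OF w(1), of N] q(3)] by (simp add: o_def)
  have "(\<lambda>n. lor (p (r n)) (re_vec (w (r n + N)))) \<longlonglongrightarrow> lor q (re_vec z)"
    "(\<lambda>n. lor (p (r n)) (im_vec (w (r n + N)))) \<longlonglongrightarrow> lor q (im_vec z)"
    using q(4) wr by (auto intro!: tendsto_intros simp: o_def)
  then have "lor q (re_vec z) = 0" "lor q (im_vec z) = 0"
    using p by (simp_all add: LIMSEQ_const_iff)
  moreover have "q \<noteq> 0" using q(1) by auto
  ultimately show "l \<in> tangent_set" using q z by (auto simp: proj_in_tangent_set)
qed

section \<open>Divergent sequences of Lorentz transformations\<close>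

lemma bounded_bilinear_matrix_vector_mult: "bounded_bilinear ((*v) :: real ^ 'n ^ 'm \<Rightarrow> _)"
  unfolding bilinear_conv_bounded_bilinear[symmetric] bilinear_def
  by (auto intro!: linearI simp: vec_eq_iff matrix_vector_mult_def sum_distrib_left
    sum.distrib algebra_simps)

lemma bounded_bilinear_matrix_mult:
  "bounded_bilinear ((**) :: real ^ 'n ^ 'm \<Rightarrow> real ^ 'k ^ 'n \<Rightarrow> _)"
  unfolding bilinear_conv_bounded_bilinear[symmetric] bilinear_def
  by (auto intro!: linearI simp: vec_eq_iff matrix_matrix_mult_def sum_distrib_left
    sum.distrib algebra_simps)

lemmas tendsto_mv [tendsto_intros] = bounded_bilinear.tendsto[OF bounded_bilinear_matrix_vector_mult]
lemmas tendsto_mm [tendsto_intros] = bounded_bilinear.tendsto[OF bounded_bilinear_matrix_mult]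

lemma bounded_linear_lor_adj: "bounded_linear lor_adj"
proof
  show "lor_adj (x + y) = lor_adj x + lor_adj y" for x y :: "real ^ ('a option) ^ ('a option)"
    by (simp add: vec_eq_iff lor_adj_def algebra_simps)
  show "lor_adj (r *\<^sub>R x) = r *\<^sub>R lor_adj x" for r and x :: "real ^ ('a option) ^ ('a option)"
    by (simp add: vec_eq_iff lor_adj_def)
  show "\<exists>K. \<forall>x :: real ^ ('a option) ^ ('a option). norm (lor_adj x) \<le> norm x * K" by (intro exI[of _ 1]) simp
qed

lemmas tendsto_lor_adj [tendsto_intros] = bounded_linear.tendsto[OF bounded_linear_lor_adj]

lemma lor_adj_scaleR: "lor_adj (c *\<^sub>R A) = c *\<^sub>R lor_adj A"
  by (simp add: vec_eq_iff lor_adj_def)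

text \<open>The image is the line of p and the kernel the orthogonal complement of q: p attracts, q
  repels.\<close>

definition rank1 :: "real ^ ('m::finite option) \<Rightarrow> real ^ ('m option) \<Rightarrow> real ^ ('m option) ^ ('m option)" where
  "rank1 p q = (\<chi> i j. p $ i * (signature j * q $ j))"

lemma rank1_mult: "rank1 p q *v x = lor q x *\<^sub>R p"
  by (simp add: rank1_def vec_eq_iff matrix_vector_mult_def lor_inner inner_vec_def sum_distrib_left mult_ac)

lemma lor_adj_rank1: "lor_adj (rank1 p q) = rank1 q p"
  by (simp add: lor_adj_def rank1_def vec_eq_iff)

lemma rank1_scale: "rank1 (a *\<^sub>R p) (b *\<^sub>R q) = (a * b) *\<^sub>R rank1 p q"
  by (simp add: rank1_def vec_eq_iff mult_ac)

lemma rank1_compose: "rank1 p q ** rank1 r s = lor q r *\<^sub>R rank1 p s"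
  by (simp add: matrix_eq matrix_vector_mul_assoc[symmetric] rank1_mult lor_simps
    scaleR_matrix_vector_assoc[symmetric] matrix_vector_mult_scaleR mult.commute)

definition null_vec :: "real ^ ('m::finite option) \<Rightarrow> bool" where
  "null_vec p \<longleftrightarrow> p \<noteq> 0 \<and> lor p p = 0"

text \<open>Normalisation multiplies the form by factors tending to 0, so the image of the limit M
  is totally isotropic and hence a line; the same for the adjoints shows that q is null too.\<close>

lemma rank_one_limit:
  assumes g: "\<And>n. lorentz (g n)" and lim: "filterlim (\<lambda>n. norm (g n)) at_top sequentially"
  obtains r p q where "strict_mono r" "null_vec p" "null_vec q"
    "(\<lambda>n. inverse (norm (g (r n))) *\<^sub>R g (r n)) \<longlonglongrightarrow> rank1 p q"
proof -
  have nz: "norm (g n) > 0" for n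
    using lorentz_eq_0_iff[OF g[of n], of tvec] by auto
  define u where "u n = inverse (norm (g n)) *\<^sub>R g n" for n
  have "u n \<in> sphere 0 1" for n using nz[of n] by (simp add: u_def)
  then obtain M r where M: "norm M = 1" "strict_mono r" "(u \<circ> r) \<longlonglongrightarrow> M"
    using compact_sphere[of 0 "1 :: real"] unfolding compact_def by (metis mem_sphere_0)
  have eps: "(\<lambda>n. inverse (norm (g (r n)))) \<longlonglongrightarrow> 0"
    using filterlim_compose[OF lim filterlim_subseq[OF M(2)]] by (rule tendsto_inverse_0_at_top)
  have u: "(\<lambda>n. inverse (norm (g (r n))) *\<^sub>R g (r n)) \<longlonglongrightarrow> M"
    using M(3) by (simp add: o_def u_def)
  \<comment> \<open>Stated for a general h because the same normalisation serves g and its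
    adjoints.\<close>
  have iso: "lor (L *v x) (L *v y) = 0"
    if h: "\<And>n. lorentz (h n)" "(\<lambda>n. inverse (norm (g (r n))) *\<^sub>R h (r n)) \<longlonglongrightarrow> L" for L h x y
  proof -
    let ?e = "\<lambda>n. inverse (norm (g (r n)))"
    have "(\<lambda>n. lor ((?e n *\<^sub>R h (r n)) *v x) ((?e n *\<^sub>R h (r n)) *v y)) \<longlonglongrightarrow> lor (L *v x) (L *v y)"
      using h(2) by (intro tendsto_intros)
    moreover have "lor ((?e n *\<^sub>R h (r n)) *v x) ((?e n *\<^sub>R h (r n)) *v y) = ?e n * ?e n * lor x y" for n
      using h(1) by (simp add: scaleR_matrix_vector_assoc[symmetric] lor_simps lorentz_lor)
    moreover have "(\<lambda>n. ?e n * ?e n * lor x y) \<longlonglongrightarrow> 0 * 0 * lor x y"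
      using eps by (intro tendsto_intros)
    ultimately show ?thesis by (simp add: LIMSEQ_unique)
  qed
  have isoM: "lor (M *v x) (M *v y) = 0" for x y using iso[OF g u] .
  have isoN: "lor (lor_adj M *v x) (lor_adj M *v y) = 0" for x y
  proof (rule iso)
    show "lorentz (lor_adj (g n))" for n using g by (rule lorentz_lor_adj)
    show "(\<lambda>n. inverse (norm (g (r n))) *\<^sub>R lor_adj (g (r n))) \<longlonglongrightarrow> lor_adj M"
      using tendsto_lor_adj[OF u] by (simp add: lor_adj_scaleR)
  qed
  have "M \<noteq> 0" using M(1) by auto
  then obtain x0 where x0: "M *v x0 \<noteq> 0" by (metis matrix_eq matrix_vector_mult_0)
  define p where "p = M *v x0"
  \<comment> \<open>The coefficient of M y along p is read off with the Euclidean product, since the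
    form vanishes on p.\<close>
  define q where "q = inverse (p \<bullet> p) *\<^sub>R (lor_adj M *v flip p)"
  have p: "null_vec p" using x0 isoM by (simp add: p_def null_vec_def)
  have Mq: "M *v y = lor q y *\<^sub>R p" for y
  proof -
    obtain c where c: "M *v y = c *\<^sub>R p"
      using null_null_orthogonal[of p "M *v y"] p isoM by (auto simp: p_def null_vec_def)
    have "lor q y = inverse (p \<bullet> p) * (p \<bullet> (M *v y))"
      by (simp add: q_def lor_simps lor_adj) (simp add: lor_inner)
    then show ?thesis using c p by (simp add: null_vec_def)
  qed
  have "M = rank1 p q" by (simp add: matrix_eq rank1_mult Mq)
  moreover have "q \<noteq> 0" using \<open>M \<noteq> 0\<close> Mq by (metis lor.zero_left matrix_eq matrix_vector_mult_0 scaleR_zero_left)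
  then have "null_vec q" using isoN by (simp add: null_vec_def q_def lor_simps)
  ultimately show ?thesis using that M(2) p u by blast
qed

section \<open>Discrete groups\<close>

locale discrete_lorentz_group =
  fixes \<Gamma> :: "(real ^ ('m::finite option) ^ ('m option)) set"
  assumes lorentz_mem: "A \<in> \<Gamma> \<Longrightarrow> lorentz A"
    and one_mem: "mat 1 \<in> \<Gamma>"
    and mult_mem: "A \<in> \<Gamma> \<Longrightarrow> B \<in> \<Gamma> \<Longrightarrow> A ** B \<in> \<Gamma>"
    and adj_mem: "A \<in> \<Gamma> \<Longrightarrow> lor_adj A \<in> \<Gamma>"
    and one_isolated: "\<exists>e>0. \<forall>A\<in>\<Gamma>. norm (A - mat 1) < e \<longrightarrow> A = mat 1"
begin

text \<open>An accumulation point l satisfies \<open>lor_adj l ** l = mat 1\<close>. For A, B in S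
  close to l the element \<open>lor_adj A ** B\<close> is then close to the identity, hence equal to
  it, so A = B.\<close>

lemma finite_bounded:
  assumes "S \<subseteq> \<Gamma>" "bounded S"
  shows "finite S"
proof (rule ccontr)
  assume "infinite S"
  then obtain l where l: "l islimpt S"
    using assms(2) bounded_infinite_imp_islimpt by blast
  have "lor_adj l ** l = mat 1"
  proof -
    obtain f where f: "\<And>n. f n \<in> S - {l}" "f \<longlonglongrightarrow> l"
      using l islimpt_sequential[of l S] by auto
    have "(\<lambda>n. lor_adj (f n) ** f n) \<longlonglongrightarrow> lor_adj l ** l"
      using f(2) by (intro tendsto_intros)
    moreover have "lor_adj (f n) ** f n = mat 1" for n
      using f(1)[of n] assms(1) lorentz_mem by (auto intro: lorentz_adj_left)
    ultimately show ?thesis by (simp add: LIMSEQ_const_iff)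
  qed
  obtain e where e: "e > 0" "\<And>A. A \<in> \<Gamma> \<Longrightarrow> norm (A - mat 1) < e \<Longrightarrow> A = mat 1"
    using one_isolated by blast
  have "((\<lambda>x. lor_adj (fst x) ** snd x) \<longlongrightarrow> lor_adj l ** l) (nhds (l, l))"
    by (intro tendsto_intros tendsto_lor_adj) (auto intro!: filterlim_fst filterlim_snd simp: nhds_prod)
  then have "\<forall>\<^sub>F x in nhds (l, l). dist (lor_adj (fst x) ** snd x) (mat 1) < e"
    using e(1) \<open>lor_adj l ** l = mat 1\<close> by (simp add: tendstoD)
  then obtain d where d: "d > 0" "\<And>x. dist x (l, l) < d \<Longrightarrow> dist (lor_adj (fst x) ** snd x) (mat 1) < e"
    by (auto simp: eventually_nhds_metric)
  have same: "A = B" if "A \<in> S" "B \<in> S" "dist A l < d / 2" "dist B l < d / 2" for A B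
  proof -
    have "dist (A, B) (l, l) < d"
    proof -
      have "dist (A, B) (l, l) \<le> dist A l + dist B l"
        by (simp add: dist_Pair_Pair sqrt_sum_squares_le_sum)
      with that show ?thesis by simp
    qed
    then have "dist (lor_adj A ** B) (mat 1) < e" using d(2)[of "(A, B)"] by simp
    moreover have "lor_adj A ** B \<in> \<Gamma>" using that assms(1) by (intro mult_mem adj_mem) auto
    ultimately have "lor_adj A ** B = mat 1"
      using e(2)[of "lor_adj A ** B"] by (simp add: dist_norm)
    then have "A ** (lor_adj A ** B) = A" by simp
    then show ?thesis
      using lorentz_adj_right[of A] lorentz_mem that assms(1) by (auto simp: matrix_mul_assoc)
  qed
  have "infinite (S \<inter> ball l (d / 2))"
    using l d(1) by (simp add: islimpt_eq_infinite_ball)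
  then obtain A where A: "A \<in> S \<inter> ball l (d / 2)" using infinite_imp_nonempty by blast
  have "S \<inter> ball l (d / 2) \<subseteq> {A}" using same A by (auto simp: dist_commute)
  then show False using \<open>infinite (S \<inter> ball l (d / 2))\<close> finite_subset by blast
qed

lemma infinite_unbounded:
  assumes "S \<subseteq> \<Gamma>" "infinite S"
  obtains A where "A \<in> S" "norm A > b"
  using finite_bounded[OF assms(1)] assms(2) by (meson boundedI not_le)

lemma infinite_cmat_image:
  "infinite {A \<in> cmat ` \<Gamma>. P A} \<longleftrightarrow> infinite {g \<in> \<Gamma>. P (cmat g)}"
proof -
  have "{A \<in> cmat ` \<Gamma>. P A} = cmat ` {g \<in> \<Gamma>. P (cmat g)}" by auto
  moreover have "inj_on cmat {g \<in> \<Gamma>. P (cmat g)}" using inj_cmat inj_on_subset by blast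
  ultimately show ?thesis by (simp add: finite_image_iff)
qed

text \<open>Let g_n k_n tend to u, where the g_n have the rank one limit with directions p and q. If
  u were not orthogonal to p, the normalised inverses, which tend to \<open>rank1 q p\<close>, would
  force the k_n towards the boundary point q, which is not in K.\<close>

lemma cluster_points_subset:
  assumes "compact K" "K \<inter> bdHR = {}"
  shows "cluster_points (cmat ` \<Gamma>) K \<subseteq> tangent_set"
proof
  fix u assume u: "u \<in> cluster_points (cmat ` \<Gamma>) K"
  obtain A where A: "\<And>n. open (A n)" "\<And>n. u \<in> A n"
    "\<And>F. (\<forall>n. F n \<in> A n) \<Longrightarrow> F \<longlonglongrightarrow> u"
    by (rule first_countable_topology_class.countable_basis[of u]) blast
  have "\<exists>g k. g \<in> \<Gamma> \<and> norm g > real n \<and> k \<in> K \<and> pact (cmat g) k \<in> A n" for n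
  proof -
    have "infinite {g \<in> cmat ` \<Gamma>. pact g ` K \<inter> A n \<noteq> {}}"
      using u A by (auto simp: cluster_points_def)
    then have "infinite {g \<in> \<Gamma>. pact (cmat g) ` K \<inter> A n \<noteq> {}}"
      by (rule iffD1[OF infinite_cmat_image])
    then obtain g where "g \<in> {g \<in> \<Gamma>. pact (cmat g) ` K \<inter> A n \<noteq> {}}" "norm g > real n"
      by (rule infinite_unbounded[rotated]) auto
    then show ?thesis by blast
  qed
  then obtain g k where g: "\<And>n. g n \<in> \<Gamma>" "\<And>n. norm (g n) > real n"
    and k: "\<And>n. k n \<in> K" "\<And>n. pact (cmat (g n)) (k n) \<in> A n"
    by metis
  have lg: "lorentz (g n)" for n using g lorentz_mem by blast
  have "filterlim (\<lambda>n. norm (g n)) at_top sequentially"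
    by (rule filterlim_at_top_mono[OF filterlim_real_sequentially]) (use g(2) in \<open>auto intro!: always_eventually less_imp_le\<close>)
  then obtain r p q where r: "strict_mono r" and pq: "null_vec p" "null_vec q"
    and lim: "(\<lambda>n. inverse (norm (g (r n))) *\<^sub>R g (r n)) \<longlonglongrightarrow> rank1 p q"
    using rank_one_limit[of g] lg by blast
  have "\<exists>z. norm z = 1 \<and> proj z = k (r n)" for n by (meson unit_lift)
  then obtain z where z: "\<And>n. norm (z n) = 1" "\<And>n. proj (z n) = k (r n)" by metis
  then have "\<forall>n. z n \<in> {z. norm z = 1 \<and> proj z \<in> K}" using k by auto
  then obtain w s where w: "norm w = 1" "proj w \<in> K" and s: "strict_mono s" "(z \<circ> s) \<longlonglongrightarrow> w"
    using compact_unit_lifts[OF assms(1)] unfolding compact_def by (metis (mono_tags, lifting) mem_Collect_eq)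
  define t where "t = r \<circ> s"
  have t: "strict_mono t" using r s by (simp add: t_def strict_mono_o)
  have lim_t: "(\<lambda>n. inverse (norm (g (t n))) *\<^sub>R g (t n)) \<longlonglongrightarrow> rank1 p q"
    using LIMSEQ_subseq_LIMSEQ[OF lim s(1)] by (simp add: o_def t_def)
  have lim_inv: "(\<lambda>n. inverse (norm (g (t n))) *\<^sub>R lor_adj (g (t n))) \<longlonglongrightarrow> rank1 q p"
    using tendsto_lor_adj[OF lim_t] by (simp add: lor_adj_scaleR lor_adj_rank1)
  have "(\<lambda>n. pact (cmat (g n)) (k n)) \<longlonglongrightarrow> u" using A(3) k(2) by auto
  then have "(\<lambda>n. pact (cmat (g (t n))) (k (t n))) \<longlonglongrightarrow> u"
    using LIMSEQ_subseq_LIMSEQ[OF _ t] by (fastforce simp: o_def)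
  moreover obtain v where v: "v \<noteq> 0" "u = proj v" by (rule proj_cases)
  ultimately obtain y where y: "y \<longlonglongrightarrow> v" "\<forall>\<^sub>F n in sequentially. y n \<noteq> 0 \<and> proj (y n) = pact (cmat (g (t n))) (k (t n))"
    using tendsto_proj_lift by blast
  \<comment> \<open>The coefficient that \<open>rank1 q p\<close> produces from v; it is zero
    exactly if p is orthogonal to both parts of v.\<close>
  define a where "a = Complex (lor p (re_vec v)) (lor p (im_vec v))"
  let ?B = "\<lambda>n. inverse (norm (g (t n))) *\<^sub>R lor_adj (g (t n))"
  have ylim: "(\<lambda>n. cplx (?B n *v re_vec (y n)) (?B n *v im_vec (y n))) \<longlonglongrightarrow> cplx (rank1 q p *v re_vec v) (rank1 q p *v im_vec v)"
    using y(1) lim_inv by (intro tendsto_intros)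
  have target: "cplx (rank1 q p *v re_vec v) (rank1 q p *v im_vec v) = a *s real_vec q"
    by (simp add: vec_eq_iff complex_eq_iff rank1_mult a_def)
  have "a = 0"
  proof (rule ccontr)
    assume "a \<noteq> 0"
    then have "a *s real_vec q \<noteq> 0" using pq by (auto simp: null_vec_def)
    then have "(\<lambda>n. proj (cplx (?B n *v re_vec (y n)) (?B n *v im_vec (y n)))) \<longlonglongrightarrow> proj (a *s real_vec q)"
      using tendsto_proj[OF ylim] target by simp
    moreover have "\<forall>\<^sub>F n in sequentially. proj (cplx (?B n *v re_vec (y n)) (?B n *v im_vec (y n))) = proj (z (s n))"
      using y(2)
    proof eventually_elim
      case (elim n)
      have pos: "norm (g (t n)) > 0" using g(2)[of "t n"] by (meson le_less_trans of_nat_0_le_iff)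
      have zs: "z (s n) \<noteq> 0" "proj (z (s n)) = k (t n)" using z by (auto simp: t_def) (metis norm_zero zero_neq_one)
      have "proj (y n) = proj (cmat (g (t n)) *v z (s n))"
        using elim zs lg by (metis pact_cmat)
      then obtain c where c: "c \<noteq> 0" "y n = c *s (cmat (g (t n)) *v z (s n))"
        using proj_eq_iff_nz[of "cmat (g (t n)) *v z (s n)" "y n"] elim zs lg by auto
      have "cmat (lor_adj (g (t n))) *v y n = c *s z (s n)"
        unfolding c(2) using lg[of "t n"]
        by (simp add: complex_vec_eq_iff matrix_vector_mult_diff_distrib matrix_vector_right_distrib
            matrix_vector_mult_scaleR)
      moreover have "cplx (?B n *v re_vec (y n)) (?B n *v im_vec (y n))
          = inverse (norm (g (t n))) *\<^sub>R (cmat (lor_adj (g (t n))) *v y n)"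
        by (simp add: complex_vec_eq_iff scaleR_matrix_vector_assoc[symmetric])
      ultimately show ?case using pos zs(1) c(1) by (simp add: proj_scaleR)
    qed
    ultimately have "(\<lambda>n. proj (z (s n))) \<longlonglongrightarrow> proj (a *s real_vec q)"
      using tendsto_cong[of "\<lambda>n. proj (cplx (?B n *v re_vec (y n)) (?B n *v im_vec (y n)))" "\<lambda>n. proj (z (s n))"]
      by blast
    moreover have "w \<noteq> 0" using w by auto
    then have "(\<lambda>n. proj (z (s n))) \<longlonglongrightarrow> proj w" using s(2) by (intro tendsto_proj) (auto simp: o_def)
    ultimately have "proj w = proj (a *s real_vec q)" using LIMSEQ_unique by blast
    also have "\<dots> = proj (real_vec q)" using \<open>a \<noteq> 0\<close> pq by (simp add: null_vec_def)
    finally have "proj w \<in> bdHR" using pq by (auto simp: bdHR_real_vec null_vec_def)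
    then show False using w assms(2) by auto
  qed
  then show "u \<in> tangent_set"
    using pq v by (auto simp: proj_in_tangent_set a_def null_vec_def zero_complex.code complex_eq_iff)
qed

text \<open>A point of \<open>tangent_set\<close> may lie on the boundary sphere, where the
  compactness argument fails, but its orbit stays in this closed invariant set.\<close>

lemma orbit_cluster_points_subset: "cluster_points (cmat ` \<Gamma>) {z} \<subseteq> tangent_set"
proof (cases "z \<in> tangent_set")
  case True
  show ?thesis
  proof
    fix u assume u: "u \<in> cluster_points (cmat ` \<Gamma>) {z}"
    show "u \<in> tangent_set"
    proof (rule ccontr)
      assume "u \<notin> tangent_set"
      then have "infinite {g \<in> cmat ` \<Gamma>. pact g ` {z} \<inter> - tangent_set \<noteq> {}}"
        using u open_Compl[OF closed_tangent_set] unfolding cluster_points_def by blast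
      then have "{g \<in> cmat ` \<Gamma>. pact g ` {z} \<inter> - tangent_set \<noteq> {}} \<noteq> {}"
        by (rule infinite_imp_nonempty)
      then have "\<exists>g\<in>\<Gamma>. pact (cmat g) z \<notin> tangent_set" by auto
      then show False using True tangent_set_invariant lorentz_mem by blast
    qed
  qed
next
  case False
  then show ?thesis using bdHR_subset_tangent_set by (intro cluster_points_subset) auto
qed

text \<open>As \<open>cluster_points\<close> counts group elements, a point with infinite isotropy
  is a cluster point of its own orbit.\<close>

lemma Kul_L0_subset: "Kul_L0 (cmat ` \<Gamma>) \<subseteq> tangent_set"
  unfolding Kul_L0_def
proof (rule closure_minimal[OF _ closed_tangent_set], rule subsetI)
  fix z assume "z \<in> {z. infinite {g \<in> cmat ` \<Gamma>. pact g z = z}}"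
  then have inf: "infinite {g \<in> cmat ` \<Gamma>. pact g z = z}" by simp
  have "z \<in> cluster_points (cmat ` \<Gamma>) {z}"
    unfolding cluster_points_def
  proof (intro CollectI allI impI)
    fix U assume "open U \<and> z \<in> U"
    then have "{g \<in> cmat ` \<Gamma>. pact g z = z} \<subseteq> {g \<in> cmat ` \<Gamma>. pact g ` {z} \<inter> U \<noteq> {}}" by auto
    then show "infinite {g \<in> cmat ` \<Gamma>. pact g ` {z} \<inter> U \<noteq> {}}" using inf finite_subset by blast
  qed
  then show "z \<in> tangent_set" using orbit_cluster_points_subset by blast
qed

text \<open>The hypothesis keeps the compact sets in the definition of \<open>Kul_L2\<close> away
  from the boundary sphere.\<close>

lemma Kul_limit_set_subset:
  assumes "bdHR \<subseteq> Kul_L1 (cmat ` \<Gamma>)"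
  shows "Kul_limit_set (cmat ` \<Gamma>) \<subseteq> tangent_set"
proof -
  note Kul_L0_subset
  moreover have "Kul_L1 (cmat ` \<Gamma>) \<subseteq> tangent_set"
    unfolding Kul_L1_def using orbit_cluster_points_subset
    by (intro closure_minimal[OF _ closed_tangent_set]) blast
  moreover have "Kul_L2 (cmat ` \<Gamma>) \<subseteq> tangent_set"
    unfolding Kul_L2_def using cluster_points_subset assms
    by (intro closure_minimal[OF _ closed_tangent_set]) blast
  ultimately show ?thesis by (simp add: Kul_limit_set_def)
qed

end

section \<open>Null directions, real points and matrix powers\<close>

lemma null_vec_scale: "c \<noteq> 0 \<Longrightarrow> null_vec (c *\<^sub>R p) \<longleftrightarrow> null_vec p"
  by (auto simp: null_vec_def lor_simps)

lemma null_vec_dependent: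
  assumes "null_vec p" "null_vec q" "lor p q = 0"
  obtains c where "c \<noteq> 0" "q = c *\<^sub>R p"
  using null_null_orthogonal[of p q] assms by (auto simp: null_vec_def)

lemma null_vec_lorentz: "lorentz A \<Longrightarrow> null_vec (A *v p) \<longleftrightarrow> null_vec p"
  by (simp add: null_vec_def lorentz_lor)

lemma null_timelike:
  assumes "null_vec q" "lor x x < 0"
  shows "lor q x \<noteq> 0"
proof
  assume "lor q x = 0"
  then show False using timelike_orthogonal_pos[of x q] assms by (auto simp: null_vec_def lor_commute)
qed

lemma proj_real_vec_scale:
  assumes "c \<noteq> 0" "x \<noteq> 0"
  shows "proj (real_vec (c *\<^sub>R x)) = proj (real_vec x)"
proof -
  have "real_vec (c *\<^sub>R x) = of_real c *s real_vec x" by (simp add: complex_vec_eq_iff)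
  with assms show ?thesis by simp
qed

lemma proj_real_vec_eq:
  assumes "x \<noteq> 0" "y \<noteq> 0" "proj (real_vec x) = proj (real_vec y)"
  obtains c where "c \<noteq> 0" "y = c *\<^sub>R x"
proof -
  obtain c where "real_vec y = c *s real_vec x"
    using proj_eq_iff_nz[of "real_vec x" "real_vec y"] assms by auto
  then have "re_vec (real_vec y) = re_vec (c *s real_vec x)" by (rule arg_cong)
  then have "y = Re c *\<^sub>R x" by simp
  with assms(2) show ?thesis using that[of "Re c"] by auto
qed

lemma pact_real_vec:
  assumes "lorentz A" "x \<noteq> 0"
  shows "pact (cmat A) (proj (real_vec x)) = proj (real_vec (A *v x))"
  using assms by (simp add: pact_cmat cmat_mult_vec)

primrec mpow :: "real ^ 'n ^ 'n \<Rightarrow> nat \<Rightarrow> real ^ 'n ^ 'n" where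
  "mpow A 0 = mat 1"
| "mpow A (Suc n) = A ** mpow A n"

lemma mpow_add: "mpow A (m + n) = mpow A m ** mpow A n"
  by (induction m) (simp_all add: matrix_mul_assoc)

lemma mpow_eigen:
  assumes "A *v x = c *\<^sub>R x"
  shows "mpow A n *v x = (c ^ n) *\<^sub>R x"
  by (induction n) (simp_all add: matrix_vector_mul_assoc[symmetric] assms matrix_vector_mult_scaleR mult.commute)

lemma lorentz_mpow: "lorentz A \<Longrightarrow> lorentz (mpow A n)"
  by (induction n) (simp_all add: lorentz_mult)

section \<open>Loxodromic elements\<close>

text \<open>p is the attracting and q the repelling fixed direction. The eigenvalue is bounded in
  absolute value only, as a Lorentz matrix may exchange the two sheets.\<close>

definition loxodromic ::
  "real ^ ('m::finite option) ^ ('m option) \<Rightarrow> real \<Rightarrow> real ^ ('m option) \<Rightarrow> real ^ ('m option) \<Rightarrow> bool" where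
  "loxodromic g c p q \<longleftrightarrow> lorentz g \<and> \<bar>c\<bar> > 1 \<and> null_vec p \<and> null_vec q \<and> lor p q \<noteq> 0 \<and>
     g *v p = c *\<^sub>R p \<and> g *v q = inverse c *\<^sub>R q"

text \<open>Near an attracting direction the rank one limit makes the normalised action of g a self-map of a
  small convex set, so Brouwer's theorem yields an eigenvector.\<close>

lemma eventually_eigenvector:
  assumes g: "\<And>n. lorentz (g n)" and eps: "\<epsilon> \<longlonglongrightarrow> 0" and lim: "(\<lambda>n. \<epsilon> n *\<^sub>R g n) \<longlonglongrightarrow> rank1 p q"
    and d: "lor q p \<noteq> 0" and e: "e > 0"
  shows "\<forall>\<^sub>F n in sequentially. \<exists>x c. norm (x - p) \<le> e \<and> lor q x = lor q p \<and> \<bar>c\<bar> > 1 \<and> null_vec x \<and> g n *v x = c *\<^sub>R x"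
proof -
  obtain K where K: "K > 0" "\<And>(A :: real ^ ('a option) ^ ('a option)) x. norm (A *v x) \<le> norm A * norm x * K"
    using bounded_bilinear.pos_bounded[OF bounded_bilinear_matrix_vector_mult] by metis
  define D where "D = lor q p"
  \<comment> \<open>Q dominates all error factors below: |D| and |p||q| occur in the estimate of f x
    - p, and |q| in that of \<open>lor q (h *v x)\<close>; the summand 1 makes it positive.\<close>
  define Q where "Q = \<bar>D\<bar> + norm p * norm q + norm q + 1"
  have Q: "Q > 0" unfolding Q_def by (simp add: add_nonneg_pos)
  define \<delta> where "\<delta> = min (D\<^sup>2 / 2 / Q) (e * (D\<^sup>2 / 2) / Q)"
  have \<delta>: "\<delta> > 0" using d e Q by (simp add: \<delta>_def D_def)
  have Kp: "K * (norm p + e) > 0" using K(1) e by (simp add: add_nonneg_pos)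
  have ev1: "\<forall>\<^sub>F n in sequentially. norm (\<epsilon> n *\<^sub>R g n - rank1 p q) < \<delta> / (K * (norm p + e))"
    using tendstoD[OF lim, of "\<delta> / (K * (norm p + e))"] \<delta> Kp by (simp add: dist_norm)
  have ev2: "\<forall>\<^sub>F n in sequentially. \<bar>\<epsilon> n\<bar> < \<bar>D\<bar> / 2"
    using tendstoD[OF eps, of "\<bar>D\<bar> / 2"] d by (simp add: D_def)
  show ?thesis
    using ev1 ev2
  proof eventually_elim
    case (elim n)
    define h where "h = \<epsilon> n *\<^sub>R g n"
    \<comment> \<open>The slice \<open>lor q x = D\<close> fixes the scale of representatives, so
      the projective action becomes a self-map of a compact convex set.\<close>
    define C where "C = cball p e \<inter> {x. lor q x = D}"
    have C: "compact C" "convex C" "C \<noteq> {}"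
    proof -
      have "closed {x. lor q x = D}" by (intro closed_Collect_eq continuous_intros)
      then show "compact C" unfolding C_def by (intro compact_Int_closed) auto
      have "{x. lor q x = D} = {x. flip q \<bullet> x = D}" by (simp add: lor_inner)
      then show "convex C" unfolding C_def by (intro convex_Int) (auto simp: convex_hyperplane)
      have "p \<in> C" using e by (simp add: C_def D_def)
      then show "C \<noteq> {}" by auto
    qed
    have near: "norm (h *v x - D *\<^sub>R p) \<le> \<delta>" if "x \<in> C" for x
    proof -
      have "norm x \<le> norm p + e" using that norm_triangle_sub[of x p] by (simp add: C_def dist_norm norm_minus_commute)
      have "h *v x - D *\<^sub>R p = (h - rank1 p q) *v x"
        using that by (simp add: C_def matrix_vector_mult_diff_rdistrib rank1_mult)
      then have "norm (h *v x - D *\<^sub>R p) \<le> norm (h - rank1 p q) * norm x * K" using K(2) by simp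
      also have "\<dots> \<le> \<delta> / (K * (norm p + e)) * (norm p + e) * K"
        using elim(1) \<open>norm x \<le> norm p + e\<close> K(1) Kp \<delta>
        by (intro mult_right_mono mult_mono) (auto simp: h_def)
      also have "\<dots> = \<delta>"
      proof -
        have "norm p + e \<noteq> 0" using Kp by auto
        with K(1) show ?thesis by simp
      qed
      finally show ?thesis .
    qed
    have b1: "Q * \<delta> \<le> D\<^sup>2 / 2" "Q * \<delta> \<le> e * (D\<^sup>2 / 2)"
      using Q by (auto simp: \<delta>_def min_def field_simps)
    have lorq: "\<bar>lor q (h *v x) - D\<^sup>2\<bar> \<le> norm q * \<delta>" if "x \<in> C" for x
    proof -
      have "lor q (h *v x) - D\<^sup>2 = lor q (h *v x - D *\<^sub>R p)" by (simp add: lor_simps D_def power2_eq_square)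
      moreover have "norm q * norm (h *v x - D *\<^sub>R p) \<le> norm q * \<delta>"
        using near[OF that] by (intro mult_left_mono) auto
      ultimately show ?thesis using abs_lor_le[of q "h *v x - D *\<^sub>R p"] by linarith
    qed
    have qQ: "norm q * \<delta> \<le> Q * \<delta>" using \<delta> by (intro mult_right_mono) (auto simp: Q_def)
    have low: "lor q (h *v x) \<ge> D\<^sup>2 / 2" if "x \<in> C" for x
      using lorq[OF that] qQ b1(1) by linarith
    have D2: "D\<^sup>2 / 2 > 0" using d by (simp add: D_def)
    define f where "f x = (D / lor q (h *v x)) *\<^sub>R (h *v x)" for x
    have "continuous_on C f"
    proof -
      have "continuous_on C (\<lambda>x. h *v x)" by (intro matrix_vector_mult_linear_continuous_on)
      moreover have "lor q (h *v x) \<noteq> 0" if "x \<in> C" for x using low[OF that] D2 by linarith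
      ultimately show ?thesis unfolding f_def by (intro continuous_intros) auto
    qed
    moreover have "f x \<in> C" if x: "x \<in> C" for x
    proof -
      let ?l = "lor q (h *v x)"
      have l: "?l > 0" using low[OF x] D2 by linarith
      have "lor q (f x) = D" using l by (simp add: f_def lor_simps)
      moreover have "norm (f x - p) \<le> e"
      proof -
        have "?l *\<^sub>R (f x - p) = D *\<^sub>R (h *v x - D *\<^sub>R p) - (?l - D\<^sup>2) *\<^sub>R p"
          using l by (simp add: f_def algebra_simps power2_eq_square)
        then have "norm (?l *\<^sub>R (f x - p)) \<le> \<bar>D\<bar> * norm (h *v x - D *\<^sub>R p) + \<bar>?l - D\<^sup>2\<bar> * norm p"
          by (metis norm_scaleR norm_triangle_ineq4)
        also have "\<dots> \<le> \<bar>D\<bar> * \<delta> + (norm q * \<delta>) * norm p"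
          using near[OF x] lorq[OF x] by (intro add_mono mult_left_mono mult_right_mono) auto
        also have "\<dots> \<le> Q * \<delta>" using \<delta> by (simp add: Q_def algebra_simps)
        also have "\<dots> \<le> e * (D\<^sup>2 / 2)" by (rule b1)
        also have "\<dots> \<le> e * ?l" using low[OF x] e by (intro mult_left_mono) auto
        finally show ?thesis using l by simp
      qed
      ultimately show ?thesis by (simp add: C_def dist_norm norm_minus_commute)
    qed
    ultimately obtain x where x: "x \<in> C" "f x = x"
      using brouwer[OF C, of f] by auto
    define \<kappa> where "\<kappa> = lor q (h *v x) / D"
    have lpos: "lor q (h *v x) > 0" using low[OF x(1)] D2 by linarith
    have "\<kappa> *\<^sub>R f x = h *v x" using lpos d by (simp add: f_def \<kappa>_def D_def)
    then have hx: "h *v x = \<kappa> *\<^sub>R x" using x(2) by simp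
    have \<kappa>: "\<bar>\<kappa>\<bar> \<ge> \<bar>D\<bar> / 2"
    proof -
      have "\<bar>\<kappa>\<bar> * \<bar>D\<bar> = lor q (h *v x)" using d lpos by (simp add: \<kappa>_def D_def)
      moreover have "(\<bar>D\<bar> / 2) * \<bar>D\<bar> = D\<^sup>2 / 2" by (simp add: power2_eq_square)
      ultimately have "\<bar>\<kappa>\<bar> * \<bar>D\<bar> \<ge> (\<bar>D\<bar> / 2) * \<bar>D\<bar>" using low[OF x(1)] by simp
      then show ?thesis by (rule mult_right_le_imp_le) (use d in \<open>simp add: D_def\<close>)
    qed
    have "\<kappa> \<noteq> 0" using \<kappa> d by (auto simp: D_def)
    have x0: "x \<noteq> 0" using x(1) d by (auto simp: C_def D_def)
    have en: "\<epsilon> n \<noteq> 0" using hx x0 \<open>\<kappa> \<noteq> 0\<close> by (auto simp: h_def)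
    have gx: "g n *v x = (\<kappa> / \<epsilon> n) *\<^sub>R x"
    proof -
      have "\<epsilon> n *\<^sub>R (g n *v x) = \<kappa> *\<^sub>R x" using hx by (simp add: h_def scaleR_matrix_vector_assoc)
      then have "inverse (\<epsilon> n) *\<^sub>R (\<epsilon> n *\<^sub>R (g n *v x)) = inverse (\<epsilon> n) *\<^sub>R (\<kappa> *\<^sub>R x)" by simp
      then show ?thesis using en by (simp add: field_simps)
    qed
    \<comment> \<open>The eigenvalue \<kappa> of h stays away from 0 while \<epsilon> n is small, so
      the eigenvalue of g is large; preservation of the form then forces x to be null.\<close>
    have c: "\<bar>\<kappa> / \<epsilon> n\<bar> > 1" using \<kappa> elim(2) en by (simp add: field_simps)
    have "lor x x = (\<kappa> / \<epsilon> n)\<^sup>2 * lor x x"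
      using lorentz_lor[OF g, of n x x] gx by (simp add: lor_simps power2_eq_square)
    moreover have "(\<kappa> / \<epsilon> n)\<^sup>2 > 1" using c by (metis one_less_power pos2 power2_abs)
    ultimately have "lor x x = 0" by auto
    then have "null_vec x" using x0 by (simp add: null_vec_def)
    with gx c x(1) show ?case by (auto simp: C_def D_def dist_norm norm_minus_commute intro!: exI[of _ x] exI[of _ "\<kappa> / \<epsilon> n"])
  qed
qed

section \<open>Attracting and repelling directions in a discrete group\<close>

context discrete_lorentz_group
begin

lemma mpow_mem: "A \<in> \<Gamma> \<Longrightarrow> mpow A n \<in> \<Gamma>"
  by (induction n) (simp_all add: one_mem mult_mem)

text \<open>p and q are the attracting and repelling directions of a divergent sequence in the group.\<close>

definition cluster_pair :: "real ^ ('m option) \<Rightarrow> real ^ ('m option) \<Rightarrow> bool" where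
  "cluster_pair p q \<longleftrightarrow> null_vec p \<and> null_vec q \<and>
     (\<exists>g \<epsilon>. (\<forall>n. g n \<in> \<Gamma>) \<and> \<epsilon> \<longlonglongrightarrow> 0 \<and> (\<lambda>n. \<epsilon> n *\<^sub>R g n) \<longlonglongrightarrow> rank1 p q)"

lemma cluster_pairE:
  assumes "cluster_pair p q"
  obtains g \<epsilon> where "null_vec p" "null_vec q" "\<And>n. g n \<in> \<Gamma>" "\<epsilon> \<longlonglongrightarrow> 0" "(\<lambda>n. \<epsilon> n *\<^sub>R g n) \<longlonglongrightarrow> rank1 p q"
  using assms by (auto simp: cluster_pair_def)

lemma cluster_pairI:
  assumes "null_vec p" "null_vec q" "\<And>n. g n \<in> \<Gamma>" "\<epsilon> \<longlonglongrightarrow> 0" "(\<lambda>n. \<epsilon> n *\<^sub>R g n) \<longlonglongrightarrow> rank1 p q"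
  shows "cluster_pair p q"
  using assms by (auto simp: cluster_pair_def)

lemma cluster_pair_scale:
  assumes "cluster_pair p q" "a \<noteq> 0" "b \<noteq> 0"
  shows "cluster_pair (a *\<^sub>R p) (b *\<^sub>R q)"
proof -
  obtain g \<epsilon> where g: "null_vec p" "null_vec q" "\<And>n. g n \<in> \<Gamma>" "\<epsilon> \<longlonglongrightarrow> 0" "(\<lambda>n. \<epsilon> n *\<^sub>R g n) \<longlonglongrightarrow> rank1 p q"
    using cluster_pairE[OF assms(1)] by blast
  have "(\<lambda>n. (a * b) *\<^sub>R (\<epsilon> n *\<^sub>R g n)) \<longlonglongrightarrow> (a * b) *\<^sub>R rank1 p q"
    using g(5) by (intro tendsto_intros)
  moreover have "(\<lambda>n. (a * b) * \<epsilon> n) \<longlonglongrightarrow> 0" using tendsto_mult_right_zero[OF g(4)] .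
  ultimately show ?thesis using g assms
    by (intro cluster_pairI[of _ _ g "\<lambda>n. (a * b) * \<epsilon> n"]) (simp_all add: null_vec_scale rank1_scale)
qed

lemma cluster_pair_swap:
  assumes "cluster_pair p q"
  shows "cluster_pair q p"
proof -
  obtain g \<epsilon> where g: "null_vec p" "null_vec q" "\<And>n. g n \<in> \<Gamma>" "\<epsilon> \<longlonglongrightarrow> 0" "(\<lambda>n. \<epsilon> n *\<^sub>R g n) \<longlonglongrightarrow> rank1 p q"
    using cluster_pairE[OF assms(1)] by blast
  have "(\<lambda>n. \<epsilon> n *\<^sub>R lor_adj (g n)) \<longlonglongrightarrow> rank1 q p"
    using tendsto_lor_adj[OF g(5)] by (simp add: lor_adj_scaleR lor_adj_rank1)
  with g show ?thesis by (intro cluster_pairI[of _ _ "\<lambda>n. lor_adj (g n)" \<epsilon>]) (simp_all add: adj_mem)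
qed

text \<open>The composed limit is \<open>lor q r\<close> times \<open>rank1 p s\<close>, and this
  factor can be divided out.\<close>

lemma cluster_pair_compose:
  assumes "cluster_pair p q" "cluster_pair r s" "lor q r \<noteq> 0"
  shows "cluster_pair p s"
proof -
  obtain g \<epsilon> where g: "null_vec p" "null_vec q" "\<And>n. g n \<in> \<Gamma>" "\<epsilon> \<longlonglongrightarrow> 0" "(\<lambda>n. \<epsilon> n *\<^sub>R g n) \<longlonglongrightarrow> rank1 p q"
    using cluster_pairE[OF assms(1)] by blast
  obtain h \<eta> where h: "null_vec r" "null_vec s" "\<And>n. h n \<in> \<Gamma>" "\<eta> \<longlonglongrightarrow> 0" "(\<lambda>n. \<eta> n *\<^sub>R h n) \<longlonglongrightarrow> rank1 r s"
    using cluster_pairE[OF assms(2)] by blast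
  have "(\<lambda>n. inverse (lor q r) *\<^sub>R ((\<epsilon> n *\<^sub>R g n) ** (\<eta> n *\<^sub>R h n))) \<longlonglongrightarrow> inverse (lor q r) *\<^sub>R (rank1 p q ** rank1 r s)"
    using g(5) h(5) by (intro tendsto_intros)
  moreover have "inverse (lor q r) *\<^sub>R (rank1 p q ** rank1 r s) = rank1 p s"
    using assms(3) by (simp add: rank1_compose)
  moreover have "inverse (lor q r) *\<^sub>R ((\<epsilon> n *\<^sub>R g n) ** (\<eta> n *\<^sub>R h n)) = (inverse (lor q r) * (\<epsilon> n * \<eta> n)) *\<^sub>R (g n ** h n)" for n
    by (simp add: vec_eq_iff matrix_matrix_mult_def sum_distrib_left mult_ac)
  moreover have "(\<lambda>n. inverse (lor q r) * (\<epsilon> n * \<eta> n)) \<longlonglongrightarrow> 0"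
    using tendsto_mult_right_zero[OF tendsto_mult_zero[OF g(4) h(4)]] .
  ultimately show ?thesis using g h
    by (intro cluster_pairI[of _ _ "\<lambda>n. g n ** h n" "\<lambda>n. inverse (lor q r) * (\<epsilon> n * \<eta> n)"]) (auto simp: mult_mem)
qed

text \<open>Right multiplication by a fixed element changes only the repelling direction. This
  breaks the coincidences that block composition.\<close>

lemma cluster_pair_move:
  assumes "cluster_pair p q" "A \<in> \<Gamma>"
  shows "cluster_pair p (lor_adj A *v q)"
proof -
  obtain g \<epsilon> where g: "null_vec p" "null_vec q" "\<And>n. g n \<in> \<Gamma>" "\<epsilon> \<longlonglongrightarrow> 0" "(\<lambda>n. \<epsilon> n *\<^sub>R g n) \<longlonglongrightarrow> rank1 p q"
    using cluster_pairE[OF assms(1)] by blast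
  have "(\<lambda>n. (\<epsilon> n *\<^sub>R g n) ** A) \<longlonglongrightarrow> rank1 p q ** A"
    using g(5) by (intro tendsto_intros)
  moreover have "rank1 p q ** A = rank1 p (lor_adj A *v q)"
    by (simp add: matrix_eq matrix_vector_mul_assoc[symmetric] rank1_mult lor_adj)
  moreover have "(\<epsilon> n *\<^sub>R g n) ** A = \<epsilon> n *\<^sub>R (g n ** A)" for n
    by (simp add: vec_eq_iff matrix_matrix_mult_def sum_distrib_left mult_ac)
  ultimately show ?thesis using g assms(2)
    by (intro cluster_pairI[of _ _ "\<lambda>n. g n ** A" \<epsilon>]) (auto simp: mult_mem null_vec_lorentz lorentz_mem lorentz_lor_adj)
qed

text \<open>The eigenvector lemma is applied to g and to its inverse, which attracts towards q. The
  two eigenvectors cannot be parallel, since their eigenvalues c and 1/d under g lie on different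
  sides of absolute value 1; being non-orthogonal they force d = c.\<close>

lemma loxodromic_near_pair:
  assumes "cluster_pair p q" "lor p q \<noteq> 0" "e > 0"
  obtains g c p' q' where "g \<in> \<Gamma>" "loxodromic g c p' q'" "norm (p' - p) \<le> e" "norm (q' - q) \<le> e"
    "lor q p' = lor q p" "lor p q' = lor p q"
proof -
  obtain g \<epsilon> where g: "null_vec p" "null_vec q" "\<And>n. g n \<in> \<Gamma>" "\<epsilon> \<longlonglongrightarrow> 0" "(\<lambda>n. \<epsilon> n *\<^sub>R g n) \<longlonglongrightarrow> rank1 p q"
    using cluster_pairE[OF assms(1)] by blast
  have lg: "lorentz (g n)" for n using g(3) lorentz_mem by blast
  have inv: "(\<lambda>n. \<epsilon> n *\<^sub>R lor_adj (g n)) \<longlonglongrightarrow> rank1 q p"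
    using tendsto_lor_adj[OF g(5)] by (simp add: lor_adj_scaleR lor_adj_rank1)
  have "\<forall>\<^sub>F n in sequentially.
     (\<exists>x c. norm (x - p) \<le> e \<and> lor q x = lor q p \<and> \<bar>c\<bar> > 1 \<and> null_vec x \<and> g n *v x = c *\<^sub>R x) \<and>
     (\<exists>x c. norm (x - q) \<le> e \<and> lor p x = lor p q \<and> \<bar>c\<bar> > 1 \<and> null_vec x \<and> lor_adj (g n) *v x = c *\<^sub>R x)"
    using assms(2,3) lg g(4,5) inv
    by (intro eventually_conj eventually_eigenvector) (auto simp: lorentz_lor_adj lor_commute)
  then obtain n x y c d where x: "norm (x - p) \<le> e" "lor q x = lor q p" "\<bar>c\<bar> > 1" "null_vec x" "g n *v x = c *\<^sub>R x"
    and y: "norm (y - q) \<le> e" "lor p y = lor p q" "\<bar>d\<bar> > 1" "null_vec y" "lor_adj (g n) *v y = d *\<^sub>R y"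
    using eventually_happens'[OF sequentially_bot] by blast
  have gy: "g n *v y = inverse d *\<^sub>R y"
  proof -
    have "y = d *\<^sub>R (g n *v y)"
      using arg_cong[OF y(5), of "\<lambda>v. g n *v v"] lg by (simp add: matrix_vector_mult_scaleR)
    then show ?thesis using y(3) by (metis abs_zero inverse_inverse_eq left_inverse not_one_less_zero scaleR_one scaleR_scaleR)
  qed
  have nxy: "lor x y \<noteq> 0"
  proof
    assume "lor x y = 0"
    then obtain k where "k \<noteq> 0" "y = k *\<^sub>R x" using null_vec_dependent x(4) y(4) by blast
    then have "c *\<^sub>R y = inverse d *\<^sub>R y" using x(5) gy by (simp add: matrix_vector_mult_scaleR)
    then have "c = inverse d" using y(4) by (simp add: null_vec_def)
    moreover have "\<bar>inverse d\<bar> < 1" using y(3) by (simp add: inverse_less_1_iff)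
    ultimately show False using x(3) by simp
  qed
  have "lor x y = (c * inverse d) * lor x y"
    using lorentz_lor[OF lg, of n x y] x(5) gy by (simp add: lor_simps) (simp add: mult.commute)
  then have "c * inverse d = 1" using nxy by simp
  then have "d = c" by (metis inverse_inverse_eq inverse_unique mult.commute)
  then have "loxodromic (g n) c x y" using x y gy lg nxy by (simp add: loxodromic_def)
  then show ?thesis using that g(3) x y by blast
qed

end

section \<open>Abundance of loxodromic elements\<close>

text \<open>The reflection of p in \<open>tvec\<close>, where \<open>lor tvec tvec = -1\<close>, is
  the antipodal point of the sphere.\<close>

lemma null_opposite:
  assumes "null_vec p"
  obtains q where "null_vec q" "lor p q \<noteq> 0"
proof -
  define q where "q = p + (2 * lor p tvec) *\<^sub>R tvec"
  have t: "lor p tvec \<noteq> 0" using assms null_nth_None by (auto simp: null_vec_def)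
  have "lor p q = 2 * (lor p tvec)\<^sup>2"
    using assms by (simp add: q_def lor_simps null_vec_def power2_eq_square del: lor_tvec)
  then have pq: "lor p q \<noteq> 0" using t by simp
  moreover have "lor q q = 0"
    using assms by (simp add: q_def lor_simps null_vec_def algebra_simps)
  moreover have "q \<noteq> 0" using pq by auto
  ultimately show ?thesis using that[of q] by (simp add: null_vec_def)
qed

text \<open>A parabola on the light cone inside the affine hyperplane where the pairing with q is
  constant, that is, a curve in horospherical coordinates seen from q. It supplies null directions
  arbitrarily close to p but orthogonal neither to p nor to q.\<close>

lemma null_vec_curve:
  fixes p q :: "real ^ ('m::finite option)"
  assumes "CARD('m) \<ge> 2" "null_vec p" "null_vec q" "lor p q \<noteq> 0"
  obtains s a where "a \<noteq> 0" "\<And>x. x \<noteq> 0 \<Longrightarrow> null_vec (p + x *\<^sub>R s + (x\<^sup>2 * a) *\<^sub>R q)"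
    "\<And>x. lor p (p + x *\<^sub>R s + (x\<^sup>2 * a) *\<^sub>R q) = x\<^sup>2 * a * lor p q"
    "\<And>x. lor q (p + x *\<^sub>R s + (x\<^sup>2 * a) *\<^sub>R q) = lor p q"
proof -
  have "card {p, q} < CARD('m) + 1" using assms(1) card_insert_le_m1[of 2 "{q}" p] by simp
  then obtain s where s: "s \<noteq> 0" "lor p s = 0" "lor q s = 0"
    using exists_lor_orthogonal[of "{p, q}"] by auto
  obtain c where c: "c > 0" "\<And>x. lor p x = 0 \<Longrightarrow> lor q x = 0 \<Longrightarrow> lor x x \<ge> c * (norm x)\<^sup>2"
    using null_pair_complement[of p q] assms by (auto simp: null_vec_def)
  have ss: "lor s s > 0"
  proof -
    have "c * (norm s)\<^sup>2 > 0" using c s by simp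
    then show ?thesis using c(2)[of s] s by linarith
  qed
  \<comment> \<open>Chosen so that the contribution of s cancels the cross term of p and q.\<close>
  define a where "a = - lor s s / (2 * lor p q)"
  have sp: "lor s p = 0" "lor s q = 0" "lor p p = 0" "lor q q = 0"
    using s assms by (auto simp: lor_commute null_vec_def)
  have q: "lor q (p + x *\<^sub>R s + (x\<^sup>2 * a) *\<^sub>R q) = lor p q" for x
    using s sp by (simp add: lor_simps lor_commute[of q p])
  have "lor (p + x *\<^sub>R s + (x\<^sup>2 * a) *\<^sub>R q) (p + x *\<^sub>R s + (x\<^sup>2 * a) *\<^sub>R q) = x\<^sup>2 * (lor s s + 2 * a * lor p q)" for x
    using s sp by (simp add: lor_simps lor_commute[of q p] power2_eq_square algebra_simps)
  also have "\<And>x. x\<^sup>2 * (lor s s + 2 * a * lor p q) = 0" using assms(4) by (simp add: a_def)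
  finally have nul: "lor (p + x *\<^sub>R s + (x\<^sup>2 * a) *\<^sub>R q) (p + x *\<^sub>R s + (x\<^sup>2 * a) *\<^sub>R q) = 0" for x .
  show ?thesis
  proof (rule that[of a s])
    show "a \<noteq> 0" using ss assms(4) by (simp add: a_def)
    show "null_vec (p + x *\<^sub>R s + (x\<^sup>2 * a) *\<^sub>R q)" for x
      using nul[of x] q[of x] assms(4) by (auto simp: null_vec_def)
    show "lor p (p + x *\<^sub>R s + (x\<^sup>2 * a) *\<^sub>R q) = x\<^sup>2 * a * lor p q" for x
      using s sp by (simp add: lor_simps)
  qed (rule q)
qed

section \<open>Orbits accumulating at a null direction\<close>

context discrete_lorentz_group
begin

text \<open>Turns accumulation of the set of orbit points into infinitely many group elements, the
  notion behind \<open>cluster_points\<close>.\<close>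

lemma infinite_orbit_near:
  assumes "null_vec p" "z \<in> HR" "proj (real_vec p) islimpt ((\<lambda>g. pact (cmat g) z) ` \<Gamma>)"
    "open U" "proj (real_vec p) \<in> U"
  shows "infinite {g \<in> \<Gamma>. pact (cmat g) z \<in> U}"
proof
  assume "finite {g \<in> \<Gamma>. pact (cmat g) z \<in> U}"
  then have "finite ((\<lambda>g. pact (cmat g) z) ` {g \<in> \<Gamma>. pact (cmat g) z \<in> U})" by simp
  moreover have "U \<inter> (\<lambda>g. pact (cmat g) z) ` \<Gamma> = (\<lambda>g. pact (cmat g) z) ` {g \<in> \<Gamma>. pact (cmat g) z \<in> U}" by auto
  moreover have "infinite (U \<inter> (\<lambda>g. pact (cmat g) z) ` \<Gamma>)"
    using assms(3-5) by (simp add: islimpt_eq_acc_point)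
  ultimately show False by simp
qed

lemma HR_notin_tangent_set:
  assumes "z \<in> HR"
  shows "z \<notin> tangent_set"
proof
  assume z: "z \<in> tangent_set"
  obtain x where x: "lor x x < 0" "z = proj (real_vec x)" using assms by (auto simp: HR_real_vec)
  then have "x \<noteq> 0" by auto
  then obtain p where "null_vec p" "lor p x = 0"
    using z x by (auto simp: proj_in_tangent_set null_vec_def)
  then show False using null_timelike x by blast
qed

lemma limit_point_in_L1:
  assumes "null_vec p" "z \<in> HR" "proj (real_vec p) islimpt ((\<lambda>g. pact (cmat g) z) ` \<Gamma>)"
  shows "proj (real_vec p) \<in> Kul_L1 (cmat ` \<Gamma>)"
proof -
  have "proj (real_vec p) \<in> cluster_points (cmat ` \<Gamma>) {z}"
    unfolding cluster_points_def
  proof (intro CollectI allI impI)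
    fix U assume "open U \<and> proj (real_vec p) \<in> U"
    then have "infinite {g \<in> \<Gamma>. pact (cmat g) z \<in> U}" using infinite_orbit_near[OF assms] by blast
    then show "infinite {g \<in> cmat ` \<Gamma>. pact g ` {z} \<inter> U \<noteq> {}}"
      by (simp add: infinite_cmat_image)
  qed
  moreover have "z \<in> - Kul_L0 (cmat ` \<Gamma>)" using Kul_L0_subset HR_notin_tangent_set assms(2) by blast
  ultimately have "proj (real_vec p) \<in> (\<Union>z \<in> - Kul_L0 (cmat ` \<Gamma>). cluster_points (cmat ` \<Gamma>) {z})"
    by (rule UN_I[rotated])
  then show ?thesis unfolding Kul_L1_def by (rule subsetD[OF closure_subset])
qed

text \<open>A timelike x is never orthogonal to the repelling null vector b, so its orbit converges
  to the attracting direction a, which must therefore be that of p.\<close>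

lemma limit_point_cluster_pair:
  assumes p: "null_vec p" "z \<in> HR" "proj (real_vec p) islimpt ((\<lambda>g. pact (cmat g) z) ` \<Gamma>)"
  obtains q where "cluster_pair p q"
proof -
  obtain x where x: "lor x x < 0" "z = proj (real_vec x)" using assms(2) by (auto simp: HR_real_vec)
  have x0: "x \<noteq> 0" using x by auto
  obtain A where A: "\<And>n. open (A n)" "\<And>n. proj (real_vec p) \<in> A n"
    "\<And>F. (\<forall>n. F n \<in> A n) \<Longrightarrow> F \<longlonglongrightarrow> proj (real_vec p)"
    by (rule first_countable_topology_class.countable_basis[of "proj (real_vec p)"]) blast
  have "\<exists>g. g \<in> \<Gamma> \<and> norm g > real n \<and> pact (cmat g) z \<in> A n" for n
  proof -
    have "infinite {g \<in> \<Gamma>. pact (cmat g) z \<in> A n}" using infinite_orbit_near[OF assms] A by blast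
    then obtain g where "g \<in> {g \<in> \<Gamma>. pact (cmat g) z \<in> A n}" "norm g > real n"
      by (rule infinite_unbounded[rotated]) auto
    then show ?thesis by blast
  qed
  then obtain g where g: "\<And>n. g n \<in> \<Gamma>" "\<And>n. norm (g n) > real n" "\<And>n. pact (cmat (g n)) z \<in> A n"
    by metis
  have lg: "lorentz (g n)" for n using g lorentz_mem by blast
  have inf: "filterlim (\<lambda>n. norm (g n)) at_top sequentially"
    by (rule filterlim_at_top_mono[OF filterlim_real_sequentially]) (use g(2) in \<open>auto intro!: always_eventually less_imp_le\<close>)
  then obtain r a b where r: "strict_mono r" and ab: "null_vec a" "null_vec b"
    and lim: "(\<lambda>n. inverse (norm (g (r n))) *\<^sub>R g (r n)) \<longlonglongrightarrow> rank1 a b"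
    using rank_one_limit[of g] lg by blast
  let ?e = "\<lambda>n. inverse (norm (g (r n)))"
  have eps: "?e \<longlonglongrightarrow> 0"
    using filterlim_compose[OF inf filterlim_subseq[OF r]] by (rule tendsto_inverse_0_at_top)
  have pair: "cluster_pair a b" using cluster_pairI[OF ab _ eps lim] g(1) by simp
  have bx: "lor b x \<noteq> 0" using null_timelike ab x by blast
  have a0: "a \<noteq> 0" using ab by (simp add: null_vec_def)
  have p0: "p \<noteq> 0" using p by (simp add: null_vec_def)
  have "(\<lambda>n. real_vec ((?e n *\<^sub>R g (r n)) *v x)) \<longlonglongrightarrow> real_vec (rank1 a b *v x)"
    using lim by (intro tendsto_intros)
  then have "(\<lambda>n. proj (real_vec ((?e n *\<^sub>R g (r n)) *v x))) \<longlonglongrightarrow> proj (real_vec (rank1 a b *v x))"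
    using bx a0 by (intro tendsto_proj) (auto simp: rank1_mult)
  moreover have "proj (real_vec ((?e n *\<^sub>R g (r n)) *v x)) = pact (cmat (g (r n))) z" for n
  proof -
    have "norm (g (r n)) > 0" using g(2)[of "r n"] by (meson le_less_trans of_nat_0_le_iff)
    then show ?thesis using lg x0 x(2)
      by (simp add: pact_real_vec scaleR_matrix_vector_assoc[symmetric] proj_real_vec_scale)
  qed
  moreover have "(\<lambda>n. pact (cmat (g (r n))) z) \<longlonglongrightarrow> proj (real_vec p)"
    using LIMSEQ_subseq_LIMSEQ[OF A(3)[of "\<lambda>n. pact (cmat (g n)) z"] r] g(3) by (simp add: o_def)
  ultimately have "proj (real_vec p) = proj (real_vec (rank1 a b *v x))"
    by (simp add: LIMSEQ_unique)
  then have "proj (real_vec a) = proj (real_vec p)" using bx a0 by (simp add: rank1_mult proj_real_vec_scale)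
  then obtain c where "c \<noteq> 0" "p = c *\<^sub>R a" using proj_real_vec_eq a0 p0 by blast
  then have "cluster_pair p (1 *\<^sub>R b)" using cluster_pair_scale[OF pair, of c 1] by simp
  then show ?thesis using that by simp
qed

text \<open>If g^n x were k times g^m x, pairing with p and with q would give c^m = c^n k and c^(-m)
  = c^(-n) k, so c^(2m) = c^(2n).\<close>

lemma loxodromic_pair_distinct_powers:
  assumes "loxodromic g c p q" "null_vec x" "lor q x \<noteq> 0" "lor p x \<noteq> 0" "m < n"
  shows "lor (mpow g m *v x) (mpow g n *v x) \<noteq> 0"
proof
  assume eq: "lor (mpow g m *v x) (mpow g n *v x) = 0"
  have lg: "lorentz g" using assms(1) by (simp add: loxodromic_def)
  then obtain k where k: "k \<noteq> 0" "mpow g n *v x = k *\<^sub>R (mpow g m *v x)"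
    using null_vec_dependent[of "mpow g m *v x" "mpow g n *v x"] eq assms(2) by (auto simp: null_vec_lorentz lorentz_mpow)
  have c: "\<bar>c\<bar> > 1" "c \<noteq> 0" using assms(1) by (auto simp: loxodromic_def)
  have pn: "mpow g n *v p = (c ^ n) *\<^sub>R p" "mpow g n *v q = (inverse c ^ n) *\<^sub>R q" for n
    using assms(1) by (auto intro!: mpow_eigen simp: loxodromic_def)
  have a: "lor p x = c ^ n * lor p (mpow g n *v x)" for n
    using lorentz_lor[OF lorentz_mpow[OF lg], of n p x] pn[of n] by (simp add: lor_simps)
  have b: "lor q x = inverse c ^ n * lor q (mpow g n *v x)" for n
    using lorentz_lor[OF lorentz_mpow[OF lg], of n q x] pn[of n] by (simp add: lor_simps)
  have "c ^ m * lor p (mpow g m *v x) = c ^ n * k * lor p (mpow g m *v x)"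
    using a[of m] a[of n] k by (auto simp: lor_simps mult.assoc)
  then have 1: "c ^ m = c ^ n * k" using a[of m] assms(4) by (metis mult_cancel_right mult_zero_right)
  have "inverse c ^ m * lor q (mpow g m *v x) = inverse c ^ n * k * lor q (mpow g m *v x)"
    using b[of m] b[of n] k by (auto simp: lor_simps mult.assoc)
  then have 2: "inverse c ^ m = inverse c ^ n * k" using b[of m] assms(3) by (metis mult_cancel_right mult_zero_right)
  have "c ^ m * c ^ m = c ^ n * c ^ n"
  proof -
    have "c ^ n * (c ^ m * inverse c ^ m) = c ^ m * (c ^ n * inverse c ^ n) * k" using 2 by simp
    then have "c ^ n = c ^ m * k" using c(2) by (simp flip: power_mult_distrib)
    then show ?thesis using 1 by simp
  qed
  then have "(\<bar>c\<bar> ^ m) = (\<bar>c\<bar> ^ n)"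
    by (metis abs_mult_self_eq power_abs power2_eq_iff_nonneg power2_eq_square abs_ge_zero)
  then show False using c(1) assms(5) power_strict_increasing[of m n "\<bar>c\<bar>"] by simp
qed

end

locale full_limit_group = discrete_lorentz_group \<Gamma>
  for \<Gamma> :: "(real ^ ('m::finite option) ^ ('m option)) set" +
  assumes card_ge_2: "CARD('m) \<ge> 2"
    and full: "null_vec p \<Longrightarrow> \<exists>z\<in>HR. proj (real_vec p) islimpt ((\<lambda>g. pact (cmat g) z) ` \<Gamma>)"
begin

lemma bdHR_subset_L1: "bdHR \<subseteq> Kul_L1 (cmat ` \<Gamma>)"
  using full limit_point_in_L1 by (auto simp: bdHR_real_vec null_vec_def)

lemma cluster_pair_exists:
  assumes "null_vec p"
  obtains q where "cluster_pair p q"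
  using full[OF assms] limit_point_cluster_pair[OF assms] by blast

text \<open>If q were fixed by the group, there would be loxodromic elements g and h fixing q with different second
  fixed points, and the infinitely many conjugates of h by powers of g would not diverge.\<close>

lemma no_global_fixed_point:
  assumes q: "null_vec q" and fixed: "\<And>A. A \<in> \<Gamma> \<Longrightarrow> \<exists>c. A *v q = c *\<^sub>R q"
  shows False
proof -
  \<comment> \<open>As g_n fixes the direction q, \<open>lor q (g n *v q)\<close> is 0. In the limit
    the product of \<open>lor r q\<close> and \<open>lor q p\<close> vanishes, so the repelling
    direction r is q.\<close>
  have pair: "cluster_pair p q" if p: "null_vec p" "lor p q \<noteq> 0" for p
  proof -
    obtain r where r: "cluster_pair p r" using cluster_pair_exists[OF p(1)] by blast
    then obtain g \<epsilon> where g: "null_vec p" "null_vec r" "\<And>n. g n \<in> \<Gamma>" "\<epsilon> \<longlonglongrightarrow> 0" "(\<lambda>n. \<epsilon> n *\<^sub>R g n) \<longlonglongrightarrow> rank1 p r"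
      using cluster_pairE by blast
    have "(\<lambda>n. lor q ((\<epsilon> n *\<^sub>R g n) *v q)) \<longlonglongrightarrow> lor q (rank1 p r *v q)"
      using g(5) by (intro tendsto_intros)
    moreover have "lor q ((\<epsilon> n *\<^sub>R g n) *v q) = 0" for n
    proof -
      obtain c where "g n *v q = c *\<^sub>R q" using fixed g(3) by blast
      then show ?thesis using q by (simp add: scaleR_matrix_vector_assoc[symmetric] lor_simps null_vec_def)
    qed
    ultimately have "lor q (rank1 p r *v q) = 0" by (simp add: LIMSEQ_const_iff)
    then have "lor r q = 0" using p by (simp add: rank1_mult lor_simps lor_commute[of q p])
    then obtain c where "c \<noteq> 0" "q = c *\<^sub>R r" using null_vec_dependent g(2) q by blast
    then show ?thesis using cluster_pair_scale[OF r, of 1 c] by simp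
  qed
  \<comment> \<open>Pairing q with p' shows that the multiplier k of q is 1/c. Pairing q with q'
    would require k = c unless q and q' are parallel, so the repelling direction is exactly
    q.\<close>
  have lox: "\<exists>g c p'. g \<in> \<Gamma> \<and> loxodromic g c p' q \<and> norm (p' - p) \<le> e" if p: "null_vec p" "lor p q \<noteq> 0" "e > 0" for p e
  proof -
    obtain g c p' q' where g: "g \<in> \<Gamma>" "loxodromic g c p' q'" "norm (p' - p) \<le> e" "lor q p' = lor q p"
      by (rule loxodromic_near_pair[OF pair[OF p(1,2)] p(2,3)]) blast
    have lg: "lorentz g" using g by (simp add: loxodromic_def)
    obtain k where k: "g *v q = k *\<^sub>R q" using fixed g(1) by blast
    have c: "\<bar>c\<bar> > 1" using g by (simp add: loxodromic_def)
    have "lor q p' = k * c * lor q p'"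
      using lorentz_lor[OF lg, of q p'] k g(2) by (simp add: loxodromic_def lor_simps)
    then have kc: "k * c = 1" using g(4) p(2) by (simp add: lor_commute)
    have "lor q q' = k * inverse c * lor q q'"
      using lorentz_lor[OF lg, of q q'] k g(2) by (simp add: loxodromic_def lor_simps)
    moreover have "k * inverse c \<noteq> 1"
    proof
      assume "k * inverse c = 1"
      then have "k = c" using c by (simp add: field_simps split: if_splits)
      then have "c\<^sup>2 = 1" using kc by (simp add: power2_eq_square)
      then show False using c by (auto simp: power2_eq_1_iff)
    qed
    ultimately have "lor q' q = 0" by (auto simp: lor_commute)
    then obtain d where d: "d \<noteq> 0" "q = d *\<^sub>R q'" using null_vec_dependent g(2) q by (auto simp: loxodromic_def)
    then have "loxodromic g c p' q"
      using g(2) by (simp add: loxodromic_def null_vec_scale lor_simps matrix_vector_mult_scaleR)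
    then show ?thesis using g by blast
  qed
  obtain p1 where p1: "null_vec p1" "lor q p1 \<noteq> 0"
    by (rule null_opposite[OF q])
  then obtain g c a where g: "g \<in> \<Gamma>" "loxodromic g c a q" using lox[of p1 1] by (auto simp: lor_commute)
  have aq: "null_vec a" "lor a q \<noteq> 0" using g by (auto simp: loxodromic_def)
  \<comment> \<open>Any nonzero parameter on the curve through a would do; 1 is taken.\<close>
  obtain p2 where p2: "null_vec p2" "lor a p2 \<noteq> 0" "lor q p2 \<noteq> 0"
  proof -
    obtain s x where x: "x \<noteq> 0" "\<And>y. y \<noteq> 0 \<Longrightarrow> null_vec (a + y *\<^sub>R s + (y\<^sup>2 * x) *\<^sub>R q)"
      "\<And>y. lor a (a + y *\<^sub>R s + (y\<^sup>2 * x) *\<^sub>R q) = y\<^sup>2 * x * lor a q"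
      "\<And>y. lor q (a + y *\<^sub>R s + (y\<^sup>2 * x) *\<^sub>R q) = lor a q"
      by (rule null_vec_curve[OF card_ge_2 aq(1) q aq(2)]) blast
    show ?thesis
      by (rule that[of "a + 1 *\<^sub>R s + (1\<^sup>2 * x) *\<^sub>R q"]) (use x(2)[of 1] x(3)[of 1] x(4)[of 1] x(1) aq in auto)
  qed
  \<comment> \<open>Moving p2 by at most e changes its pairing with a by at most half of it.\<close>
  define e where "e = \<bar>lor a p2\<bar> / (norm a + 1) / 2"
  have e: "e > 0" unfolding e_def using p2 by (intro divide_pos_pos add_nonneg_pos) auto
  obtain h d b where h: "h \<in> \<Gamma>" "loxodromic h d b q" "norm (b - p2) \<le> e" using lox[of p2 e] p2 e by (auto simp: lor_commute)
  have bq: "null_vec b" "lor q b \<noteq> 0" using h by (auto simp: loxodromic_def lor_commute)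
  have ab: "lor a b \<noteq> 0"
  proof
    assume "lor a b = 0"
    then have "\<bar>lor a p2\<bar> = \<bar>lor a (b - p2)\<bar>" by (simp add: lor_simps)
    also have "\<dots> \<le> norm a * e" using abs_lor_le[of a "b - p2"] h(3) by (meson mult_left_mono norm_ge_zero order_trans)
    also have "\<dots> \<le> (norm a + 1) * e" using e by (intro mult_right_mono) auto
    also have "\<dots> = \<bar>lor a p2\<bar> / 2"
    proof -
      have "norm a + 1 \<noteq> 0" using norm_ge_zero[of a] by linarith
      from nonzero_mult_div_cancel_left[OF this, of "\<bar>lor a p2\<bar>"] show ?thesis
        by (simp only: e_def times_divide_eq_right)
    qed
    finally show False using p2 by simp
  qed
  have lg: "lorentz g" and lh: "lorentz h" using g h lorentz_mem by auto
  define G where "G n = mpow g n" for n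
  \<comment> \<open>Conjugation keeps the eigenvalues d and 1/d of h while moving the fixed
    direction P n, which makes the C n distinct.\<close>
  define C where "C n = G n ** h ** lor_adj (G n)" for n
  have lG: "lorentz (G n)" for n using lg by (simp add: G_def lorentz_mpow)
  have CG: "C n \<in> \<Gamma>" for n using g h by (simp add: C_def G_def mult_mem adj_mem mpow_mem)
  define P where "P n = G n *v b" for n
  have nP: "null_vec (P n)" for n using bq lG by (simp add: P_def null_vec_lorentz)
  have dd: "\<bar>d\<bar> > 1" "d \<noteq> 0" "h *v b = d *\<^sub>R b" "h *v q = inverse d *\<^sub>R q" using h by (auto simp: loxodromic_def)
  have cc: "\<bar>c\<bar> > 1" "c \<noteq> 0" "g *v a = c *\<^sub>R a" "g *v q = inverse c *\<^sub>R q" using g by (auto simp: loxodromic_def)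
  have Gq: "G n *v q = (inverse c ^ n) *\<^sub>R q" "G n *v a = (c ^ n) *\<^sub>R a" for n
    using cc by (auto intro!: mpow_eigen simp: G_def)
  have adjGq: "lor_adj (G n) *v q = (c ^ n) *\<^sub>R q" for n
  proof -
    have "q = (c ^ n) *\<^sub>R (G n *v q)" using Gq(1)[of n] cc by (simp add: power_inverse)
    then have "lor_adj (G n) *v q = lor_adj (G n) *v ((c ^ n) *\<^sub>R (G n *v q))" by simp
    then show ?thesis using lG by (simp add: matrix_vector_mult_scaleR)
  qed
  have CP: "C n *v P n = d *\<^sub>R P n" for n
    using lG dd by (simp add: C_def P_def matrix_vector_mul_assoc[symmetric] matrix_vector_mult_scaleR)
  have Cq: "C n *v q = inverse d *\<^sub>R q" for n
    using dd Gq adjGq cc by (simp add: C_def matrix_vector_mul_assoc[symmetric] matrix_vector_mult_scaleR power_inverse)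
  have lC: "lorentz (C n)" for n using CG lorentz_mem by blast
  have adjCq: "lor_adj (C n) *v q = d *\<^sub>R q" for n
  proof -
    have "q = d *\<^sub>R (C n *v q)" using Cq[of n] dd by simp
    then have "lor_adj (C n) *v q = lor_adj (C n) *v (d *\<^sub>R (C n *v q))" by simp
    then show ?thesis using lC by (simp add: matrix_vector_mult_scaleR)
  qed
  have "inj C"
  proof (rule linorder_injI)
    fix m n :: nat assume mn: "m < n"
    show "C m \<noteq> C n"
    proof
      assume eq: "C m = C n"
      have "lor (P m) (P n) = d * d * lor (P m) (P n)"
        using lorentz_lor[OF lC, of n "P m" "P n"] CP[of n] CP[of m] eq by (simp add: lor_simps)
      moreover have "lor (P m) (P n) \<noteq> 0"
        using loxodromic_pair_distinct_powers[OF g(2) bq(1) bq(2) ab mn] by (simp add: P_def G_def)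
      ultimately have "d\<^sup>2 = 1" by (simp add: power2_eq_square)
      then show False using dd by (auto simp: power2_eq_1_iff)
    qed
  qed
  \<comment> \<open>The indices are forced to infinity so that powers of c^(-2) vanish along them at
    the end.\<close>
  have "\<exists>k. k \<ge> n \<and> norm (C k) > real n" for n
  proof -
    have "infinite (C ` {n..})" using \<open>inj C\<close> by (simp add: finite_image_iff inj_on_subset[OF \<open>inj C\<close>] infinite_Ici)
    then obtain A where "A \<in> C ` {n..}" "norm A > real n"
      using infinite_unbounded[of "C ` {n..}"] CG by blast
    then show ?thesis by auto
  qed
  then obtain k where k: "\<And>n. k n \<ge> n" "\<And>n. norm (C (k n)) > real n" by metis
  have inf: "filterlim (\<lambda>n. norm (C (k n))) at_top sequentially"
    by (rule filterlim_at_top_mono[OF filterlim_real_sequentially]) (use k(2) in \<open>auto intro!: always_eventually less_imp_le\<close>)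
  then obtain r u v where r: "strict_mono r" and uv: "null_vec u" "null_vec v"
    and lim: "(\<lambda>n. inverse (norm (C (k (r n)))) *\<^sub>R C (k (r n))) \<longlonglongrightarrow> rank1 u v"
    using rank_one_limit[of "\<lambda>n. C (k n)"] lC by blast
  let ?e = "\<lambda>n. inverse (norm (C (k (r n))))"
  have eps: "?e \<longlonglongrightarrow> 0"
    using filterlim_compose[OF inf filterlim_subseq[OF r]] by (rule tendsto_inverse_0_at_top)
  have liminv: "(\<lambda>n. ?e n *\<^sub>R lor_adj (C (k (r n)))) \<longlonglongrightarrow> rank1 v u"
    using tendsto_lor_adj[OF lim] by (simp add: lor_adj_scaleR lor_adj_rank1)
  \<comment> \<open>The eigenvalue at q is the same for all C n while their norms diverge, so both
    normalised limits kill q; hence u and v are parallel to q.\<close>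
  have zero: "rank1 v u *v q = 0" "rank1 u v *v q = 0"
  proof -
    have "(\<lambda>n. (?e n *\<^sub>R C (k (r n))) *v q) \<longlonglongrightarrow> rank1 u v *v q" using lim by (intro tendsto_intros)
    moreover have "(\<lambda>n. (?e n * inverse d) *\<^sub>R q) \<longlonglongrightarrow> (0 * inverse d) *\<^sub>R q" using eps by (intro tendsto_intros)
    ultimately show "rank1 u v *v q = 0"
      by (simp add: scaleR_matrix_vector_assoc[symmetric] Cq LIMSEQ_unique)
    have "(\<lambda>n. (?e n *\<^sub>R lor_adj (C (k (r n)))) *v q) \<longlonglongrightarrow> rank1 v u *v q" using liminv by (intro tendsto_intros)
    moreover have "(\<lambda>n. (?e n * d) *\<^sub>R q) \<longlonglongrightarrow> (0 * d) *\<^sub>R q" using eps by (intro tendsto_intros)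
    ultimately show "rank1 v u *v q = 0"
      by (simp add: scaleR_matrix_vector_assoc[symmetric] adjCq LIMSEQ_unique)
  qed
  then have "lor u q = 0" "lor v q = 0" using uv by (auto simp: rank1_mult null_vec_def)
  then obtain \<alpha> \<beta> where \<alpha>: "\<alpha> \<noteq> 0" "q = \<alpha> *\<^sub>R u" and \<beta>: "\<beta> \<noteq> 0" "q = \<beta> *\<^sub>R v"
    using null_vec_dependent uv q by metis
  \<comment> \<open>Two incompatible limits: P n also has a constant eigenvalue, so its direction
    must tend to q, but P n is g^n b and loses its pairing with a, so the limit is orthogonal to
    a.\<close>
  define w where "w n = inverse (norm (P (k (r n)))) *\<^sub>R P (k (r n))" for n
  have Ppos: "norm (P n) > 0" for n using nP by (simp add: null_vec_def)
  have "\<And>n. w n \<in> {p. norm p = 1 \<and> lor p p = 0}"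
    using nP Ppos by (auto simp: w_def null_vec_def lor_simps)
  then obtain l s where l: "norm l = 1" "lor l l = 0" and s: "strict_mono s" "(w \<circ> s) \<longlonglongrightarrow> l"
    using compact_null_unit unfolding compact_def by (metis (mono_tags, lifting) mem_Collect_eq)
  have "(\<lambda>n. (?e (s n) *\<^sub>R C (k (r (s n)))) *v w (s n)) \<longlonglongrightarrow> rank1 u v *v l"
    using LIMSEQ_subseq_LIMSEQ[OF lim s(1)] s(2) by (intro tendsto_intros) (auto simp: o_def)
  moreover have "(?e (s n) *\<^sub>R C (k (r (s n)))) *v w (s n) = (?e (s n) * d) *\<^sub>R w (s n)" for n
    by (simp add: w_def scaleR_matrix_vector_assoc[symmetric] matrix_vector_mult_scaleR CP)
  moreover have "(\<lambda>n. (?e (s n) * d) *\<^sub>R w (s n)) \<longlonglongrightarrow> (0 * d) *\<^sub>R l"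
    using LIMSEQ_subseq_LIMSEQ[OF eps s(1)] s(2) by (intro tendsto_intros) (auto simp: o_def)
  ultimately have "rank1 u v *v l = 0" by (simp add: LIMSEQ_unique)
  then have "lor v l = 0" using uv by (auto simp: rank1_mult null_vec_def)
  then have lql: "lor q l = 0" using \<beta> by (simp add: lor_simps)
  have nl: "null_vec l" using l by (auto simp: null_vec_def)
  then obtain \<gamma> where \<gamma>: "\<gamma> \<noteq> 0" "l = \<gamma> *\<^sub>R q" using null_vec_dependent lql q by blast
  have "lor a (w n) = (lor a b / lor q b) * (inverse (c\<^sup>2) ^ k (r n)) * lor q (w n)" for n
  proof -
    define m where "m = k (r n)"
    have 1: "lor a b = c ^ m * lor a (P m)" and 2: "lor q b = inverse c ^ m * lor q (P m)"
      using lorentz_lor[OF lG, of m a b] lorentz_lor[OF lG, of m q b] Gq[of m] by (simp_all add: P_def lor_simps)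
    have "lor a (P m) = inverse c ^ m * lor a b" "lor q (P m) = c ^ m * lor q b"
      unfolding 1 2 using cc(2) by (simp_all add: power_inverse)
    then show ?thesis using bq(2) cc(2)
      by (simp add: w_def lor_simps power_inverse power2_eq_square power_mult_distrib flip: m_def)
  qed
  moreover have "(\<lambda>n. (lor a b / lor q b) * (inverse (c\<^sup>2) ^ k (r (s n))) * lor q (w (s n))) \<longlonglongrightarrow> (lor a b / lor q b) * 0 * lor q l"
  proof -
    have "\<bar>inverse (c\<^sup>2)\<bar> < 1" using cc(1)
      by (metis abs_ge_zero abs_inverse inverse_less_1_iff less_le_not_le one_less_power power2_abs pos2 abs_power2)
    then have pow: "(\<lambda>n. inverse (c\<^sup>2) ^ n) \<longlonglongrightarrow> 0" by (simp add: LIMSEQ_abs_realpow_zero2)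
    have "filterlim (\<lambda>n. k (r (s n))) at_top sequentially"
    proof (rule filterlim_at_top_mono[OF filterlim_ident])
      have "n \<le> k (r (s n))" for n using k(1)[of "r (s n)"] seq_suble[OF r, of "s n"] seq_suble[OF s(1), of n] by linarith
      then show "\<forall>\<^sub>F n in sequentially. n \<le> k (r (s n))" by simp
    qed
    from filterlim_compose[OF pow this] have "(\<lambda>n. inverse (c\<^sup>2) ^ k (r (s n))) \<longlonglongrightarrow> 0" .
    then show ?thesis using s(2) by (intro tendsto_intros) (auto simp: o_def)
  qed
  moreover have "(\<lambda>n. lor a (w (s n))) \<longlonglongrightarrow> lor a l" using s(2) by (intro tendsto_intros) (auto simp: o_def)
  ultimately have "lor a l = 0" by (simp add: LIMSEQ_unique)
  then show False using \<gamma> aq by (simp add: lor_simps)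
qed

text \<open>Take some partner a of p and some partner b of q. After a swap (p, a) and (b, q) compose
  unless a and b are parallel; in that case an element moving the direction b separates them
  first.\<close>

lemma all_cluster_pairs:
  assumes "null_vec p" "null_vec q"
  shows "cluster_pair p q"
proof -
  obtain a where a: "cluster_pair p a" using cluster_pair_exists assms by blast
  obtain b where b: "cluster_pair q b" using cluster_pair_exists assms by blast
  have na: "null_vec a" "null_vec b" using a b by (auto simp: cluster_pair_def)
  show ?thesis
  proof (cases "lor a b = 0")
    case False
    then show ?thesis using cluster_pair_compose[OF a cluster_pair_swap[OF b]] by simp
  next
    case True
    then obtain k where k: "k \<noteq> 0" "a = k *\<^sub>R b" using null_vec_dependent[of b a] na by (auto simp: lor_commute)
    obtain A where A: "A \<in> \<Gamma>" "\<nexists>c. A *v b = c *\<^sub>R b" using no_global_fixed_point[OF na(2)] by blast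
    have "null_vec (A *v b)" using A lorentz_mem na by (simp add: null_vec_lorentz)
    then have "lor b (A *v b) \<noteq> 0" using null_vec_dependent[OF na(2)] A(2) by metis
    then have "lor (lor_adj A *v a) b \<noteq> 0" using k by (simp add: lor_adj lor_simps)
    then show ?thesis using cluster_pair_compose[OF cluster_pair_move[OF a A(1)] cluster_pair_swap[OF b]] by simp
  qed
qed

end

section \<open>The Kulkarni limit set of a group with full limit set\<close>

text \<open>On the complement of the axis the form is positive definite and preserved, so orbits are
  bounded and have Cauchy subsequences; pulling a small difference back by the earlier power yields
  a power close to the identity. Both vectors are treated at once since the same exponents must
  serve the real and the imaginary part.\<close>

lemma loxodromic_recurrence:
  assumes g: "loxodromic g c p q"
    and x: "lor p x = 0" "lor q x = 0" and y: "lor p y = 0" "lor q y = 0"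
  obtains s where "\<And>k. s k \<ge> k" "(\<lambda>k. mpow g (s k) *v x) \<longlonglongrightarrow> x" "(\<lambda>k. mpow g (s k) *v y) \<longlonglongrightarrow> y"
proof -
  have lg: "lorentz (mpow g n)" for n using g by (simp add: loxodromic_def lorentz_mpow)
  have c0: "c \<noteq> 0" using g by (auto simp: loxodromic_def)
  obtain b where b: "b > 0" "\<And>x. lor p x = 0 \<Longrightarrow> lor q x = 0 \<Longrightarrow> lor x x \<ge> b * (norm x)\<^sup>2"
    by (rule null_pair_complement[of p q]) (use g in \<open>auto simp: loxodromic_def null_vec_def\<close>)
  have pn: "mpow g n *v p = (c ^ n) *\<^sub>R p" "mpow g n *v q = (inverse c ^ n) *\<^sub>R q" for n
    using g by (auto intro!: mpow_eigen simp: loxodromic_def)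
  have inv: "lor p (mpow g n *v u) = 0" "lor q (mpow g n *v u) = 0" if "lor p u = 0" "lor q u = 0" for n u
    using lorentz_lor[OF lg, of n p u] lorentz_lor[OF lg, of n q u] pn[of n] that c0 by (simp_all add: lor_simps)
  have bnd: "norm (mpow g n *v u) \<le> sqrt (lor u u / b)" if "lor p u = 0" "lor q u = 0" for n u
  proof -
    have "b * (norm (mpow g n *v u))\<^sup>2 \<le> lor (mpow g n *v u) (mpow g n *v u)"
      using b(2) inv[OF that] by blast
    also have "\<dots> = lor u u" using lg by (simp add: lorentz_lor)
    finally show ?thesis using b(1) by (intro real_le_rsqrt) (simp add: field_simps)
  qed
  have "bounded (range (\<lambda>n. (mpow g n *v x, mpow g n *v y)))"
    unfolding bounded_iff using bnd[OF x] bnd[OF y]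
    by (intro exI[of _ "sqrt (lor x x / b) + sqrt (lor y y / b)"]) (force intro: order_trans[OF norm_Pair_le] add_mono)
  then obtain l r where r: "strict_mono (r :: nat \<Rightarrow> nat)" "((\<lambda>n. (mpow g n *v x, mpow g n *v y)) \<circ> r) \<longlonglongrightarrow> l"
    using bounded_imp_convergent_subsequence by blast
  then have "Cauchy ((\<lambda>n. (mpow g n *v x, mpow g n *v y)) \<circ> r)" by (simp add: LIMSEQ_imp_Cauchy)
  then have cau: "\<exists>M. \<forall>m\<ge>M. \<forall>n\<ge>M. norm (mpow g (r m) *v x - mpow g (r n) *v x) < e \<and> norm (mpow g (r m) *v y - mpow g (r n) *v y) < e"
    if "e > 0" for e
  proof -
    have "\<exists>M. \<forall>m\<ge>M. \<forall>n\<ge>M. dist (mpow g (r m) *v x, mpow g (r m) *v y) (mpow g (r n) *v x, mpow g (r n) *v y) < e"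
      using \<open>Cauchy _\<close> that unfolding Cauchy_def o_def by blast
    then obtain M where M: "\<And>m n. m \<ge> M \<Longrightarrow> n \<ge> M \<Longrightarrow> dist (mpow g (r m) *v x, mpow g (r m) *v y) (mpow g (r n) *v x, mpow g (r n) *v y) < e"
      by blast
    show ?thesis
    proof (intro exI[of _ M] allI impI)
      fix m n assume "m \<ge> M" "n \<ge> M"
      from M[OF this] show "norm (mpow g (r m) *v x - mpow g (r n) *v x) < e \<and> norm (mpow g (r m) *v y - mpow g (r n) *v y) < e"
        using dist_fst_le[of "(mpow g (r m) *v x, mpow g (r m) *v y)" "(mpow g (r n) *v x, mpow g (r n) *v y)"]
          dist_snd_le[of "(mpow g (r m) *v x, mpow g (r m) *v y)" "(mpow g (r n) *v x, mpow g (r n) *v y)"]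
        by (simp add: dist_norm)
    qed
  qed
  have pull_back: "sqrt b * norm (mpow g k *v u - u) \<le> norm (mpow g (i + k) *v u - mpow g i *v u)"
    if u: "lor p u = 0" "lor q u = 0" for i k u
  proof -
    let ?w = "mpow g k *v u - u"
    have "b * (norm ?w)\<^sup>2 \<le> lor ?w ?w"
      using b(2)[of ?w] inv[OF u] u by (simp add: lor_simps)
    also have "\<dots> = lor (mpow g i *v ?w) (mpow g i *v ?w)" using lg by (simp add: lorentz_lor)
    also have "\<dots> \<le> (norm (mpow g i *v ?w))\<^sup>2"
      using abs_lor_le[of "mpow g i *v ?w" "mpow g i *v ?w"] by (simp add: power2_eq_square)
    also have "mpow g i *v ?w = mpow g (i + k) *v u - mpow g i *v u"
      by (simp add: mpow_add matrix_vector_mul_assoc matrix_vector_mult_diff_distrib)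
    finally have "(sqrt b * norm ?w)\<^sup>2 \<le> (norm (mpow g (i + k) *v u - mpow g i *v u))\<^sup>2"
      using b(1) by (simp add: power_mult_distrib)
    then show ?thesis by (rule power2_le_imp_le) simp
  qed
  have "\<exists>j\<ge>k. norm (mpow g j *v x - x) < inverse (real (Suc k)) \<and> norm (mpow g j *v y - y) < inverse (real (Suc k))" for k
  proof -
    define e where "e = sqrt b * inverse (real (Suc k))"
    have "e > 0" using b(1) by (simp add: e_def)
    then obtain M where M: "\<And>m n. m \<ge> M \<Longrightarrow> n \<ge> M \<Longrightarrow>
      norm (mpow g (r m) *v x - mpow g (r n) *v x) < e \<and> norm (mpow g (r m) *v y - mpow g (r n) *v y) < e"
      using cau by blast
    \<comment> \<open>Guarantees r n - r M >= k, because r n >= n.\<close>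
    define n where "n = M + r M + k"
    have rn: "r n \<ge> n" using seq_suble[OF r(1)] .
    define j where "j = r n - r M"
    have j: "j \<ge> k" "r M + j = r n" using rn by (auto simp: j_def n_def)
    have "norm (mpow g (r n) *v x - mpow g (r M) *v x) < e" "norm (mpow g (r n) *v y - mpow g (r M) *v y) < e"
      using M[of n M] by (auto simp: n_def)
    then have "sqrt b * norm (mpow g j *v x - x) < e" "sqrt b * norm (mpow g j *v y - y) < e"
      using pull_back[OF x, of j "r M"] pull_back[OF y, of j "r M"] j by auto
    then show ?thesis using b(1) j by (auto simp: e_def)
  qed
  then obtain s where s: "\<And>k. s k \<ge> k" "\<And>k. norm (mpow g (s k) *v x - x) < inverse (real (Suc k))"
    "\<And>k. norm (mpow g (s k) *v y - y) < inverse (real (Suc k))"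
    by metis
  have "(\<lambda>k. mpow g (s k) *v x - x) \<longlonglongrightarrow> 0" "(\<lambda>k. mpow g (s k) *v y - y) \<longlonglongrightarrow> 0"
    by (rule Lim_null_comparison[OF _ LIMSEQ_inverse_real_of_nat];
        use s in \<open>auto intro!: always_eventually less_imp_le\<close>)+
  then have "(\<lambda>k. mpow g (s k) *v x) \<longlonglongrightarrow> x" "(\<lambda>k. mpow g (s k) *v y) \<longlonglongrightarrow> y"
    by (simp_all add: LIM_zero_iff)
  with s(1) show ?thesis using that by blast
qed

lemma closed_Kul_limit_set: "closed (Kul_limit_set G)"
  by (simp add: Kul_limit_set_def Kul_L0_def Kul_L1_def Kul_L2_def closed_Un)

lemma tendsto_vector_scalar_mult [tendsto_intros]:
  fixes f :: "'b \<Rightarrow> complex" and z :: "'b \<Rightarrow> complex ^ 'n::finite"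
  assumes "(f \<longlongrightarrow> c) F" "(z \<longlongrightarrow> w) F"
  shows "((\<lambda>n. f n *s z n) \<longlongrightarrow> c *s w) F"
  unfolding vector_scalar_mult_def using assms by (intro tendsto_intros)

lemma complement_combination_nonzero:
  assumes "null_vec p" "null_vec q" "lor p q \<noteq> 0" "v \<noteq> 0"
    "lor p (re_vec v) = 0" "lor q (re_vec v) = 0" "lor p (im_vec v) = 0" "lor q (im_vec v) = 0"
  shows "v + a *s real_vec p + b *s real_vec q \<noteq> 0"
proof
  assume eq: "v + a *s real_vec p + b *s real_vec q = 0"
  have re: "re_vec v + Re a *\<^sub>R p + Re b *\<^sub>R q = 0"
    using arg_cong[OF eq, of re_vec] by simp
  have im: "im_vec v + Im a *\<^sub>R p + Im b *\<^sub>R q = 0"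
    using arg_cong[OF eq, of im_vec] by simp
  have "lor p (re_vec v + Re a *\<^sub>R p + Re b *\<^sub>R q) = 0" "lor q (re_vec v + Re a *\<^sub>R p + Re b *\<^sub>R q) = 0"
    "lor p (im_vec v + Im a *\<^sub>R p + Im b *\<^sub>R q) = 0" "lor q (im_vec v + Im a *\<^sub>R p + Im b *\<^sub>R q) = 0"
    unfolding re im by simp_all
  then have "Re a = 0" "Re b = 0" "Im a = 0" "Im b = 0"
    using assms by (simp_all add: lor_simps null_vec_def lor_commute[of q p])
  then have "v = 0" using re im by (simp add: complex_vec_eq_iff)
  then show False using assms by simp
qed

context full_limit_group
begin

lemma Kul_limit_set_eq_subset: "Kul_limit_set (cmat ` \<Gamma>) \<subseteq> tangent_set"
  using Kul_limit_set_subset bdHR_subset_L1 by blast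

text \<open>Points on the ray from v towards the repelling direction are pushed by powers of g to points on the
  ray from v towards the attracting one, so one of the two rays consists of limit points.\<close>

lemma loxodromic_dichotomy:
  assumes g: "g \<in> \<Gamma>" "loxodromic g c p q" and v: "v \<noteq> 0"
    "lor p (re_vec v) = 0" "lor q (re_vec v) = 0" "lor p (im_vec v) = 0" "lor q (im_vec v) = 0"
    and out: "proj (v + b *s real_vec q) \<notin> Kul_limit_set (cmat ` \<Gamma>)"
  shows "proj (v + a *s real_vec p) \<in> Kul_limit_set (cmat ` \<Gamma>)"
proof -
  have c: "\<bar>c\<bar> > 1" "c \<noteq> 0" and pq: "null_vec p" "null_vec q" "lor p q \<noteq> 0" using g by (auto simp: loxodromic_def)
  have lg: "lorentz (mpow g n)" for n using g by (simp add: loxodromic_def lorentz_mpow)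
  have pn: "mpow g n *v p = (c ^ n) *\<^sub>R p" "mpow g n *v q = (inverse c ^ n) *\<^sub>R q" for n
    using g by (auto intro!: mpow_eigen simp: loxodromic_def)
  obtain s where s: "\<And>k. s k \<ge> k" "(\<lambda>k. mpow g (s k) *v re_vec v) \<longlonglongrightarrow> re_vec v"
     "(\<lambda>k. mpow g (s k) *v im_vec v) \<longlonglongrightarrow> im_vec v"
    using loxodromic_recurrence[OF g(2) v(2,3,4,5)] by metis
  define \<epsilon> where "\<epsilon> k = inverse c ^ s k" for k
  have "filterlim s at_top sequentially"
    by (rule filterlim_at_top_mono[OF filterlim_ident]) (use s(1) in simp)
  moreover have "(\<lambda>n. inverse c ^ n) \<longlonglongrightarrow> 0"
  proof (rule LIMSEQ_power_zero)
    show "norm (inverse c) < 1" using c by (simp add: field_simps)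
  qed
  ultimately have eps: "\<epsilon> \<longlonglongrightarrow> 0" unfolding \<epsilon>_def by (rule filterlim_compose[rotated])
  \<comment> \<open>The power g^(s k) multiplies p by 1/\<epsilon> k and q by \<epsilon> k. So y k
    tends to v + b q, while its image tends to v + a p.\<close>
  define y where "y k = v + (of_real (\<epsilon> k) * a) *s real_vec p + b *s real_vec q" for k
  define y0 where "y0 = v + b *s real_vec q"
  define u where "u = v + a *s real_vec p"
  have y0: "y0 \<noteq> 0" using complement_combination_nonzero[OF pq v, of 0 b] by (simp add: y0_def)
  have u0: "u \<noteq> 0" using complement_combination_nonzero[OF pq v, of a 0] by (simp add: u_def)
  have yn: "y k \<noteq> 0" for k unfolding y_def using complement_combination_nonzero[OF pq v] .
  have ylim: "y \<longlonglongrightarrow> y0"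
  proof -
    have "(\<lambda>k. v + (of_real (\<epsilon> k) * a) *s real_vec p + b *s real_vec q) \<longlonglongrightarrow> v + (of_real 0 * a) *s real_vec p + b *s real_vec q"
      by (intro tendsto_intros eps)
    then have "y \<longlonglongrightarrow> v + (of_real 0 * a) *s real_vec p + b *s real_vec q" by (simp only: y_def[abs_def])
    then show ?thesis by (simp add: y0_def)
  qed
  let ?L = "Kul_L0 (cmat ` \<Gamma>) \<union> Kul_L1 (cmat ` \<Gamma>)"
  have "closed ?L" by (simp add: Kul_L0_def Kul_L1_def closed_Un)
  moreover have "proj y0 \<in> - ?L" using out by (auto simp: Kul_limit_set_def y0_def)
  ultimately have "\<forall>\<^sub>F k in sequentially. proj (y k) \<in> - ?L"
    by (intro topological_tendstoD[OF tendsto_proj[OF ylim y0]] open_Compl)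
  then obtain N where N: "\<And>k. k \<ge> N \<Longrightarrow> proj (y k) \<in> - ?L" by (auto simp: eventually_sequentially)
  \<comment> \<open>A convergent sequence with its limit is compact; starting at N keeps it away
    from \<open>Kul_L0\<close> and \<open>Kul_L1\<close>, as the definition of \<open>Kul_L2\<close>
    demands.\<close>
  define K where "K = proj ` insert y0 (range (\<lambda>k. y (k + N)))"
  have "compact (insert y0 (range (\<lambda>k. y (k + N))))"
    using LIMSEQ_ignore_initial_segment[OF ylim] by (rule compact_sequence_with_limit)
  then have "compact K" unfolding K_def using y0 yn
    by (intro compact_continuous_image continuous_on_subset[OF continuous_on_proj]) auto
  moreover have "K \<subseteq> - ?L" using N \<open>proj y0 \<in> - ?L\<close> by (auto simp: K_def)
  moreover have "proj u \<in> cluster_points (cmat ` \<Gamma>) K"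
    unfolding cluster_points_def
  proof (intro CollectI allI impI, elim conjE)
    fix U assume U: "open U" "proj u \<in> U"
    have im: "cmat (mpow g (s k)) *v y k =
        cplx (mpow g (s k) *v re_vec v) (mpow g (s k) *v im_vec v) + a *s real_vec p + (of_real (\<epsilon> k) * b) *s real_vec q" for k
    proof -
      have "mpow g (s k) *v ((\<epsilon> k * r) *\<^sub>R p) = r *\<^sub>R p" "mpow g (s k) *v (r *\<^sub>R q) = (\<epsilon> k * r) *\<^sub>R q" for r
        using c(2) by (simp_all add: matrix_vector_mult_scaleR pn \<epsilon>_def power_inverse)
      then show ?thesis
        by (simp add: complex_vec_eq_iff y_def matrix_vector_right_distrib)
    qed
    have "(\<lambda>k. cplx (mpow g (s k) *v re_vec v) (mpow g (s k) *v im_vec v) + a *s real_vec p + (of_real (\<epsilon> k) * b) *s real_vec q)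
       \<longlonglongrightarrow> cplx (re_vec v) (im_vec v) + a *s real_vec p + (of_real 0 * b) *s real_vec q"
      by (intro tendsto_intros s eps)
    then have "(\<lambda>k. cmat (mpow g (s k)) *v y k) \<longlonglongrightarrow> u" by (simp add: im u_def)
    from tendsto_proj[OF this u0] have "\<forall>\<^sub>F k in sequentially. proj (cmat (mpow g (s k)) *v y k) \<in> U"
      using U topological_tendstoD by blast
    then obtain M where M: "\<And>k. k \<ge> M \<Longrightarrow> proj (cmat (mpow g (s k)) *v y k) \<in> U"
      by (auto simp: eventually_sequentially)
    \<comment> \<open>The exponents s k may repeat, so infinitude is counted on their range;
      distinct exponents give distinct powers because |c| > 1.\<close>
    define T where "T = s ` {M + N..}"
    have "infinite T"
      unfolding infinite_nat_iff_unbounded_le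
    proof
      fix n show "\<exists>k\<ge>n. k \<in> T" using s(1)[of "M + N + n"] by (intro exI[of _ "s (M + N + n)"]) (auto simp: T_def)
    qed
    moreover have "inj_on (mpow g) T"
    proof (rule inj_onI)
      fix i j assume "mpow g i = mpow g j"
      then have "(c ^ i) *\<^sub>R p = (c ^ j) *\<^sub>R p" by (metis pn(1))
      then have "\<bar>c\<bar> ^ i = \<bar>c\<bar> ^ j" using pq by (simp add: null_vec_def flip: power_abs)
      then show "i = j" using c(1) by (simp add: power_inject_exp)
    qed
    ultimately have "infinite (mpow g ` T)" by (simp add: finite_image_iff)
    moreover have "mpow g ` T \<subseteq> {h \<in> \<Gamma>. pact (cmat h) ` K \<inter> U \<noteq> {}}"
    proof
      fix h assume "h \<in> mpow g ` T"
      then obtain k where k: "k \<ge> M + N" "h = mpow g (s k)" by (auto simp: T_def)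
      have "h \<in> \<Gamma>" using k g by (simp add: mpow_mem)
      moreover have "proj (y k) \<in> K" using k by (auto simp: K_def intro!: image_eqI[of _ _ "k - N"])
      moreover have "pact (cmat h) (proj (y k)) \<in> U" using M[of k] k lg yn by (simp add: pact_cmat)
      ultimately show "h \<in> {h \<in> \<Gamma>. pact (cmat h) ` K \<inter> U \<noteq> {}}" by blast
    qed
    ultimately show "infinite {h \<in> cmat ` \<Gamma>. pact h ` K \<inter> U \<noteq> {}}"
      using finite_subset unfolding infinite_cmat_image by blast
  qed
  ultimately have "proj u \<in> Kul_L2 (cmat ` \<Gamma>)"
    unfolding Kul_L2_def by (intro subsetD[OF closure_subset] UN_I[of K]) auto
  then show ?thesis by (simp add: Kul_limit_set_def u_def)
qed

text \<open>Axes of loxodromic elements approximate (p, q). The projection of u to the complement of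
  such an axis is a limit point by the dichotomy with a = b = 0, where lying outside the limit set
  would imply lying in it; closedness yields u.\<close>

lemma pair_complement_in_limit_set:
  assumes "null_vec p" "null_vec q" "lor p q \<noteq> 0" "u \<noteq> 0"
    "lor p (re_vec u) = 0" "lor q (re_vec u) = 0" "lor p (im_vec u) = 0" "lor q (im_vec u) = 0"
  shows "proj u \<in> Kul_limit_set (cmat ` \<Gamma>)"
proof -
  have "\<exists>g c p' q'. g \<in> \<Gamma> \<and> loxodromic g c p' q' \<and> norm (p' - p) \<le> inverse (real (Suc n)) \<and> norm (q' - q) \<le> inverse (real (Suc n))" for n
    by (rule loxodromic_near_pair[OF all_cluster_pairs[OF assms(1,2)] assms(3), of "inverse (real (Suc n))"]) (simp, blast)
  then obtain g c P Q where g: "\<And>n. g n \<in> \<Gamma>" "\<And>n. loxodromic (g n) (c n) (P n) (Q n)"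
    and near: "\<And>n. norm (P n - p) \<le> inverse (real (Suc n))" "\<And>n. norm (Q n - q) \<le> inverse (real (Suc n))"
    by metis
  have "(\<lambda>n. P n - p) \<longlonglongrightarrow> 0" "(\<lambda>n. Q n - q) \<longlonglongrightarrow> 0"
    by (rule Lim_null_comparison[OF _ LIMSEQ_inverse_real_of_nat]; use near in simp)+
  then have lim: "P \<longlonglongrightarrow> p" "Q \<longlonglongrightarrow> q" by (simp_all add: LIM_zero_iff)
  define f where "f n x = x - (lor (Q n) x / lor (P n) (Q n)) *\<^sub>R P n - (lor (P n) x / lor (P n) (Q n)) *\<^sub>R Q n" for n x
  define w where "w n = cplx (f n (re_vec u)) (f n (im_vec u))" for n
  have "(\<lambda>n. f n x) \<longlonglongrightarrow> x - (lor q x / lor p q) *\<^sub>R p - (lor p x / lor p q) *\<^sub>R q" for x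
    unfolding f_def by (intro tendsto_intros lim assms(3))
  then have fl: "(\<lambda>n. f n (re_vec u)) \<longlonglongrightarrow> re_vec u" "(\<lambda>n. f n (im_vec u)) \<longlonglongrightarrow> im_vec u"
    using assms by (metis (no_types) diff_zero div_0 scale_zero_left)+
  have "w \<longlonglongrightarrow> cplx (re_vec u) (im_vec u)" unfolding w_def by (intro tendsto_intros fl)
  then have w: "w \<longlonglongrightarrow> u" by simp
  have PQ: "null_vec (P n)" "null_vec (Q n)" "lor (P n) (Q n) \<noteq> 0" for n using g(2)[of n] by (auto simp: loxodromic_def)
  have perp: "lor (P n) (f n x) = 0" "lor (Q n) (f n x) = 0" for n x
    using PQ[of n] by (simp_all add: f_def lor_simps null_vec_def lor_commute[of "Q n" "P n"])
  have "\<forall>\<^sub>F n in sequentially. w n \<in> - {0}"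
    using topological_tendstoD[OF w, of "- {0}"] assms(4) by (simp add: open_Compl)
  then have "\<forall>\<^sub>F n in sequentially. proj (w n) \<in> Kul_limit_set (cmat ` \<Gamma>)"
  proof eventually_elim
    case (elim n)
    then show ?case
      using loxodromic_dichotomy[OF g, of "w n" n 0 0] perp by (auto simp: w_def)
  qed
  then show ?thesis
    using Lim_in_closed_set[OF closed_Kul_limit_set _ _ tendsto_proj[OF w assms(4)]] by simp
qed

end

section \<open>Orthogonal representatives and complements of planes\<close>

text \<open>The complex bilinear extension of the form, evaluated at (z, z).\<close>

definition qform :: "complex ^ ('m::finite option) \<Rightarrow> complex" where
  "qform z = Complex (lor (re_vec z) (re_vec z) - lor (im_vec z) (im_vec z)) (2 * lor (re_vec z) (im_vec z))"

lemma qform_scale: "qform (c *s z) = c\<^sup>2 * qform z"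
  by (simp add: qform_def complex_eq_iff lor_simps lor_commute[of "im_vec z" "re_vec z"] power2_eq_square algebra_simps)

lemma phase_rotation:
  obtains c where "c \<noteq> 0" "lor (re_vec (c *s z)) (im_vec (c *s z)) = 0"
    "lor (im_vec (c *s z)) (im_vec (c *s z)) \<le> lor (re_vec (c *s z)) (re_vec (c *s z))"
proof -
  \<comment> \<open>Multiplying by a square root of the conjugate turns \<open>qform z\<close> into
    the real number |qform z|^2, whose being real and nonnegative is the claim.\<close>
  define c where "c = (if qform z = 0 then 1 else csqrt (cnj (qform z)))"
  have "qform (c *s z) = of_real ((cmod (qform z))\<^sup>2)"
  proof -
    have "qform (c *s z) = qform z * cnj (qform z)" by (simp add: c_def qform_scale mult.commute)
    then show ?thesis by (simp only: complex_norm_square)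
  qed
  then have "Im (qform (c *s z)) = 0" "Re (qform (c *s z)) \<ge> 0" by simp_all
  moreover have "c \<noteq> 0" by (simp add: c_def)
  ultimately show ?thesis using that[of c] by (simp add: qform_def del: re_vec_simps im_vec_simps)
qed

text \<open>For m = 2 the space has dimension 3, so the complement of a plane is a line.\<close>

lemma lor_complement_line:
  fixes x y :: "real ^ ('m::finite option)"
  assumes "CARD('m) = 2" "x \<noteq> 0" "\<nexists>c. y = c *\<^sub>R x" "n \<noteq> 0"
    "lor n x = 0" "lor n y = 0" "lor n' x = 0" "lor n' y = 0"
  shows "\<exists>c. n' = c *\<^sub>R n"
proof -
  let ?A = "span {flip y, flip x}"
  let ?W = "{w \<in> UNIV. \<forall>a\<in>?A. orthogonal a w}"
  have "flip y \<notin> span {flip x}"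
  proof
    assume "flip y \<in> span {flip x}"
    then obtain k where "flip y = k *\<^sub>R flip x" by (auto simp: span_singleton)
    then have "flip (flip y) = flip (k *\<^sub>R flip x)" by simp
    then have "y = k *\<^sub>R x" by (simp add: linear_simps(5)[OF bounded_linear_flip])
    then show False using assms(3) by blast
  qed
  then have "dim {flip y, flip x} = 2" using assms(2) by (simp add: dim_insert)
  then have "dim ?A = 2" by simp
  moreover have "dim ?W + dim ?A = dim (UNIV :: (real ^ ('m option)) set)"
    by (intro dim_subspace_orthogonal_to_vectors) auto
  ultimately have W1: "dim ?W = 1" using assms(1) by simp
  have sW: "subspace ?W" using subspace_orthogonal_to_vectors[of ?A] by (simp add: orthogonal_commute)
  have mem: "w \<in> ?W" if "lor w x = 0" "lor w y = 0" for w
  proof -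
    have "orthogonal w b" if "b \<in> {flip y, flip x}" for b
      using that \<open>lor w x = 0\<close> \<open>lor w y = 0\<close> by (auto simp: orthogonal_def lor_inner2)
    then have "orthogonal w a" if "a \<in> ?A" for a
      using orthogonal_to_span[OF that] by blast
    then show ?thesis by (simp add: orthogonal_commute)
  qed
  have "span {n} \<subseteq> ?W" using mem[OF assms(5,6)] sW by (intro span_minimal) auto
  moreover have "dim (span {n}) \<ge> dim ?W" using W1 assms(4) by (simp add: dim_insert)
  ultimately have "span {n} = ?W" using sW by (intro subspace_dim_equal) auto
  then have "n' \<in> span {n}" using mem[OF assms(7,8)] by simp
  then show ?thesis by (auto simp: span_singleton)
qed

text \<open>Project \<open>tvec\<close> off the two spacelike vectors; this only lowers the value of
  the form.\<close>

lemma timelike_complement: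
  assumes "lor x x > 0" "lor y y > 0" "lor x y = 0"
  obtains t where "lor t t < 0" "lor t x = 0" "lor t y = 0"
proof -
  define t where "t = tvec - (lor tvec x / lor x x) *\<^sub>R x - (lor tvec y / lor y y) *\<^sub>R y"
  have yx: "lor y x = 0" using assms(3) by (simp add: lor_commute)
  have tx: "lor t x = 0" "lor t y = 0" using assms yx by (simp_all add: t_def lor_simps del: lor_tvec)
  have "lor t t = lor t tvec" using tx by (subst (2) t_def) (simp add: lor_simps del: lor_tvec)
  also have "\<dots> = - 1 - (lor tvec x)\<^sup>2 / lor x x - (lor tvec y)\<^sup>2 / lor y y"
    by (simp add: t_def lor_simps lor_commute[of x tvec] lor_commute[of y tvec] power2_eq_square)
  also have "\<dots> < 0" using assms by (smt (verit) divide_nonneg_pos zero_le_power2)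
  finally show ?thesis using that[of t] tx by simp
qed

lemma spacelike_if_tvec_orthogonal:
  assumes "s \<noteq> 0" "lor tvec s = 0"
  shows "lor s s > 0"
  using timelike_orthogonal_pos[of tvec s] assms by simp

section \<open>Tangent hyperplanes consist of limit points\<close>

context full_limit_group
begin

text \<open>Reflecting p in a timelike vector t orthogonal to x and y gives a second null vector q
  orthogonal to both, so x + iy lies in the complement of the axis (p, q).\<close>

lemma spacelike_plane_in_limit_set:
  assumes p: "null_vec p" "lor p x = 0" "lor p y = 0"
    and xy: "lor x x > 0" "lor y y > 0" "lor x y = 0"
  shows "proj (cplx x y) \<in> Kul_limit_set (cmat ` \<Gamma>)"
proof -
  obtain t where t: "lor t t < 0" "lor t x = 0" "lor t y = 0"
    by (rule timelike_complement[OF xy])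
  have pt: "lor p t \<noteq> 0" using null_timelike p(1) t(1) by blast
  define q where "q = p - (2 * lor p t / lor t t) *\<^sub>R t"
  have pp: "lor p p = 0" using p by (simp add: null_vec_def)
  have "lor p q = - 2 * (lor p t)\<^sup>2 / lor t t" using pp by (simp add: q_def lor_simps power2_eq_square)
  then have pq: "lor p q \<noteq> 0" using pt t by simp
  have "lor q q = 0" using pp t(1) by (simp add: q_def lor_simps lor_commute[of t p])
  then have "null_vec q" using pq by (auto simp: null_vec_def)
  moreover have "lor q x = 0" "lor q y = 0" using p t by (simp_all add: q_def lor_simps)
  moreover have "x \<noteq> 0" using xy by auto
  ultimately show ?thesis using pair_complement_in_limit_set[OF p(1) _ pq, of "cplx x y"] p by simp
qed

text \<open>Up to a phase u has orthogonal parts, each spacelike or a multiple of p. Both are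
  perturbed inside the hyperplane to orthogonal spacelike vectors; the room for a second direction
  comes from m >= 3.\<close>

lemma hyperplane_in_limit_set_ge_3:
  assumes m: "CARD('m) \<ge> 3" and p: "null_vec p" and u: "u \<noteq> 0" "lor p (re_vec u) = 0" "lor p (im_vec u) = 0"
  shows "proj u \<in> Kul_limit_set (cmat ` \<Gamma>)"
proof -
  obtain c where c: "c \<noteq> 0" "lor (re_vec (c *s u)) (im_vec (c *s u)) = 0"
    "lor (im_vec (c *s u)) (im_vec (c *s u)) \<le> lor (re_vec (c *s u)) (re_vec (c *s u))"
    by (rule phase_rotation)
  define x where "x = re_vec (c *s u)"
  define y where "y = im_vec (c *s u)"
  have z: "c *s u = cplx x y" by (simp only: x_def y_def cplx_re_im)
  have cu: "c *s u \<noteq> 0" using c(1) u(1) by simp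
  have px: "lor p x = 0" "lor p y = 0" using u by (simp_all add: x_def y_def lor_simps)
  have xy: "lor x y = 0" "lor y y \<le> lor x x" using c by (simp_all only: x_def y_def)
  have pp: "lor p p = 0" "p \<noteq> 0" using p by (auto simp: null_vec_def)
  have ge: "lor x x \<ge> 0" "lor y y \<ge> 0" using null_orthogonal(1)[OF pp] px by auto
  \<comment> \<open>The last property makes s2, chosen orthogonal to p and s1, orthogonal to x as
    well, so the perturbed vectors stay orthogonal.\<close>
  obtain s1 where s1: "lor p s1 = 0" "lor s1 y = 0" "\<And>d. d > 0 \<Longrightarrow> lor (x + d *\<^sub>R s1) (x + d *\<^sub>R s1) > 0"
    "\<And>s. lor p s = 0 \<Longrightarrow> lor s1 s = 0 \<Longrightarrow> lor x s = 0"
  proof (cases "lor x x > 0")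
    case True
    have "lor (x + d *\<^sub>R x) (x + d *\<^sub>R x) > 0" if "d > 0" for d
    proof -
      have "lor (x + d *\<^sub>R x) (x + d *\<^sub>R x) = (1 + d)\<^sup>2 * lor x x" by (simp add: lor_simps power2_eq_square algebra_simps)
      then show ?thesis using True that by simp
    qed
    then show ?thesis using that[of x] px xy by blast
  next
    case False
    then have "lor x x = 0" "lor y y = 0" using ge xy by auto
    then obtain \<alpha> \<beta> where ab: "x = \<alpha> *\<^sub>R p" "y = \<beta> *\<^sub>R p" using null_orthogonal(2)[OF pp] px by metis
    have "card {p, tvec} < CARD('m) + 1" using m card_insert_le_m1[of 2 "{tvec}" p] by simp
    then obtain s where s: "s \<noteq> 0" "lor p s = 0" "lor tvec s = 0" using exists_lor_orthogonal[of "{p, tvec}"] by auto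
    have "lor s s > 0" using spacelike_if_tvec_orthogonal s by blast
    then have "lor (x + d *\<^sub>R s) (x + d *\<^sub>R s) > 0" if "d > 0" for d
      using that pp s by (simp add: ab lor_simps lor_commute[of s p])
    moreover have "lor s y = 0" using s by (simp add: ab lor_simps lor_commute[of s p])
    moreover have "lor x r = 0" if "lor p r = 0" for r using that by (simp add: ab lor_simps)
    ultimately show ?thesis using that[of s] s by blast
  qed
  obtain s2 where s2: "lor p s2 = 0" "lor x s2 = 0" "lor s1 s2 = 0" "\<And>d. d > 0 \<Longrightarrow> lor (y + d *\<^sub>R s2) (y + d *\<^sub>R s2) > 0"
  proof (cases "lor y y > 0")
    case True
    have "lor (y + d *\<^sub>R y) (y + d *\<^sub>R y) > 0" if "d > 0" for d
    proof -
      have "lor (y + d *\<^sub>R y) (y + d *\<^sub>R y) = (1 + d)\<^sup>2 * lor y y" by (simp add: lor_simps power2_eq_square algebra_simps)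
      then show ?thesis using True that by simp
    qed
    then show ?thesis using that[of y] px xy s1(2) by blast
  next
    case False
    then have "lor y y = 0" using ge by auto
    then obtain \<beta> where ab: "y = \<beta> *\<^sub>R p" using null_orthogonal(2)[OF pp] px by metis
    have "card {p, s1, tvec} \<le> 3" by (simp add: card_insert_if)
    then have "card {p, s1, tvec} < CARD('m) + 1" using m by simp
    then obtain s where s: "s \<noteq> 0" "lor p s = 0" "lor s1 s = 0" "lor tvec s = 0" using exists_lor_orthogonal[of "{p, s1, tvec}"] by auto
    have "lor s s > 0" using spacelike_if_tvec_orthogonal s by blast
    then have "lor (y + d *\<^sub>R s) (y + d *\<^sub>R s) > 0" if "d > 0" for d
      using that pp s by (simp add: ab lor_simps lor_commute[of s p])
    then show ?thesis using that[of s] s s1(4) by blast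
  qed
  define d where "d n = inverse (real (Suc n))" for n
  have d: "d n > 0" for n by (simp add: d_def)
  have dl: "d \<longlonglongrightarrow> 0" unfolding d_def by (rule LIMSEQ_inverse_real_of_nat)
  have "(\<lambda>n. cplx (x + d n *\<^sub>R s1) (y + d n *\<^sub>R s2)) \<longlonglongrightarrow> cplx (x + 0 *\<^sub>R s1) (y + 0 *\<^sub>R s2)"
    by (intro tendsto_intros dl)
  then have lim: "(\<lambda>n. proj (cplx (x + d n *\<^sub>R s1) (y + d n *\<^sub>R s2))) \<longlonglongrightarrow> proj (c *s u)"
    using cu by (intro tendsto_proj) (simp_all add: z)
  have "proj (cplx (x + d n *\<^sub>R s1) (y + d n *\<^sub>R s2)) \<in> Kul_limit_set (cmat ` \<Gamma>)" for n
    using s1 s2 px d xy by (intro spacelike_plane_in_limit_set[OF p]) (simp_all add: lor_simps)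
  then have "proj (c *s u) \<in> Kul_limit_set (cmat ` \<Gamma>)"
    using Lim_in_closed_set[OF closed_Kul_limit_set _ _ lim] by simp
  then show ?thesis using c(1) u(1) by simp
qed

text \<open>A loxodromic element with both fixed points near p0 would contradict the dichotomy: for m = 2 the complement
  of its axis is a line, so both tangent hyperplanes project onto the same v.\<close>

lemma hyperplane_in_limit_set_2:
  assumes m: "CARD('m) = 2" and p0: "null_vec p0" and u0: "u0 \<noteq> 0" "lor p0 (re_vec u0) = 0" "lor p0 (im_vec u0) = 0"
  shows "proj u0 \<in> Kul_limit_set (cmat ` \<Gamma>)"
proof (rule ccontr)
  assume out0: "proj u0 \<notin> Kul_limit_set (cmat ` \<Gamma>)"
  define tangent where "tangent p u \<longleftrightarrow> u \<noteq> 0 \<and> lor p (re_vec u) = 0 \<and> lor p (im_vec u) = 0 \<and> proj u \<notin> Kul_limit_set (cmat ` \<Gamma>)" for p u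
  \<comment> \<open>A multiple of \<open>tvec\<close> moves u0 into the hyperplane of p,
    continuously in p. Hence all hyperplanes near that of p0 contain points outside the limit
    set.\<close>
  define f where "f p = cplx (re_vec u0 - (lor p (re_vec u0) / lor p tvec) *\<^sub>R tvec) (im_vec u0 - (lor p (im_vec u0) / lor p tvec) *\<^sub>R tvec)" for p
  have t0: "lor p0 tvec \<noteq> 0" using p0 null_nth_None by (auto simp: null_vec_def)
  have "(f \<longlongrightarrow> cplx (re_vec u0 - (lor p0 (re_vec u0) / lor p0 tvec) *\<^sub>R tvec) (im_vec u0 - (lor p0 (im_vec u0) / lor p0 tvec) *\<^sub>R tvec)) (nhds p0)"
    unfolding f_def using t0 by (intro tendsto_intros filterlim_ident)
  then have fl: "(f \<longlongrightarrow> u0) (nhds p0)" using u0 by simp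
  have "\<forall>\<^sub>F p in nhds p0. f p \<in> - {0}"
    using topological_tendstoD[OF fl, of "- {0}"] u0(1) by (simp add: open_Compl)
  moreover have "\<forall>\<^sub>F p in nhds p0. proj (f p) \<in> - Kul_limit_set (cmat ` \<Gamma>)"
    using topological_tendstoD[OF tendsto_proj[OF fl u0(1)], of "- Kul_limit_set (cmat ` \<Gamma>)"] out0
    by (simp add: open_Compl closed_Kul_limit_set)
  ultimately have "\<forall>\<^sub>F p in nhds p0. f p \<noteq> 0 \<and> proj (f p) \<notin> Kul_limit_set (cmat ` \<Gamma>)"
    by eventually_elim auto
  then obtain e where e: "e > 0" "\<And>p. dist p p0 < e \<Longrightarrow> f p \<noteq> 0 \<and> proj (f p) \<notin> Kul_limit_set (cmat ` \<Gamma>)"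
    by (auto simp: eventually_nhds_metric)
  have ex: "\<exists>u. tangent p u" if "null_vec p" "norm (p - p0) < e" for p
  proof -
    have "lor p tvec \<noteq> 0" using that(1) null_nth_None by (auto simp: null_vec_def)
    then have "lor p (re_vec (f p)) = 0" "lor p (im_vec (f p)) = 0" by (simp_all add: f_def lor_simps del: lor_tvec)
    then show ?thesis using e(2)[of p] that(2) by (intro exI[of _ "f p"]) (auto simp: tangent_def dist_norm)
  qed
  obtain p1 where p1: "null_vec p1" "lor p0 p1 \<noteq> 0" by (rule null_opposite[OF p0])
  \<comment> \<open>The curve gives a null q0 close to p0 but not orthogonal to it, so that a
    loxodromic element with both fixed directions near p0 exists.\<close>
  obtain s a where sa: "a \<noteq> 0" "\<And>x. x \<noteq> 0 \<Longrightarrow> null_vec (p0 + x *\<^sub>R s + (x\<^sup>2 * a) *\<^sub>R p1)"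
    "\<And>x. lor p0 (p0 + x *\<^sub>R s + (x\<^sup>2 * a) *\<^sub>R p1) = x\<^sup>2 * a * lor p0 p1"
    "\<And>x. lor p1 (p0 + x *\<^sub>R s + (x\<^sup>2 * a) *\<^sub>R p1) = lor p0 p1"
    by (rule null_vec_curve[OF card_ge_2 p0 p1]) blast
  define \<gamma> where "\<gamma> x = p0 + x *\<^sub>R s + (x\<^sup>2 * a) *\<^sub>R p1" for x
  have "\<gamma> \<midarrow>0\<rightarrow> p0 + 0 *\<^sub>R s + (0\<^sup>2 * a) *\<^sub>R p1" unfolding \<gamma>_def by (intro tendsto_intros)
  then have "\<forall>\<^sub>F x in at 0. dist (\<gamma> x) p0 < e / 2" using tendstoD[of \<gamma> p0 "at 0" "e / 2"] e(1) by simp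
  moreover have "\<forall>\<^sub>F x :: real in at 0. x \<noteq> 0" by (rule eventually_neq_at_within)
  ultimately have "\<forall>\<^sub>F x in at 0. dist (\<gamma> x) p0 < e / 2 \<and> x \<noteq> 0" by eventually_elim simp
  then obtain x where x: "dist (\<gamma> x) p0 < e / 2" "x \<noteq> 0"
    by (metis (mono_tags, lifting) at_neq_bot eventually_happens')
  define q0 where "q0 = \<gamma> x"
  have q0: "null_vec q0" "lor p0 q0 \<noteq> 0" "norm (q0 - p0) < e / 2"
    using sa x p1 by (auto simp: q0_def \<gamma>_def dist_norm)
  have e4: "e / 4 > 0" using e by simp
  obtain g c p q where g: "g \<in> \<Gamma>" "loxodromic g c p q" "norm (p - p0) \<le> e / 4" "norm (q - q0) \<le> e / 4"
    by (rule loxodromic_near_pair[OF all_cluster_pairs[OF p0 q0(1)] q0(2) e4]) blast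
  have pq: "null_vec p" "null_vec q" "lor p q \<noteq> 0" using g by (auto simp: loxodromic_def)
  have "norm (q - p0) < e" using norm_triangle_ineq[of "q - q0" "q0 - p0"] g(4) q0(3) e(1) by simp
  then obtain u' where u': "tangent q u'" using ex pq by blast
  have "norm (p - p0) < e" using g(3) e(1) by simp
  then obtain u where u: "tangent p u" using ex pq by blast
  have red: "\<exists>v k. v \<noteq> 0 \<and> lor p (re_vec v) = 0 \<and> lor q (re_vec v) = 0 \<and> lor p (im_vec v) = 0 \<and> lor q (im_vec v) = 0 \<and> u = v + k *s real_vec p"
    if pq: "null_vec p" "null_vec q" "lor p q \<noteq> 0" and u: "tangent p u" for p q u
  proof -
    define k where "k = Complex (lor q (re_vec u) / lor q p) (lor q (im_vec u) / lor q p)"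
    define v where "v = u - k *s real_vec p"
    have p: "lor p p = 0" "p \<noteq> 0" "lor q p \<noteq> 0" using pq by (auto simp: null_vec_def lor_commute)
    \<comment> \<open>Otherwise u would represent the boundary point p, which belongs to
      \<open>Kul_L1\<close>.\<close>
    have "v \<noteq> 0"
    proof
      assume "v = 0"
      then have "u = k *s real_vec p" by (simp add: v_def)
      moreover have "k \<noteq> 0" using u calculation by (auto simp: tangent_def)
      ultimately have "proj u = proj (real_vec p)" using p by simp
      also have "\<dots> \<in> bdHR" using p by (auto simp: bdHR_real_vec)
      finally show False using u bdHR_subset_L1 by (auto simp: tangent_def Kul_limit_set_def)
    qed
    then show ?thesis using u p by (intro exI[of _ v] exI[of _ k]) (simp add: v_def k_def tangent_def lor_simps)
  qed
  obtain v k where v: "v \<noteq> 0" "lor p (re_vec v) = 0" "lor q (re_vec v) = 0" "lor p (im_vec v) = 0" "lor q (im_vec v) = 0"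
    "u = v + k *s real_vec p" using red[OF pq u] by metis
  have qp: "lor q p \<noteq> 0" using pq by (simp add: lor_commute)
  obtain v' k' where v': "v' \<noteq> 0" "lor p (re_vec v') = 0" "lor q (re_vec v') = 0" "lor p (im_vec v') = 0" "lor q (im_vec v') = 0"
    "u' = v' + k' *s real_vec q" using red[OF pq(2,1) qp u'] by metis
  have "card {p, q} < CARD('m) + 1" using m card_insert_le_m1[of 2 "{q}" p] by simp
  then obtain n where n: "n \<noteq> 0" "lor p n = 0" "lor q n = 0"
    using exists_lor_orthogonal[of "{p, q}"] by auto
  have line: "\<exists>c. r = c *\<^sub>R n" if "lor p r = 0" "lor q r = 0" for r
  proof (rule lor_complement_line[OF m _ _ n(1)])
    show "p \<noteq> 0" using pq by (simp add: null_vec_def)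
    show "\<nexists>c. q = c *\<^sub>R p" using pq by (auto simp: null_vec_def lor_simps)
  qed (use n that in \<open>simp_all add: lor_commute\<close>)
  have cline: "\<exists>c. w = c *s real_vec n" if w: "lor p (re_vec w) = 0" "lor q (re_vec w) = 0" "lor p (im_vec w) = 0" "lor q (im_vec w) = 0" for w
  proof -
    obtain a where "re_vec w = a *\<^sub>R n" using line[OF w(1,2)] by blast
    moreover obtain b where "im_vec w = b *\<^sub>R n" using line[OF w(3,4)] by blast
    ultimately have "w = Complex a b *s real_vec n" by (simp add: complex_vec_eq_iff)
    then show ?thesis by blast
  qed
  obtain a where a: "v = a *s real_vec n" using cline v by blast
  obtain b where b: "v' = b *s real_vec n" using cline v' by blast
  have ab: "a \<noteq> 0" "b \<noteq> 0" using a b v(1) v'(1) by auto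
  \<comment> \<open>A rescaling of u' whose component in the complement is the same v as that of u,
    as the dichotomy requires.\<close>
  define w where "w = v + (k' * a / b) *s real_vec q"
  have w: "u' = (b / a) *s w"
    using ab by (simp add: v' a b w_def vector_smult_assoc vector_add_ldistrib)
  have "w \<noteq> 0" using u' w by (auto simp: tangent_def)
  then have "proj w = proj u'" unfolding w using ab by simp
  then have "proj (v + (k' * a / b) *s real_vec q) \<notin> Kul_limit_set (cmat ` \<Gamma>)"
    using u' by (simp add: tangent_def w_def)
  then have "proj u \<in> Kul_limit_set (cmat ` \<Gamma>)"
    unfolding v(6) by (rule loxodromic_dichotomy[OF g(1,2) v(1-5)])
  then show False using u by (simp add: tangent_def)
qed

theorem Kul_limit_set_eq: "Kul_limit_set (cmat ` \<Gamma>) = tangent_set"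
proof (rule equalityI[OF Kul_limit_set_eq_subset], rule subsetI)
  fix l :: "'m cproj" assume l: "l \<in> tangent_set"
  obtain z where z: "z \<noteq> 0" "l = proj z" by (rule proj_cases)
  then obtain p where p: "null_vec p" "lor p (re_vec z) = 0" "lor p (im_vec z) = 0"
    using l by (auto simp: proj_in_tangent_set null_vec_def)
  show "l \<in> Kul_limit_set (cmat ` \<Gamma>)"
  proof (cases "CARD('m) = 2")
    case True
    then show ?thesis unfolding z(2) using p z(1) by (intro hyperplane_in_limit_set_2)
  next
    case False
    then have "CARD('m) \<ge> 3" using card_ge_2 by linarith
    then show ?thesis unfolding z(2) using p z(1) by (intro hyperplane_in_limit_set_ge_3)
  qed
qed

end

section \<open>Calculus of smooth functions\<close>

lemma Ck_on_cong:
  assumes "open S" "\<And>x. x \<in> S \<Longrightarrow> f x = g x" "Ck_on k S f"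
  shows "Ck_on k S g"
  using assms(2,3)
proof (induction k arbitrary: f g)
  case 0
  then show ?case by (auto cong: continuous_on_cong)
next
  case (Suc k)
  have d: "(g has_derivative frechet_derivative f (at x)) (at x)" if "x \<in> S" for x
  proof (rule has_derivative_transform_within_open[OF _ assms(1) that])
    show "(f has_derivative frechet_derivative f (at x)) (at x)"
      using Suc.prems(2) that by (simp add: frechet_derivative_works[symmetric])
  qed (use Suc.prems(1) in auto)
  have "Ck_on k S (\<lambda>x. frechet_derivative g (at x) v)" for v
  proof (rule Suc.IH)
    show "frechet_derivative f (at x) v = frechet_derivative g (at x) v" if "x \<in> S" for x
      using frechet_derivative_at[OF d[OF that]] by simp
    show "Ck_on k S (\<lambda>x. frechet_derivative f (at x) v)" using Suc.prems(2) by simp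
  qed
  then show ?case using d by (auto simp: differentiable_def)
qed

text \<open>Replaces the chosen \<open>frechet_derivative\<close> by any derivative formula at hand;
  the inductions below rest on it.\<close>

lemma Ck_on_SucI:
  assumes "open S" "\<And>x. x \<in> S \<Longrightarrow> (f has_derivative f' x) (at x)" "\<And>v. Ck_on k S (\<lambda>x. f' x v)"
  shows "Ck_on (Suc k) S f"
proof -
  have "f' x = frechet_derivative f (at x)" if "x \<in> S" for x
    using frechet_derivative_at[OF assms(2)[OF that]] .
  then have "Ck_on k S (\<lambda>x. frechet_derivative f (at x) v)" for v
    by (intro Ck_on_cong[OF assms(1) _ assms(3)[of v]]) simp
  then show ?thesis using assms(2) by (auto simp: differentiable_def)
qed

lemma Ck_on_derivative:
  assumes "Ck_on (Suc k) S f" "x \<in> S"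
  shows "(f has_derivative frechet_derivative f (at x)) (at x)"
  using assms by (simp add: frechet_derivative_works[symmetric])

lemma Ck_on_subset: "Ck_on k S f \<Longrightarrow> T \<subseteq> S \<Longrightarrow> Ck_on k T f"
  by (induction k arbitrary: f) (auto intro: continuous_on_subset)

lemma Ck_on_imp_continuous_on: "Ck_on k S f \<Longrightarrow> continuous_on S f"
  by (cases k) (auto intro!: continuous_at_imp_continuous_on differentiable_imp_continuous_within)

lemma Ck_on_Suc_imp: "Ck_on (Suc k) S f \<Longrightarrow> Ck_on k S f"
proof (induction k arbitrary: f)
  case 0
  then show ?case using Ck_on_imp_continuous_on[of "Suc 0"] by simp
next
  case (Suc k)
  from Suc.prems have "\<forall>x\<in>S. f differentiable (at x)" "\<And>v. Ck_on (Suc k) S (\<lambda>x. frechet_derivative f (at x) v)"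
    by simp_all
  then show ?case using Suc.IH by simp
qed

lemma Ck_on_local:
  assumes "\<And>x. x \<in> S \<Longrightarrow> \<exists>U. x \<in> U \<and> open U \<and> Ck_on k U f"
  shows "Ck_on k S f"
  using assms
proof (induction k arbitrary: f)
  case 0
  show ?case
    unfolding Ck_on.simps
  proof (rule continuous_at_imp_continuous_on, rule ballI)
    fix x assume "x \<in> S"
    with 0 obtain U where "x \<in> U" "open U" "continuous_on U f" by auto
    then show "isCont f x" using continuous_on_eq_continuous_at by blast
  qed
next
  case (Suc k)
  have "f differentiable (at x)" if "x \<in> S" for x using Suc.prems[OF that] by auto
  moreover have "Ck_on k S (\<lambda>x. frechet_derivative f (at x) v)" for v
    by (rule Suc.IH) (use Suc.prems in fastforce)
  ultimately show ?case by simp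
qed

lemma Ck_on_const: "Ck_on k S (\<lambda>x. c)"
  by (induction k arbitrary: c) simp_all

lemma Ck_on_compose_linear:
  assumes "open S" "bounded_linear L" "Ck_on k S f"
  shows "Ck_on k S (\<lambda>x. L (f x))"
  using assms(3)
proof (induction k arbitrary: f)
  case 0
  then show ?case using bounded_linear.continuous_on[OF assms(2)] by simp
next
  case (Suc k)
  show ?case
  proof (rule Ck_on_SucI[OF assms(1)])
    show "((\<lambda>x. L (f x)) has_derivative (\<lambda>v. L (frechet_derivative f (at x) v))) (at x)" if "x \<in> S" for x
      using Ck_on_derivative[OF Suc.prems that] by (rule bounded_linear.has_derivative[OF assms(2)])
    show "Ck_on k S (\<lambda>x. L (frechet_derivative f (at x) v))" for v
      using Suc.prems by (intro Suc.IH) simp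
  qed
qed

lemma Ck_on_add:
  assumes "open S" "Ck_on k S f" "Ck_on k S g"
  shows "Ck_on k S (\<lambda>x. f x + g x)"
  using assms(2,3)
proof (induction k arbitrary: f g)
  case 0
  then show ?case by (auto intro: continuous_intros)
next
  case (Suc k)
  show ?case
  proof (rule Ck_on_SucI[OF assms(1)])
    show "((\<lambda>x. f x + g x) has_derivative (\<lambda>v. frechet_derivative f (at x) v + frechet_derivative g (at x) v)) (at x)" if "x \<in> S" for x
      using Ck_on_derivative[OF Suc.prems(1) that] Ck_on_derivative[OF Suc.prems(2) that] by (rule has_derivative_add)
    show "Ck_on k S (\<lambda>x. frechet_derivative f (at x) v + frechet_derivative g (at x) v)" for v
      using Suc.prems by (intro Suc.IH) simp_all
  qed
qed

lemma Ck_on_bilinear: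
  assumes "open S" "bounded_bilinear B" "Ck_on k S f" "Ck_on k S g"
  shows "Ck_on k S (\<lambda>x. B (f x) (g x))"
  using assms(3,4)
proof (induction k arbitrary: f g)
  case 0
  then show ?case using bounded_bilinear.continuous_on[OF assms(2)] by simp
next
  case (Suc k)
  show ?case
  proof (rule Ck_on_SucI[OF assms(1)])
    show "((\<lambda>x. B (f x) (g x)) has_derivative
      (\<lambda>v. B (f x) (frechet_derivative g (at x) v) + B (frechet_derivative f (at x) v) (g x))) (at x)" if "x \<in> S" for x
      using Ck_on_derivative[OF Suc.prems(1) that] Ck_on_derivative[OF Suc.prems(2) that]
      by (rule bounded_bilinear.FDERIV[OF assms(2)])
    show "Ck_on k S (\<lambda>x. B (f x) (frechet_derivative g (at x) v) + B (frechet_derivative f (at x) v) (g x))" for v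
      using Suc.prems Suc.prems[THEN Ck_on_Suc_imp] by (intro Ck_on_add assms(1) Suc.IH) simp_all
  qed
qed

lemma Ck_on_sum:
  assumes "open S" "finite I" "\<And>i. i \<in> I \<Longrightarrow> Ck_on k S (f i)"
  shows "Ck_on k S (\<lambda>x. \<Sum>i\<in>I. f i x)"
  using assms(2,3) by (induction I rule: finite_induct) (auto intro: Ck_on_const Ck_on_add assms(1))

text \<open>\<open>Ck_on\<close> controls derivatives in fixed directions, whereas the chain rule
  differentiates g in a direction depending on x. Expanding this direction in a basis gives a sum of
  products to which the induction hypothesis applies.\<close>

lemma Ck_on_compose:
  fixes f :: "'a::euclidean_space \<Rightarrow> 'b::euclidean_space" and g :: "'b \<Rightarrow> 'c::euclidean_space"
  assumes "open S" "open T" "f ` S \<subseteq> T" "Ck_on k S f" "Ck_on k T g"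
  shows "Ck_on k S (\<lambda>x. g (f x))"
  using assms(4,5)
proof (induction k arbitrary: g)
  case 0
  then show ?case using assms(3) by (auto intro: continuous_on_compose2)
next
  case (Suc k)
  let ?Df = "\<lambda>x. frechet_derivative f (at x)" and ?Dg = "\<lambda>y. frechet_derivative g (at y)"
  have lin: "?Dg (f x) w = (\<Sum>b\<in>Basis. (w \<bullet> b) *\<^sub>R ?Dg (f x) b)" if "x \<in> S" for x w
  proof -
    have "linear (?Dg (f x))"
      using Ck_on_derivative[OF Suc.prems(2), of "f x"] assms(3) that
      by (intro bounded_linear.linear has_derivative_bounded_linear[of g _ "at (f x)"]) auto
    then have "?Dg (f x) (\<Sum>b\<in>Basis. (w \<bullet> b) *\<^sub>R b) = (\<Sum>b\<in>Basis. (w \<bullet> b) *\<^sub>R ?Dg (f x) b)"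
      by (simp add: linear_sum linear_scale)
    then show ?thesis by (simp add: euclidean_representation)
  qed
  show ?case
  proof (rule Ck_on_SucI[OF assms(1)])
    show "((\<lambda>x. g (f x)) has_derivative (\<lambda>v. \<Sum>b\<in>Basis. (?Df x v \<bullet> b) *\<^sub>R ?Dg (f x) b)) (at x)" if "x \<in> S" for x
    proof -
      have "f x \<in> T" using assms(3) that by auto
      then have "((\<lambda>x. g (f x)) has_derivative (\<lambda>v. ?Dg (f x) (?Df x v))) (at x)"
        by (rule has_derivative_compose[OF Ck_on_derivative[OF Suc.prems(1) that] Ck_on_derivative[OF Suc.prems(2)]])
      moreover have "(\<lambda>v. ?Dg (f x) (?Df x v)) = (\<lambda>v. \<Sum>b\<in>Basis. (?Df x v \<bullet> b) *\<^sub>R ?Dg (f x) b)"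
        by (rule ext) (rule lin[OF that])
      ultimately show ?thesis by (simp only:)
    qed
    show "Ck_on k S (\<lambda>x. \<Sum>b\<in>Basis. (?Df x v \<bullet> b) *\<^sub>R ?Dg (f x) b)" for v
    proof (intro Ck_on_sum assms(1) Ck_on_bilinear[OF assms(1) bounded_bilinear_scaleR])
      fix b :: 'b assume "b \<in> Basis"
      show "Ck_on k S (\<lambda>x. ?Df x v \<bullet> b)"
        using Suc.prems(1) by (intro Ck_on_compose_linear[OF assms(1) bounded_linear_inner_left]) simp
      show "Ck_on k S (\<lambda>x. ?Dg (f x) b)"
        using Suc.prems(2) Suc.prems(1)[THEN Ck_on_Suc_imp] by (intro Suc.IH) simp_all
    qed simp
  qed
qed

lemma Ck_on_id: "open S \<Longrightarrow> Ck_on k S (\<lambda>x. x)"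
proof (induction k)
  case (Suc k)
  then show ?case by (intro Ck_on_SucI[of S "\<lambda>x. x" "\<lambda>x v. v"]) (auto intro: Ck_on_const)
qed simp

lemma Ck_on_inverse_real: "Ck_on k {x :: real. x \<noteq> 0} inverse"
proof (induction k)
  case 0
  then show ?case by (auto intro: continuous_intros)
next
  case (Suc k)
  have o: "open {x :: real. x \<noteq> 0}" by (simp add: open_Collect_neq)
  show ?case
  proof (rule Ck_on_SucI[OF o])
    show "(inverse has_derivative (\<lambda>v. - (inverse x * v * inverse x))) (at x)" if "x \<in> {x :: real. x \<noteq> 0}" for x
      using that by (auto intro!: derivative_eq_intros)
    show "Ck_on k {x. x \<noteq> 0} (\<lambda>x. - (inverse x * v * inverse x))" for v :: real
      by (intro Ck_on_compose_linear[OF o bounded_linear_minus[OF bounded_linear_ident]]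
          Ck_on_bilinear[OF o bounded_bilinear_mult] Suc Ck_on_const)
  qed
qed

lemma Ck_on_sqrt: "Ck_on k {x :: real. 0 < x} sqrt"
proof (induction k)
  case 0
  then show ?case by (auto intro: continuous_intros)
next
  case (Suc k)
  have o: "open {x :: real. 0 < x}" by (simp add: open_Collect_less)
  show ?case
  proof (rule Ck_on_SucI[OF o])
    show "(sqrt has_derivative (\<lambda>v. v * (inverse (sqrt x) / 2))) (at x)" if "x \<in> {x :: real. 0 < x}" for x
      using that by (auto intro!: derivative_eq_intros simp: field_simps)
    show "Ck_on k {x. 0 < x} (\<lambda>x. v * (inverse (sqrt x) / 2))" for v :: real
      by (intro Ck_on_bilinear[OF o bounded_bilinear_mult] Ck_on_const
          Ck_on_compose_linear[OF o bounded_linear_divide] Ck_on_compose[OF o _ _ Suc Ck_on_inverse_real])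
        (auto simp: open_Collect_neq)
  qed
qed

section \<open>Closure properties of smooth maps\<close>

named_theorems smooth_intros

lemma smooth_on_subset: "smooth_on S f \<Longrightarrow> T \<subseteq> S \<Longrightarrow> smooth_on T f"
  by (auto simp: smooth_on_def intro: Ck_on_subset)

lemma smooth_on_cong:
  assumes "open S" "\<And>x. x \<in> S \<Longrightarrow> f x = g x" "smooth_on S f"
  shows "smooth_on S g"
  using assms Ck_on_cong unfolding smooth_on_def by blast

lemma smooth_on_local:
  assumes "\<And>x. x \<in> S \<Longrightarrow> \<exists>U. x \<in> U \<and> open U \<and> smooth_on U f"
  shows "smooth_on S f"
  unfolding smooth_on_def
proof
  fix k show "Ck_on k S f" by (rule Ck_on_local) (use assms in \<open>unfold smooth_on_def, blast\<close>)
qed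

lemma smooth_on_imp_continuous_on: "smooth_on S f \<Longrightarrow> continuous_on S f"
  unfolding smooth_on_def using Ck_on_imp_continuous_on by blast

lemma smooth_on_const [smooth_intros]: "smooth_on S (\<lambda>x. c)"
  by (simp add: smooth_on_def Ck_on_const)

lemma smooth_on_id [smooth_intros]: "open S \<Longrightarrow> smooth_on S (\<lambda>x. x)"
  by (simp add: smooth_on_def Ck_on_id)

lemma smooth_on_linear:
  assumes "open S" "bounded_linear L" "smooth_on S f"
  shows "smooth_on S (\<lambda>x. L (f x))"
  using assms by (simp add: smooth_on_def Ck_on_compose_linear)

lemma smooth_on_bilinear:
  assumes "open S" "bounded_bilinear B" "smooth_on S f" "smooth_on S g"
  shows "smooth_on S (\<lambda>x. B (f x) (g x))"
  using assms by (simp add: smooth_on_def Ck_on_bilinear)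

lemma smooth_on_compose:
  assumes "open S" "open T" "\<And>x. x \<in> S \<Longrightarrow> f x \<in> T" "smooth_on S f" "smooth_on T g"
  shows "smooth_on S (\<lambda>x. g (f x))"
  unfolding smooth_on_def
proof
  fix k show "Ck_on k S (\<lambda>x. g (f x))"
    by (rule Ck_on_compose[OF assms(1,2)]) (use assms in \<open>auto simp: smooth_on_def\<close>)
qed

lemma smooth_on_add [smooth_intros]:
  "open S \<Longrightarrow> smooth_on S f \<Longrightarrow> smooth_on S g \<Longrightarrow> smooth_on S (\<lambda>x. f x + g x)"
  by (simp add: smooth_on_def Ck_on_add)

lemma smooth_on_minus [smooth_intros]:
  "open S \<Longrightarrow> smooth_on S f \<Longrightarrow> smooth_on S (\<lambda>x. - f x)"
  by (rule smooth_on_linear[OF _ bounded_linear_minus[OF bounded_linear_ident]])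

lemma smooth_on_diff [smooth_intros]:
  "open S \<Longrightarrow> smooth_on S f \<Longrightarrow> smooth_on S g \<Longrightarrow> smooth_on S (\<lambda>x. f x - g x)"
  using smooth_on_add[OF _ _ smooth_on_minus, of S f g] by simp

lemma smooth_on_sum [smooth_intros]:
  "open S \<Longrightarrow> finite I \<Longrightarrow> (\<And>i. i \<in> I \<Longrightarrow> smooth_on S (f i)) \<Longrightarrow> smooth_on S (\<lambda>x. \<Sum>i\<in>I. f i x)"
  by (simp add: smooth_on_def Ck_on_sum)

lemma smooth_on_mult [smooth_intros]:
  fixes f g :: "_ \<Rightarrow> 'a::{euclidean_space, real_normed_algebra}"
  shows "open S \<Longrightarrow> smooth_on S f \<Longrightarrow> smooth_on S g \<Longrightarrow> smooth_on S (\<lambda>x. f x * g x)"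
  by (rule smooth_on_bilinear[OF _ bounded_bilinear_mult])

lemma smooth_on_scaleR [smooth_intros]:
  "open S \<Longrightarrow> smooth_on S f \<Longrightarrow> smooth_on S g \<Longrightarrow> smooth_on S (\<lambda>x. f x *\<^sub>R g x)"
  by (rule smooth_on_bilinear[OF _ bounded_bilinear_scaleR])

lemma smooth_on_power [smooth_intros]:
  fixes f :: "_ \<Rightarrow> 'a::{euclidean_space, real_normed_algebra_1}"
  shows "open S \<Longrightarrow> smooth_on S f \<Longrightarrow> smooth_on S (\<lambda>x. f x ^ n)"
  by (induction n) (auto intro!: smooth_intros)

lemma smooth_on_Re [smooth_intros]: "open S \<Longrightarrow> smooth_on S f \<Longrightarrow> smooth_on S (\<lambda>x. Re (f x))"
  by (rule smooth_on_linear[OF _ bounded_linear_Re])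

lemma smooth_on_Im [smooth_intros]: "open S \<Longrightarrow> smooth_on S f \<Longrightarrow> smooth_on S (\<lambda>x. Im (f x))"
  by (rule smooth_on_linear[OF _ bounded_linear_Im])

lemma smooth_on_cnj [smooth_intros]: "open S \<Longrightarrow> smooth_on S f \<Longrightarrow> smooth_on S (\<lambda>x. cnj (f x))"
  by (rule smooth_on_linear[OF _ bounded_linear_cnj])

lemma smooth_on_of_real [smooth_intros]:
  "open S \<Longrightarrow> smooth_on S f \<Longrightarrow> smooth_on S (\<lambda>x. complex_of_real (f x))"
  by (rule smooth_on_linear[OF _ bounded_linear_of_real])

lemma smooth_on_Complex [smooth_intros]:
  assumes "open S" "smooth_on S f" "smooth_on S g"
  shows "smooth_on S (\<lambda>x. Complex (f x) (g x))"
  using assms unfolding Complex_eq by (intro smooth_intros)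

lemma smooth_on_fst [smooth_intros]: "open S \<Longrightarrow> smooth_on S f \<Longrightarrow> smooth_on S (\<lambda>x. fst (f x))"
  by (rule smooth_on_linear[OF _ bounded_linear_fst])

lemma smooth_on_snd [smooth_intros]: "open S \<Longrightarrow> smooth_on S f \<Longrightarrow> smooth_on S (\<lambda>x. snd (f x))"
  by (rule smooth_on_linear[OF _ bounded_linear_snd])

lemma smooth_on_Pair [smooth_intros]:
  assumes "open S" "smooth_on S f" "smooth_on S g"
  shows "smooth_on S (\<lambda>x. (f x, g x))"
proof -
  have "smooth_on S (\<lambda>x. (f x, 0) + (0, g x))"
    using smooth_on_linear[OF assms(1) bounded_linear_Pair[OF bounded_linear_ident bounded_linear_zero] assms(2)]
      smooth_on_linear[OF assms(1) bounded_linear_Pair[OF bounded_linear_zero bounded_linear_ident] assms(3)]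
    by (intro smooth_on_add assms(1))
  then show ?thesis by simp
qed

lemma smooth_on_vec_nth [smooth_intros]:
  "open S \<Longrightarrow> smooth_on S f \<Longrightarrow> smooth_on S (\<lambda>x. f x $ i)"
  by (rule smooth_on_linear[OF _ bounded_linear_vec_nth])

lemma smooth_on_vec_lambda [smooth_intros]:
  fixes f :: "'a::euclidean_space \<Rightarrow> 'n::finite \<Rightarrow> 'b::euclidean_space"
  assumes "open S" "\<And>i. smooth_on S (\<lambda>x. f x i)"
  shows "smooth_on S (\<lambda>x. \<chi> i. f x i)"
proof -
  have lin: "bounded_linear (\<lambda>y :: 'b. axis i y :: 'b ^ 'n)" for i
    unfolding linear_conv_bounded_linear[symmetric] by (rule linearI) (auto simp: axis_def vec_eq_iff)
  have "smooth_on S (\<lambda>x. \<Sum>i\<in>UNIV. axis i (f x i))"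
    using assms by (intro smooth_intros smooth_on_linear[OF _ lin]) auto
  moreover have "(\<Sum>i\<in>UNIV. axis i (f x i)) = (\<chi> i. f x i)" for x
    by (simp add: vec_eq_iff axis_def if_distrib cong: if_cong)
  ultimately show ?thesis by simp
qed

lemma smooth_on_inverse_real [smooth_intros]:
  fixes f :: "'a::euclidean_space \<Rightarrow> real"
  assumes "open S" "smooth_on S f" "\<And>x. x \<in> S \<Longrightarrow> f x \<noteq> 0"
  shows "smooth_on S (\<lambda>x. inverse (f x))"
  by (rule smooth_on_compose[OF assms(1), of "{x. x \<noteq> 0}"])
    (use assms in \<open>auto simp: open_Collect_neq smooth_on_def Ck_on_inverse_real\<close>)

lemma smooth_on_sqrt [smooth_intros]:
  assumes "open S" "smooth_on S f" "\<And>x. x \<in> S \<Longrightarrow> f x > 0"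
  shows "smooth_on S (\<lambda>x. sqrt (f x))"
  by (rule smooth_on_compose[OF assms(1), of "{x. 0 < x}"])
    (use assms in \<open>auto simp: open_Collect_less smooth_on_def Ck_on_sqrt\<close>)

lemma smooth_on_divide_real [smooth_intros]:
  fixes f g :: "'a::euclidean_space \<Rightarrow> real"
  assumes "open S" "smooth_on S f" "smooth_on S g" "\<And>x. x \<in> S \<Longrightarrow> g x \<noteq> 0"
  shows "smooth_on S (\<lambda>x. f x / g x)"
  unfolding divide_inverse using assms by (intro smooth_intros)

text \<open>Written with the conjugate over the squared modulus, the quotient involves a real
  inverse only.\<close>

lemma smooth_on_divide_complex [smooth_intros]:
  fixes f g :: "'a::euclidean_space \<Rightarrow> complex"
  assumes "open S" "smooth_on S f" "smooth_on S g" "\<And>x. x \<in> S \<Longrightarrow> g x \<noteq> 0"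
  shows "smooth_on S (\<lambda>x. f x / g x)"
proof -
  have "f x / g x = f x * (inverse ((Re (g x))\<^sup>2 + (Im (g x))\<^sup>2) *\<^sub>R cnj (g x))" for x
  proof -
    have "f x / g x = (f x * cnj (g x)) /\<^sub>R (cmod (g x))\<^sup>2"
      by (subst complex_div_cnj) (simp add: scaleR_conv_of_real divide_inverse mult.commute)
    then show ?thesis by (simp add: cmod_power2)
  qed
  moreover have "(Re (g x))\<^sup>2 + (Im (g x))\<^sup>2 \<noteq> 0" if "x \<in> S" for x
    using assms(4)[OF that] by (simp add: complex_eq_iff sum_power2_eq_zero_iff)
  ultimately show ?thesis using assms(1-3) by (simp only:) (rule smooth_intros | assumption)+
qed

lemma smooth_on_cmod [smooth_intros]:
  assumes "open S" "smooth_on S f" "\<And>x. x \<in> S \<Longrightarrow> f x \<noteq> 0"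
  shows "smooth_on S (\<lambda>x. cmod (f x))"
  unfolding cmod_def using assms
  by (intro smooth_intros) (auto simp: complex_eq_iff sum_power2_gt_zero_iff)

section \<open>The complement of the tangent hyperplanes\<close>

text \<open>The real number \<open>herm z z\<close>.\<close>

definition hnorm :: "complex ^ ('m::finite option) \<Rightarrow> real" where
  "hnorm z = lor (re_vec z) (re_vec z) + lor (im_vec z) (im_vec z)"

lemma hnorm_scale: "hnorm (c *s z) = (cmod c)\<^sup>2 * hnorm z"
  unfolding cmod_power2
  by (simp add: hnorm_def lor_simps lor_commute[of "im_vec z" "re_vec z"] power2_eq_square algebra_simps)

lemma cmod_qform_scale: "cmod (qform (c *s z)) = (cmod c)\<^sup>2 * cmod (qform z)"
  by (simp add: qform_scale norm_mult norm_power)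

text \<open>The right side is four times the Gram determinant of the real and imaginary parts; so
  the comparison of h and |q| carries information on the plane they span.\<close>

lemma hnorm_qform_gram:
  "(hnorm z)\<^sup>2 - (cmod (qform z))\<^sup>2 =
     4 * (lor (re_vec z) (re_vec z) * lor (im_vec z) (im_vec z) - (lor (re_vec z) (im_vec z))\<^sup>2)"
  unfolding cmod_power2 by (simp add: hnorm_def qform_def power2_eq_square algebra_simps)

lemma gram_pos:
  assumes "cmod (qform z) < hnorm z"
  shows "lor (re_vec z) (re_vec z) * lor (im_vec z) (im_vec z) - (lor (re_vec z) (im_vec z))\<^sup>2 > 0"
proof -
  have "(cmod (qform z))\<^sup>2 < (hnorm z)\<^sup>2" using assms by (intro power_strict_mono) auto
  then have "0 < (hnorm z)\<^sup>2 - (cmod (qform z))\<^sup>2" by simp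
  then show ?thesis unfolding hnorm_qform_gram by simp
qed

text \<open>The weights make the two contributions \<open>lor s s * lor t t\<close> and its
  negative.\<close>

lemma null_combination:
  assumes "lor t t < 0" "lor s s > 0" "lor t s = 0"
  shows "null_vec (sqrt (lor s s) *\<^sub>R t + sqrt (- lor t t) *\<^sub>R s)"
proof -
  let ?p = "sqrt (lor s s) *\<^sub>R t + sqrt (- lor t t) *\<^sub>R s"
  have "lor t ?p = sqrt (lor s s) * lor t t" using assms by (simp add: lor_simps)
  then have "lor t ?p \<noteq> 0" using assms by simp
  then have "?p \<noteq> 0" by auto
  moreover have "lor ?p ?p = 0"
  proof -
    have "lor ?p ?p = sqrt (lor s s) * (sqrt (lor s s) * lor t t) + sqrt (- lor t t) * (sqrt (- lor t t) * lor s s)"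
      using assms(3) by (simp add: lor_simps lor_commute[of s t])
    also have "\<dots> = (sqrt (lor s s) * sqrt (lor s s)) * lor t t + (sqrt (- lor t t) * sqrt (- lor t t)) * lor s s"
      by (simp only: mult.assoc)
    also have "\<dots> = 0" using assms by simp
    finally show ?thesis .
  qed
  ultimately show ?thesis by (simp add: null_vec_def)
qed

text \<open>If y is null and nonzero, or y = 0 and x is null, that vector works. Otherwise a
  timelike and a spacelike vector orthogonal to x and y combine to a null one; there is room for
  both from m = 2 on if y = 0, and from m = 3 on if x and y span a spacelike plane.\<close>

lemma exists_null_orthogonal:
  fixes x y :: "real ^ ('m::finite option)"
  assumes "CARD('m) \<ge> 2" "x \<noteq> 0 \<or> y \<noteq> 0" "lor x y = 0" "lor x x \<ge> 0" "lor y y \<ge> 0"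
    "lor y y = 0 \<or> (CARD('m) \<ge> 3 \<and> lor x x > 0)"
  obtains p where "null_vec p" "lor p x = 0" "lor p y = 0"
proof (cases "lor y y = 0")
  case True
  show ?thesis
  proof (cases "y = 0 \<and> lor x x > 0")
    case True
    define t where "t = tvec - (lor tvec x / lor x x) *\<^sub>R x"
    have tx: "lor t x = 0" using True by (simp add: t_def lor_simps del: lor_tvec)
    have "lor t t = lor t tvec" using tx by (subst (2) t_def) (simp add: lor_simps del: lor_tvec)
    also have "\<dots> = - 1 - (lor tvec x)\<^sup>2 / lor x x"
      by (simp add: t_def lor_simps lor_commute[of x tvec] power2_eq_square)
    also have "\<dots> < 0" using True by (smt (verit) divide_nonneg_pos zero_le_power2)
    finally have tt: "lor t t < 0" .
    have "card {x, t} < CARD('m) + 1" using assms(1) card_insert_le_m1[of 2 "{t}" x] by simp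
    then obtain s where s: "s \<noteq> 0" "lor x s = 0" "lor t s = 0"
      using exists_lor_orthogonal[of "{x, t}"] by auto
    have "lor s s > 0" using timelike_orthogonal_pos[OF tt s(3,1)] .
    from null_combination[OF tt this s(3)] show ?thesis
      using that True tx s by (simp add: lor_simps lor_commute[of s x])
  next
    case F: False
    show ?thesis
    proof (cases "y = 0")
      case True
      then have "lor x x = 0" using F assms(4) by simp
      then show ?thesis using that[of x] assms True by (simp add: null_vec_def)
    next
      case False
      then show ?thesis using that[of y] assms True by (simp add: null_vec_def lor_commute)
    qed
  qed
next
  case False
  then have m: "CARD('m) \<ge> 3" and xx: "lor x x > 0" and yy: "lor y y > 0" using assms by auto
  obtain t where t: "lor t t < 0" "lor t x = 0" "lor t y = 0"
    by (rule timelike_complement[OF xx yy assms(3)])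
  have "card {x, y, t} \<le> 3" by (simp add: card_insert_if)
  then have "card {x, y, t} < CARD('m) + 1" using m by simp
  then obtain s where s: "s \<noteq> 0" "lor x s = 0" "lor y s = 0" "lor t s = 0"
    using exists_lor_orthogonal[of "{x, y, t}"] by auto
  have "lor s s > 0" using timelike_orthogonal_pos[OF t(1) s(4,1)] .
  from null_combination[OF t(1) this s(4)] show ?thesis
    using that t s by (simp add: lor_simps lor_commute[of s x] lor_commute[of s y])
qed

lemma proj_in_tangent_set_null:
  "z \<noteq> 0 \<Longrightarrow> proj z \<in> tangent_set \<longleftrightarrow> (\<exists>p. null_vec p \<and> lor p (re_vec z) = 0 \<and> lor p (im_vec z) = 0)"
  by (auto simp: proj_in_tangent_set null_vec_def)

text \<open>For orthogonal parts h and |q| are, up to the factor |c|^2, the sum and the difference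
  of \<open>lor x x\<close> and \<open>lor y y\<close>, so comparing them gives the sign of
  \<open>lor y y\<close>.\<close>

lemma rotated_representative:
  assumes "z \<noteq> 0"
  obtains c x y where "c \<noteq> 0" "c *s z = cplx x y" "x \<noteq> 0 \<or> y \<noteq> 0" "lor x y = 0" "lor y y \<le> lor x x"
    "hnorm z < cmod (qform z) \<longleftrightarrow> lor y y < 0" "hnorm z > cmod (qform z) \<longleftrightarrow> lor y y > 0"
proof -
  obtain c where c: "c \<noteq> 0" "lor (re_vec (c *s z)) (im_vec (c *s z)) = 0"
    "lor (im_vec (c *s z)) (im_vec (c *s z)) \<le> lor (re_vec (c *s z)) (re_vec (c *s z))"
    by (rule phase_rotation)
  define x where "x = re_vec (c *s z)"
  define y where "y = im_vec (c *s z)"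
  have z: "c *s z = cplx x y" by (simp only: x_def y_def cplx_re_im)
  have xy: "lor x y = 0" "lor y y \<le> lor x x" using c by (simp_all only: x_def y_def)
  have "c *s z \<noteq> 0" using c(1) assms by simp
  then have nz: "x \<noteq> 0 \<or> y \<noteq> 0" by (auto simp: z)
  have h: "(cmod c)\<^sup>2 * hnorm z = lor x x + lor y y"
    using hnorm_scale[of c z] by (simp add: z hnorm_def)
  have qc: "qform (cplx x y) = of_real (lor x x - lor y y)"
    using xy by (simp add: qform_def complex_eq_iff)
  then have q: "(cmod c)\<^sup>2 * cmod (qform z) = lor x x - lor y y"
    using cmod_qform_scale[of c z] xy by (simp add: z del: of_real_diff)
  have pos: "(cmod c)\<^sup>2 > 0" using c(1) by simp
  have "hnorm z < cmod (qform z) \<longleftrightarrow> (cmod c)\<^sup>2 * hnorm z < (cmod c)\<^sup>2 * cmod (qform z)" using pos by simp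
  then have lt: "hnorm z < cmod (qform z) \<longleftrightarrow> lor y y < 0" unfolding h q by linarith
  have "hnorm z > cmod (qform z) \<longleftrightarrow> (cmod c)\<^sup>2 * hnorm z > (cmod c)\<^sup>2 * cmod (qform z)" using pos by simp
  then have gt: "hnorm z > cmod (qform z) \<longleftrightarrow> lor y y > 0" unfolding h q by linarith
  show ?thesis using that[OF c(1) z nz xy lt gt] .
qed

text \<open>Decided by the type of y in a rotated representative: if y is timelike there is no
  orthogonal null vector, if y is null there always is one, and if y is spacelike there is one
  exactly for m >= 3.\<close>

lemma notin_tangent_set_iff:
  fixes z :: "complex ^ ('m::finite option)"
  assumes "CARD('m) \<ge> 2" "z \<noteq> 0"
  shows "proj z \<notin> tangent_set \<longleftrightarrow>
    hnorm z < cmod (qform z) \<or> (CARD('m) = 2 \<and> cmod (qform z) < hnorm z)"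
proof -
  obtain c x y where c: "c \<noteq> 0" "c *s z = cplx x y" "x \<noteq> 0 \<or> y \<noteq> 0" "lor x y = 0" "lor y y \<le> lor x x"
    "hnorm z < cmod (qform z) \<longleftrightarrow> lor y y < 0" "hnorm z > cmod (qform z) \<longleftrightarrow> lor y y > 0"
    by (rule rotated_representative[OF assms(2)]) blast
  have "proj z = proj (cplx x y)" using c(1) assms(2) by (metis c(2) proj_scale)
  then have tan: "proj z \<in> tangent_set \<longleftrightarrow> (\<exists>p. null_vec p \<and> lor p x = 0 \<and> lor p y = 0)"
    using c(3) by (simp add: proj_in_tangent_set_null)
  consider "lor y y < 0" | "lor y y = 0" | "lor y y > 0" by linarith
  then show ?thesis
  proof cases
    case 1
    then show ?thesis using tan c(6) null_timelike by blast
  next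
    case 2
    have xx: "lor x x \<ge> 0" using 2 c(5) by simp
    obtain p where "null_vec p" "lor p x = 0" "lor p y = 0"
      by (rule exists_null_orthogonal[OF assms(1) c(3,4) xx]) (use 2 in auto)
    then show ?thesis using tan c 2 by auto
  next
    case 3
    then have xx: "lor x x > 0" using c(5) by simp
    show ?thesis
    proof (cases "CARD('m) = 2")
      case True
      have "\<not> (null_vec p \<and> lor p x = 0 \<and> lor p y = 0)" for p
      proof
        assume p: "null_vec p \<and> lor p x = 0 \<and> lor p y = 0"
        obtain t where t: "lor t t < 0" "lor t x = 0" "lor t y = 0"
          by (rule timelike_complement[OF xx 3 c(4)])
        have "\<exists>k. p = k *\<^sub>R t"
        proof (rule lor_complement_line[OF True _ _ _ t(2,3)])
          show "x \<noteq> 0" using xx by auto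
          show "\<nexists>k. y = k *\<^sub>R x" using c(4) xx 3 by (auto simp: lor_simps)
          show "t \<noteq> 0" using t by auto
        qed (use p in auto)
        then show False using p t by (auto simp: null_vec_def lor_simps)
      qed
      then show ?thesis using tan True c 3 by auto
    next
      case False
      then have m: "CARD('m) \<ge> 3" using assms(1) by linarith
      obtain p where "null_vec p" "lor p x = 0" "lor p y = 0"
        by (rule exists_null_orthogonal[OF assms(1) c(3,4)]) (use m xx 3 in auto)
      then show ?thesis using tan c 3 False by auto
    qed
  qed
qed

section \<open>The projection onto hyperbolic space\<close>

definition conj_vec :: "complex ^ 'n \<Rightarrow> complex ^ 'n" where
  "conj_vec z = (\<chi> i. cnj (z $ i))"

lemma conj_vec_nth [simp]: "conj_vec z $ i = cnj (z $ i)"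
  by (simp add: conj_vec_def)

text \<open>If z is rotated to x + i y with x, y orthogonal and y timelike, this is a multiple of y.\<close>

definition axis_vec :: "complex ^ ('m::finite option) \<Rightarrow> complex ^ ('m option)" where
  "axis_vec z = of_real (cmod (qform z)) *s z - qform z *s conj_vec z"

lemma axis_vec_scale: "axis_vec (c *s z) = (of_real ((cmod c)\<^sup>2) * c) *s axis_vec z"
proof -
  define N where "N = complex_of_real ((cmod c)\<^sup>2)"
  have m: "of_real (cmod (qform (c *s z))) = N * of_real (cmod (qform z))"
    by (simp add: N_def cmod_qform_scale)
  have N: "N = c * cnj c" unfolding N_def by (rule complex_norm_square)
  have "axis_vec (c *s z) = (N * c) *s axis_vec z"
    unfolding axis_vec_def m unfolding qform_scale
    by (simp add: N vec_eq_iff power2_eq_square algebra_simps)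
  then show ?thesis by (simp only: N_def)
qed

text \<open>Y spans the timelike line to which z is projected. Kept as a relation on unnormalised Y,
  it is visibly compatible with scaling and with Lorentz matrices, unlike the coordinate formula
  \<open>klein\<close>.\<close>

definition axis_of :: "complex ^ ('m::finite option) \<Rightarrow> real ^ ('m option) \<Rightarrow> bool" where
  "axis_of z Y \<longleftrightarrow> lor Y Y < 0 \<and>
     (if hnorm z < cmod (qform z) then \<exists>d. d \<noteq> 0 \<and> axis_vec z = d *s real_vec Y
      else CARD('m) = 2 \<and> cmod (qform z) < hnorm z \<and> lor Y (re_vec z) = 0 \<and> lor Y (im_vec z) = 0)"

lemma axis_of_scale:
  assumes "c \<noteq> 0" "axis_of z Y"
  shows "axis_of (c *s z) Y"
proof (cases "hnorm z < cmod (qform z)")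
  case True
  then obtain d where "d \<noteq> 0" "axis_vec z = d *s real_vec Y" using assms(2) by (auto simp: axis_of_def)
  then have "axis_vec (c *s z) = (of_real ((cmod c)\<^sup>2) * c * d) *s real_vec Y"
    by (simp add: axis_vec_scale vector_smult_assoc)
  moreover have "of_real ((cmod c)\<^sup>2) * c * d \<noteq> 0" using \<open>d \<noteq> 0\<close> assms(1) by simp
  moreover have "hnorm (c *s z) < cmod (qform (c *s z))"
    using True assms(1) by (simp add: hnorm_scale cmod_qform_scale)
  ultimately have "\<exists>d. d \<noteq> 0 \<and> axis_vec (c *s z) = d *s real_vec Y" "hnorm (c *s z) < cmod (qform (c *s z))"
    by blast+
  then show ?thesis using assms(2) unfolding axis_of_def by (simp only: if_True)
next
  case False
  then show ?thesis using assms
    unfolding axis_of_def hnorm_scale cmod_qform_scale by (simp add: lor_simps)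
qed

lemma axis_of_scaleR:
  assumes "r \<noteq> 0" "axis_of z Y"
  shows "axis_of z (r *\<^sub>R Y)"
proof -
  have "lor (r *\<^sub>R Y) (r *\<^sub>R Y) = r\<^sup>2 * lor Y Y" by (simp add: lor_simps power2_eq_square)
  then have "lor (r *\<^sub>R Y) (r *\<^sub>R Y) < 0" using assms by (simp add: axis_of_def mult_pos_neg)
  moreover have "d *s real_vec Y = (d / of_real r) *s real_vec (r *\<^sub>R Y)" for d
    using assms(1) by (simp add: vec_eq_iff complex_eq_iff)
  then have "\<exists>d. d \<noteq> 0 \<and> axis_vec z = d *s real_vec (r *\<^sub>R Y)" if ex: "\<exists>d. d \<noteq> 0 \<and> axis_vec z = d *s real_vec Y"
  proof -
    obtain d where "d \<noteq> 0" "axis_vec z = d *s real_vec Y" using ex by blast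
    moreover have "d / of_real r \<noteq> 0" using \<open>d \<noteq> 0\<close> assms(1) by simp
    ultimately show ?thesis using \<open>\<And>d. d *s real_vec Y = _\<close> by metis
  qed
  ultimately show ?thesis using assms(2)
    unfolding axis_of_def by (simp add: lor_simps split: if_splits)
qed

lemma axis_of_rotated:
  assumes "lor x y = 0" "lor y y < 0"
  shows "axis_of (cplx x y) y" "hnorm (cplx x y) < cmod (qform (cplx x y))"
proof -
  have xx: "lor x x \<ge> 0" using timelike_orthogonal_pos[OF assms(2), of x] assms(1) by (cases "x = 0") (simp_all add: lor_commute)
  define r where "r = lor x x - lor y y"
  have r: "r > 0" using xx assms(2) by (simp add: r_def)
  have q: "qform (cplx x y) = of_real r" using assms(1) by (simp add: qform_def r_def complex_eq_iff)
  show lt: "hnorm (cplx x y) < cmod (qform (cplx x y))" unfolding q norm_of_real using assms(2) r by (simp add: hnorm_def r_def)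
  have "axis_vec (cplx x y) = (2 * \<i> * of_real r) *s real_vec y"
    using r by (simp add: axis_vec_def q vec_eq_iff complex_eq_iff)
  moreover have "2 * \<i> * of_real r \<noteq> 0" using r by simp
  ultimately have "\<exists>d. d \<noteq> 0 \<and> axis_vec (cplx x y) = d *s real_vec y" by blast
  then show "axis_of (cplx x y) y" unfolding axis_of_def using lt assms(2) by (simp only: if_True)
qed

text \<open>In the first case both vectors span the line of \<open>axis_vec z\<close>; in the second
  both are orthogonal to two vectors of R^3 that are independent because their Gram determinant is
  positive.\<close>

lemma axis_of_unique:
  assumes "z \<noteq> 0" "axis_of z Y" "axis_of z Y'"
  obtains r where "r \<noteq> 0" "Y' = r *\<^sub>R Y"
proof -
  have nz: "Y \<noteq> 0" "Y' \<noteq> 0" using assms by (auto simp: axis_of_def)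
  have "\<exists>r. Y' = r *\<^sub>R Y"
  proof (cases "hnorm z < cmod (qform z)")
    case True
    then obtain d d' where d: "d \<noteq> 0" "d' \<noteq> 0" "axis_vec z = d *s real_vec Y" "axis_vec z = d' *s real_vec Y'"
      using assms by (auto simp: axis_of_def)
    then have "inverse d' *s (d' *s real_vec Y') = inverse d' *s (d *s real_vec Y)" by simp
    then have "real_vec Y' = (inverse d' * d) *s real_vec Y" using d(2) by (simp add: vector_smult_assoc)
    then have "re_vec (real_vec Y') = re_vec ((inverse d' * d) *s real_vec Y)" by (rule arg_cong)
    then have "Y' = Re (inverse d' * d) *\<^sub>R Y" by simp
    then show ?thesis by blast
  next
    case False
    then have a: "CARD('a) = 2" "cmod (qform z) < hnorm z" "lor Y (re_vec z) = 0" "lor Y (im_vec z) = 0"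
      "lor Y' (re_vec z) = 0" "lor Y' (im_vec z) = 0" using assms by (auto simp: axis_of_def)
    note gram = gram_pos[OF a(2)]
    show ?thesis
    proof (rule lor_complement_line[OF a(1) _ _ nz(1) a(3,4,5,6)])
      show "re_vec z \<noteq> 0" using gram by auto
      show "\<nexists>c. im_vec z = c *\<^sub>R re_vec z" using gram by (auto simp: lor_simps power2_eq_square)
    qed
  qed
  then show ?thesis using that nz by auto
qed

lemma qform_lorentz: "lorentz A \<Longrightarrow> qform (cmat A *v z) = qform z"
  by (simp add: qform_def lorentz_lor)

lemma hnorm_lorentz: "lorentz A \<Longrightarrow> hnorm (cmat A *v z) = hnorm z"
  by (simp add: hnorm_def lorentz_lor)

lemma conj_vec_cmat: "conj_vec (cmat A *v z) = cmat A *v conj_vec z"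
  by (simp add: vec_eq_iff matrix_vector_mult_def cmat_def)

lemma cmat_smult: "cmat A *v (c *s z) = c *s (cmat A *v z)"
  by (simp add: vector_scalar_commute)

lemma axis_vec_lorentz: "lorentz A \<Longrightarrow> axis_vec (cmat A *v z) = cmat A *v axis_vec z"
  by (simp add: axis_vec_def qform_lorentz conj_vec_cmat matrix_vector_mult_diff_distrib cmat_smult)

lemma axis_of_lorentz:
  assumes "lorentz A" "axis_of z Y"
  shows "axis_of (cmat A *v z) (A *v Y)"
proof -
  have "cmat A *v (d *s real_vec Y) = d *s real_vec (A *v Y)" for d
    by (simp only: cmat_smult) (simp add: cmat_mult_vec)
  then have "\<exists>d. d \<noteq> 0 \<and> axis_vec (cmat A *v z) = d *s real_vec (A *v Y)"
    if "\<exists>d. d \<noteq> 0 \<and> axis_vec z = d *s real_vec Y"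
    using that axis_vec_lorentz[OF assms(1), of z] by metis
  then show ?thesis using assms
    by (simp add: axis_of_def qform_lorentz hnorm_lorentz lorentz_lor split: if_splits)
qed

section \<open>Klein ball coordinates of the projection\<close>

definition homog :: "real ^ 'm \<Rightarrow> real ^ ('m::finite option)" where
  "homog k = (\<chi> i. case i of None \<Rightarrow> 1 | Some j \<Rightarrow> k $ j)"

lemma homog_nth [simp]: "homog k $ None = 1" "homog k $ Some j = k $ j"
  by (simp_all add: homog_def)

lemma homog_nonzero [simp]: "homog k \<noteq> 0"
  by (metis homog_nth(1) zero_index zero_neq_one)

lemma homog_zero: "homog 0 = tvec"
  by (simp add: vec_eq_iff tvec_def axis_def) (metis homog_nth option.exhaust zero_index)

lemma space_part_homog [simp]: "space_part (homog k) = k"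
  by (simp add: vec_eq_iff)

lemma lor_homog: "lor (homog k) (homog k) = (norm k)\<^sup>2 - 1"
  by (simp add: lor_self)

lemma homog_eq_scale: "homog k = r *\<^sub>R homog l \<Longrightarrow> k = l"
proof -
  assume eq: "homog k = r *\<^sub>R homog l"
  have "homog k $ None = (r *\<^sub>R homog l) $ None" by (simp only: eq)
  then have "r = 1" by simp
  then have "space_part (homog k) = space_part (homog l)" using eq by simp
  then show "k = l" by simp
qed

lemma timelike_homog:
  assumes "lor Y Y < 0"
  shows "Y $ None \<noteq> 0" "Y = Y $ None *\<^sub>R homog (inverse (Y $ None) *\<^sub>R space_part Y)"
    "norm (inverse (Y $ None) *\<^sub>R space_part Y) < 1"
proof -
  show n: "Y $ None \<noteq> 0" using assms by (auto simp: lor_self)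
  show "Y = Y $ None *\<^sub>R homog (inverse (Y $ None) *\<^sub>R space_part Y)"
    unfolding vec_eq_iff
  proof
    fix i show "Y $ i = (Y $ None *\<^sub>R homog (inverse (Y $ None) *\<^sub>R space_part Y)) $ i"
      using n by (cases i) auto
  qed
  have "(norm (space_part Y))\<^sup>2 < \<bar>Y $ None\<bar>\<^sup>2" using assms by (simp add: lor_self)
  then have "norm (space_part Y) < \<bar>Y $ None\<bar>" by (rule power_less_imp_less_base) simp
  then show "norm (inverse (Y $ None) *\<^sub>R space_part Y) < 1" using n by (simp add: field_simps)
qed

text \<open>Meaningful only for m = 2, where they enumerate the positive indices.\<close>

definition idx1 :: "'m::finite" where "idx1 = (SOME a. True)"
definition idx2 :: "'m::finite" where "idx2 = (SOME b. b \<noteq> idx1)"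

lemma UNIV_idx:
  assumes "CARD('m::finite) = 2"
  shows "(UNIV :: 'm set) = {idx1, idx2}" "idx1 \<noteq> (idx2 :: 'm)"
proof -
  have "\<exists>b :: 'm. b \<noteq> idx1"
  proof (rule ccontr)
    assume "\<not> (\<exists>b :: 'm. b \<noteq> idx1)"
    then have "(UNIV :: 'm set) = {idx1}" by auto
    then have "CARD('m) = 1" by (metis card_1_singleton_iff One_nat_def)
    then show False using assms by simp
  qed
  then show ne: "idx1 \<noteq> (idx2 :: 'm)" unfolding idx2_def by (metis (mono_tags, lifting) someI_ex)
  have "card {idx1, idx2 :: 'm} = CARD('m)" using ne assms by simp
  then show "(UNIV :: 'm set) = {idx1, idx2}" by (metis card_subset_eq finite subset_UNIV)
qed

text \<open>For m = 2 the Euclidean cross product of the real and imaginary parts with its time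
  coordinate negated, which makes it orthogonal to both for the form.\<close>

definition lcross :: "complex ^ ('m::finite option) \<Rightarrow> real ^ ('m option)" where
  "lcross z = (let a = Some idx1; b = Some idx2; x = re_vec z; y = im_vec z in
     (\<chi> i. if i = None then x $ b * y $ a - x $ a * y $ b
           else if i = a then x $ b * y $ None - x $ None * y $ b
           else x $ None * y $ a - x $ a * y $ None))"

lemma lor_2:
  fixes x y :: "real ^ ('m::finite option)"
  assumes "CARD('m) = 2"
  shows "lor x y = x $ Some idx1 * y $ Some idx1 + x $ Some idx2 * y $ Some idx2 - x $ None * y $ None"
proof -
  have "sum f UNIV = f idx1 + f idx2" for f :: "'m \<Rightarrow> real"
    unfolding UNIV_idx(1)[OF assms] using UNIV_idx(2)[OF assms] by simp
  then show ?thesis by (simp add: lor_def)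
qed

lemma lcross_nth:
  assumes "CARD('m::finite) = 2"
  shows "lcross z $ (None :: 'm option) = re_vec z $ Some idx2 * im_vec z $ Some idx1 - re_vec z $ Some idx1 * im_vec z $ Some idx2"
    "lcross z $ (Some idx1 :: 'm option) = re_vec z $ Some idx2 * im_vec z $ None - re_vec z $ None * im_vec z $ Some idx2"
    "lcross z $ (Some idx2 :: 'm option) = re_vec z $ None * im_vec z $ Some idx1 - re_vec z $ Some idx1 * im_vec z $ None"
  using UNIV_idx(2)[OF assms] by (simp_all add: lcross_def Let_def)

lemma lcross:
  fixes z :: "complex ^ ('m::finite option)"
  assumes "CARD('m) = 2"
  shows "lor (lcross z) (re_vec z) = 0" "lor (lcross z) (im_vec z) = 0"
    "4 * lor (lcross z) (lcross z) = (cmod (qform z))\<^sup>2 - (hnorm z)\<^sup>2"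
proof -
  show "lor (lcross z) (re_vec z) = 0" "lor (lcross z) (im_vec z) = 0"
    unfolding lor_2[OF assms] lcross_nth[OF assms] by algebra+
  have "lor (lcross z) (lcross z) = (lor (re_vec z) (im_vec z))\<^sup>2 - lor (re_vec z) (re_vec z) * lor (im_vec z) (im_vec z)"
    unfolding lor_2[OF assms] lcross_nth[OF assms] by algebra
  then show "4 * lor (lcross z) (lcross z) = (cmod (qform z))\<^sup>2 - (hnorm z)\<^sup>2"
    using hnorm_qform_gram[of z] by simp
qed

text \<open>The point of the Klein ball onto which the bundle projects the class of z; the second case occurs only for
  m = 2.\<close>

definition klein :: "complex ^ ('m::finite option) \<Rightarrow> real ^ 'm" where
  "klein z = (if hnorm z < cmod (qform z) then \<chi> j. Re (axis_vec z $ Some j / axis_vec z $ None)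
     else \<chi> j. lcross z $ Some j / lcross z $ None)"

definition Omega_lift :: "(complex ^ ('m::finite option)) set" where
  "Omega_lift = {z. hnorm z < cmod (qform z) \<or> (CARD('m) = 2 \<and> cmod (qform z) < hnorm z)}"

lemma Omega_lift_nonzero: "z \<in> Omega_lift \<Longrightarrow> z \<noteq> 0"
  by (auto simp: Omega_lift_def hnorm_def qform_def zero_complex.code)

text \<open>Links the formula \<open>klein\<close> to the relation \<open>axis_of\<close>. The
  nonvanishing denominators are included because smoothness of \<open>klein\<close> rests on
  them.\<close>

lemma axis_of_exists:
  fixes z :: "complex ^ ('m::finite option)"
  assumes "z \<in> Omega_lift"
  shows "axis_of z (homog (klein z)) \<and> norm (klein z) < 1"
    and "hnorm z < cmod (qform z) \<Longrightarrow> axis_vec z $ None \<noteq> 0"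
    and "\<not> hnorm z < cmod (qform z) \<Longrightarrow> lcross z $ None \<noteq> 0"
proof -
  have z0: "z \<noteq> 0" using assms by (rule Omega_lift_nonzero)
  have key: "axis_of z (homog (klein z)) \<and> norm (klein z) < 1 \<and> axis_vec z $ None \<noteq> 0" if 1: "hnorm z < cmod (qform z)"
  proof -
    obtain c x y where c: "c \<noteq> 0" "c *s z = cplx x y" "lor x y = 0" "hnorm z < cmod (qform z) \<longleftrightarrow> lor y y < 0"
      by (rule rotated_representative[OF z0]) blast
    have y: "lor y y < 0" using 1 c(4) by simp
    have "axis_of (inverse c *s (c *s z)) y"
      unfolding c(2) using c(1) axis_of_rotated(1)[OF c(3) y] by (intro axis_of_scale) auto
    then have az: "axis_of z y" using c(1) by (simp add: vector_smult_assoc)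
    then obtain d where d: "d \<noteq> 0" "axis_vec z = d *s real_vec y" using 1 by (auto simp: axis_of_def)
    have yN: "y $ None \<noteq> 0" by (rule timelike_homog(1)[OF y])
    have "axis_vec z $ Some j / axis_vec z $ None = of_real (y $ Some j / y $ None)" for j
    proof -
      have "axis_vec z $ i = d * of_real (y $ i)" for i by (simp add: d(2) complex_of_real_def)
      then show ?thesis using d(1) by simp
    qed
    then have k: "klein z = inverse (y $ None) *\<^sub>R space_part y"
      using 1 by (simp add: klein_def vec_eq_iff field_simps)
    from az have "axis_of z (inverse (y $ None) *\<^sub>R y)" using yN by (intro axis_of_scaleR) auto
    moreover have "inverse (y $ None) *\<^sub>R y = homog (klein z)"
      by (subst timelike_homog(2)[OF y]) (use yN k in simp)
    moreover have "axis_vec z $ None \<noteq> 0" using d yN by (simp add: complex_eq_iff)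
    ultimately show ?thesis using timelike_homog(3)[OF y] k by simp
  qed
  have key2: "axis_of z (homog (klein z)) \<and> norm (klein z) < 1 \<and> lcross z $ None \<noteq> 0" if 2: "\<not> hnorm z < cmod (qform z)"
  proof -
    have m: "CARD('m) = 2" "cmod (qform z) < hnorm z" using 2 assms by (auto simp: Omega_lift_def)
    have "(cmod (qform z))\<^sup>2 < (hnorm z)\<^sup>2" using m(2) by (intro power_strict_mono) auto
    then have y: "lor (lcross z) (lcross z) < 0" using lcross(3)[OF m(1), of z] by linarith
    then have "axis_of z (lcross z)" using 2 m lcross(1,2)[OF m(1), of z] by (auto simp: axis_of_def)
    moreover have yN: "lcross z $ None \<noteq> 0" by (rule timelike_homog(1)[OF y])
    ultimately have "axis_of z (inverse (lcross z $ None) *\<^sub>R lcross z)" by (intro axis_of_scaleR) auto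
    moreover have k: "klein z = inverse (lcross z $ None) *\<^sub>R space_part (lcross z)"
      using 2 by (simp add: klein_def vec_eq_iff field_simps)
    moreover have "inverse (lcross z $ None) *\<^sub>R lcross z = homog (klein z)"
      by (subst timelike_homog(2)[OF y]) (use yN k in simp)
    ultimately show ?thesis using timelike_homog(3)[OF y] yN by simp
  qed
  show "axis_of z (homog (klein z)) \<and> norm (klein z) < 1" using key key2 by blast
  show "hnorm z < cmod (qform z) \<Longrightarrow> axis_vec z $ None \<noteq> 0" using key by blast
  show "\<not> hnorm z < cmod (qform z) \<Longrightarrow> lcross z $ None \<noteq> 0" using key2 by blast
qed

lemma Omega_lift_scale: "c \<noteq> 0 \<Longrightarrow> c *s z \<in> Omega_lift \<longleftrightarrow> z \<in> Omega_lift"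
  by (simp add: Omega_lift_def hnorm_scale cmod_qform_scale)

lemma Omega_lift_lorentz: "lorentz A \<Longrightarrow> cmat A *v z \<in> Omega_lift \<longleftrightarrow> z \<in> Omega_lift"
  by (simp add: Omega_lift_def hnorm_lorentz qform_lorentz)

lemma axis_of_klein:
  assumes "z \<in> Omega_lift" "axis_of z Y"
  obtains r where "r \<noteq> 0" "homog (klein z) = r *\<^sub>R Y"
  using axis_of_unique[OF Omega_lift_nonzero[OF assms(1)] assms(2)] axis_of_exists(1)[OF assms(1)] by blast

lemma klein_scale:
  assumes "c \<noteq> 0" "z \<in> Omega_lift"
  shows "klein (c *s z) = klein z"
proof -
  have "axis_of (c *s z) (homog (klein z))"
    using axis_of_scale[OF assms(1)] axis_of_exists(1)[OF assms(2)] by blast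
  then obtain r where "homog (klein (c *s z)) = r *\<^sub>R homog (klein z)"
    using axis_of_klein[of "c *s z"] assms by (auto simp: Omega_lift_scale)
  then show ?thesis by (rule homog_eq_scale)
qed

lemma klein_lorentz:
  assumes "lorentz A" "z \<in> Omega_lift"
  obtains r where "r \<noteq> 0" "homog (klein (cmat A *v z)) = r *\<^sub>R (A *v homog (klein z))"
proof -
  have "axis_of (cmat A *v z) (A *v homog (klein z))"
    using axis_of_lorentz[OF assms(1)] axis_of_exists(1)[OF assms(2)] by blast
  then show ?thesis using axis_of_klein[of "cmat A *v z"] assms that by (auto simp: Omega_lift_lorentz)
qed

section \<open>Smoothness of the projection\<close>

lemma smooth_on_cplx [smooth_intros]:
  fixes f g :: "'a::euclidean_space \<Rightarrow> real ^ 'n::finite"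
  shows "open S \<Longrightarrow> smooth_on S f \<Longrightarrow> smooth_on S g \<Longrightarrow> smooth_on S (\<lambda>x. cplx (f x) (g x))"
  unfolding cplx_def by (intro smooth_intros)

lemma smooth_on_re_vec [smooth_intros]:
  fixes f :: "'a::euclidean_space \<Rightarrow> complex ^ 'n::finite"
  shows "open S \<Longrightarrow> smooth_on S f \<Longrightarrow> smooth_on S (\<lambda>x. re_vec (f x))"
  by (rule smooth_on_linear[OF _ bounded_linear_re_vec])

lemma smooth_on_im_vec [smooth_intros]:
  fixes f :: "'a::euclidean_space \<Rightarrow> complex ^ 'n::finite"
  shows "open S \<Longrightarrow> smooth_on S f \<Longrightarrow> smooth_on S (\<lambda>x. im_vec (f x))"
  by (rule smooth_on_linear[OF _ bounded_linear_im_vec])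

lemma smooth_on_lor [smooth_intros]:
  "open S \<Longrightarrow> smooth_on S f \<Longrightarrow> smooth_on S g \<Longrightarrow> smooth_on S (\<lambda>x. lor (f x) (g x))"
  by (rule smooth_on_bilinear[OF _ bounded_bilinear_lor])

lemma smooth_on_homog [smooth_intros]:
  fixes f :: "'a::euclidean_space \<Rightarrow> real ^ 'm::finite"
  assumes "open S" "smooth_on S f"
  shows "smooth_on S (\<lambda>x. homog (f x))"
  unfolding homog_def
proof (rule smooth_on_vec_lambda[OF assms(1)])
  fix i show "smooth_on S (\<lambda>x. case i of None \<Rightarrow> 1 | Some j \<Rightarrow> f x $ j)"
    using assms by (cases i) (auto intro: smooth_intros)
qed

lemma smooth_on_conj_vec [smooth_intros]:
  fixes f :: "'a::euclidean_space \<Rightarrow> complex ^ 'n::finite"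
  shows "open S \<Longrightarrow> smooth_on S f \<Longrightarrow> smooth_on S (\<lambda>x. conj_vec (f x))"
  unfolding conj_vec_def by (intro smooth_intros)

lemma smooth_on_smult [smooth_intros]:
  fixes f :: "'a::euclidean_space \<Rightarrow> complex ^ 'n::finite"
  shows "open S \<Longrightarrow> smooth_on S c \<Longrightarrow> smooth_on S f \<Longrightarrow> smooth_on S (\<lambda>x. c x *s f x)"
  unfolding vector_scalar_mult_def by (intro smooth_intros)

lemma smooth_on_qform [smooth_intros]:
  "open S \<Longrightarrow> smooth_on S f \<Longrightarrow> smooth_on S (\<lambda>x. qform (f x))"
  unfolding qform_def by (intro smooth_intros)

lemma continuous_on_hnorm: "continuous_on S hnorm"
proof -
  have "smooth_on UNIV (hnorm :: complex ^ ('a option) \<Rightarrow> real)"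
    unfolding hnorm_def[abs_def] by (intro smooth_intros) auto
  then show ?thesis using smooth_on_imp_continuous_on continuous_on_subset by blast
qed

lemma continuous_on_cmod_qform: "continuous_on S (\<lambda>z. cmod (qform z))"
proof -
  have "smooth_on UNIV (qform :: complex ^ ('a option) \<Rightarrow> complex)"
    by (intro smooth_intros) auto
  then show ?thesis
    by (intro continuous_on_norm) (use smooth_on_imp_continuous_on continuous_on_subset in blast)
qed

lemma open_lt: "open {z :: complex ^ ('m::finite option). hnorm z < cmod (qform z)}"
  by (intro open_Collect_less continuous_on_hnorm continuous_on_cmod_qform)

lemma open_gt: "open {z :: complex ^ ('m::finite option). cmod (qform z) < hnorm z}"
  by (intro open_Collect_less continuous_on_hnorm continuous_on_cmod_qform)

lemma open_Omega_lift: "open (Omega_lift :: (complex ^ ('m::finite option)) set)"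
  unfolding Omega_lift_def
  by (cases "CARD('m) = 2") (auto simp: Collect_disj_eq intro!: open_Un open_lt open_gt)

text \<open>Both strict inequalities between h and |q| are open conditions, so near each point only
  one branch of \<open>klein\<close> occurs.\<close>

lemma smooth_on_klein: "smooth_on Omega_lift (klein :: complex ^ ('m::finite option) \<Rightarrow> real ^ 'm)"
proof (rule smooth_on_local)
  fix z :: "complex ^ ('m option)" assume z: "z \<in> Omega_lift"
  show "\<exists>U. z \<in> U \<and> open U \<and> smooth_on U klein"
  proof (cases "hnorm z < cmod (qform z)")
    case True
    let ?U = "{z :: complex ^ ('m option). hnorm z < cmod (qform z)}"
    have ax: "axis_vec w $ None \<noteq> 0" if "w \<in> ?U" for w
      using axis_of_exists(2)[of w] that by (auto simp: Omega_lift_def)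
    then have q: "qform w \<noteq> 0" if "w \<in> ?U" for w
      using ax[OF that] by (auto simp: axis_vec_def)
    have "smooth_on ?U axis_vec"
      unfolding axis_vec_def[abs_def] using open_lt q by (intro smooth_intros) auto
    then have "smooth_on ?U (\<lambda>w. \<chi> j. Re (axis_vec w $ Some j / axis_vec w $ None))"
      using open_lt ax by (intro smooth_intros) auto
    then have "smooth_on ?U klein"
      by (rule smooth_on_cong[OF open_lt, rotated]) (simp add: klein_def)
    with True open_lt show ?thesis by (intro exI[of _ ?U]) simp
  next
    case False
    then have m: "CARD('m) = 2" "cmod (qform z) < hnorm z" using z by (auto simp: Omega_lift_def)
    let ?U = "{z :: complex ^ ('m option). cmod (qform z) < hnorm z}"
    have ax: "lcross w $ None \<noteq> 0" if "w \<in> ?U" for w :: "complex ^ ('m option)"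
      using axis_of_exists(3)[of w] that m(1) by (auto simp: Omega_lift_def)
    have sm: "smooth_on ?U (\<lambda>w. lcross w $ i)" for i
    proof -
      consider "i = None" | "i = Some idx1" | "i = Some idx2"
        using UNIV_idx(1)[OF m(1)] by (cases i) auto
      then show ?thesis
        by cases (use open_gt in \<open>auto simp: lcross_nth[OF m(1)] intro!: smooth_intros\<close>)
    qed
    have "smooth_on ?U (\<lambda>w. \<chi> j. lcross w $ Some j / lcross w $ None)"
      using open_gt ax by (intro smooth_on_vec_lambda smooth_on_divide_real sm) auto
    then have "smooth_on ?U klein"
      by (rule smooth_on_cong[OF open_gt, rotated]) (simp add: klein_def)
    with m open_gt show ?thesis by (intro exI[of _ ?U]) simp
  qed
qed

section \<open>Boosts\<close>

definition refl :: "real ^ ('m::finite option) \<Rightarrow> real ^ ('m option) \<Rightarrow> real ^ ('m option)" where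
  "refl u v = v - (2 * lor u v / lor u u) *\<^sub>R u"

lemma linear_refl: "linear (refl u)"
  by (rule linearI) (simp_all add: refl_def lor_simps algebra_simps add_divide_distrib)

lemma lor_refl: "lor u u \<noteq> 0 \<Longrightarrow> lor (refl u x) (refl u y) = lor x y"
  by (simp add: refl_def lor_simps lor_commute[of x u] field_simps)

lemma refl_refl: "lor u u \<noteq> 0 \<Longrightarrow> refl u (refl u x) = x"
  by (simp add: refl_def lor_simps)

text \<open>For |k| < 1 a positive multiple of the sum of \<open>tvec\<close> and the normalised
  \<open>homog k\<close>, that is, the bisector of the two.\<close>

definition mid_vec :: "real ^ 'm \<Rightarrow> real ^ ('m::finite option)" where
  "mid_vec k = homog k + sqrt (1 - (norm k)\<^sup>2) *\<^sub>R tvec"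

text \<open>The first reflection sends \<open>tvec\<close> to its negative, and reflection in the
  bisector sends that to the normalised \<open>homog k\<close>. Reflections give a formula that is
  smooth in k and easy to invert.\<close>

definition boost :: "real ^ 'm \<Rightarrow> real ^ ('m::finite option) \<Rightarrow> real ^ ('m option)" where
  "boost k v = refl (mid_vec k) (refl tvec v)"

definition unboost :: "real ^ 'm \<Rightarrow> real ^ ('m::finite option) \<Rightarrow> real ^ ('m option)" where
  "unboost k v = refl tvec (refl (mid_vec k) v)"

lemma norm_square_less_1: "norm k < 1 \<Longrightarrow> 1 - (norm k)\<^sup>2 > 0"
  by (simp add: power_less_one_iff abs_square_less_1)

lemma lor_mid_vec:
  assumes "norm k < 1"
  shows "lor (mid_vec k) (mid_vec k) = - 2 * sqrt (1 - (norm k)\<^sup>2) * (1 + sqrt (1 - (norm k)\<^sup>2))"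
    and "lor (mid_vec k) (mid_vec k) < 0"
proof -
  define r where "r = sqrt (1 - (norm k)\<^sup>2)"
  have r: "r > 0" "r\<^sup>2 = 1 - (norm k)\<^sup>2" using norm_square_less_1[OF assms] by (simp_all add: r_def)
  have "lor (mid_vec k) (mid_vec k) = - r\<^sup>2 - 2 * r - r\<^sup>2"
    unfolding mid_vec_def r_def[symmetric] using r(2) by (simp add: lor_simps lor_homog power2_eq_square algebra_simps)
  then show e: "lor (mid_vec k) (mid_vec k) = - 2 * r * (1 + r)" by (simp add: power2_eq_square algebra_simps)
  show "lor (mid_vec k) (mid_vec k) < 0" unfolding e using r(1) by (simp add: mult_pos_pos)
qed

lemma boost_tvec:
  assumes "norm k < 1"
  shows "boost k tvec = inverse (sqrt (1 - (norm k)\<^sup>2)) *\<^sub>R homog k"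
proof -
  define r where "r = sqrt (1 - (norm k)\<^sup>2)"
  have r: "r > 0" using norm_square_less_1[OF assms] by (simp add: r_def)
  have u: "mid_vec k = homog k + r *\<^sub>R tvec" by (simp add: mid_vec_def r_def)
  have "refl tvec tvec = - (tvec :: real ^ ('a option))" by (simp add: refl_def) (simp add: scaleR_2)
  then have "boost k tvec = refl (mid_vec k) (- tvec)" by (simp add: boost_def)
  also have "\<dots> = - tvec - (2 * lor (mid_vec k) (- tvec) / lor (mid_vec k) (mid_vec k)) *\<^sub>R mid_vec k"
    by (simp only: refl_def)
  also have "2 * lor (mid_vec k) (- tvec) / lor (mid_vec k) (mid_vec k) = - inverse r"
  proof -
    have "lor (mid_vec k) (- tvec) = 1 + r" by (simp add: u lor_simps)
    moreover have "lor (mid_vec k) (mid_vec k) = - 2 * r * (1 + r)" using lor_mid_vec(1)[OF assms] by (simp add: r_def)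
    moreover have "2 * (1 + r) / (- 2 * r * (1 + r)) = - inverse r" using r by (simp add: divide_simps)
    ultimately show ?thesis by (simp only:)
  qed
  also have "- tvec - (- inverse r) *\<^sub>R mid_vec k = inverse r *\<^sub>R homog k"
    using r by (simp add: u algebra_simps)
  finally show ?thesis by (simp add: r_def)
qed

definition boost_mat :: "real ^ 'm \<Rightarrow> real ^ ('m::finite option) ^ ('m option)" where
  "boost_mat k = matrix (boost k)"

lemma boost_mat_mult: "boost_mat k *v x = boost k x"
proof -
  have "linear (boost k)"
    using linear_compose[OF linear_refl[of tvec] linear_refl[of "mid_vec k"]] by (simp add: boost_def[abs_def] o_def)
  then show ?thesis by (simp add: boost_mat_def)
qed

lemma lorentz_boost_mat:
  assumes "norm k < 1"
  shows "lorentz (boost_mat k)"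
  using lor_mid_vec(2)[OF assms] by (simp add: lorentz_def boost_mat_mult boost_def lor_refl)

lemma unboost_mat_mult:
  assumes "norm k < 1"
  shows "lor_adj (boost_mat k) *v x = unboost k x"
proof -
  have "boost_mat k *v unboost k x = x"
    using lor_mid_vec(2)[OF assms] by (simp add: boost_mat_mult boost_def unboost_def refl_refl)
  then show ?thesis using lorentz_adj_mult(1)[OF lorentz_boost_mat[OF assms], of "unboost k x"] by simp
qed

definition cboost :: "real ^ 'm \<Rightarrow> complex ^ ('m::finite option) \<Rightarrow> complex ^ ('m option)" where
  "cboost k z = cplx (boost k (re_vec z)) (boost k (im_vec z))"

definition cunboost :: "real ^ 'm \<Rightarrow> complex ^ ('m::finite option) \<Rightarrow> complex ^ ('m option)" where
  "cunboost k z = cplx (unboost k (re_vec z)) (unboost k (im_vec z))"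

lemma cboost_eq: "cboost k z = cmat (boost_mat k) *v z"
  by (simp add: cboost_def cmat_mult_vec boost_mat_mult)

lemma cunboost_eq: "norm k < 1 \<Longrightarrow> cunboost k z = cmat (lor_adj (boost_mat k)) *v z"
  by (simp add: cunboost_def cmat_mult_vec unboost_mat_mult)

lemma cboost_cunboost:
  assumes "norm k < 1"
  shows "cboost k (cunboost k z) = z" "cunboost k (cboost k z) = z"
  using lor_mid_vec(2)[OF assms]
  by (simp_all add: cboost_def cunboost_def boost_def unboost_def refl_refl)

lemma cboost_scale: "cboost k (c *s z) = c *s cboost k z"
  by (simp add: cboost_eq cmat_smult)

lemma cunboost_scale: "norm k < 1 \<Longrightarrow> cunboost k (c *s z) = c *s cunboost k z"
  by (simp add: cunboost_eq cmat_smult)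

lemma cboost_eq_0_iff: "norm k < 1 \<Longrightarrow> cboost k z = 0 \<longleftrightarrow> z = 0"
  by (simp add: cboost_eq lorentz_boost_mat)

lemma cunboost_eq_0_iff: "norm k < 1 \<Longrightarrow> cunboost k z = 0 \<longleftrightarrow> z = 0"
  by (simp add: cunboost_eq lorentz_boost_mat lorentz_lor_adj)

lemma smooth_on_refl:
  assumes "open S" "smooth_on S u" "smooth_on S f" "\<And>x. x \<in> S \<Longrightarrow> lor (u x) (u x) \<noteq> 0"
  shows "smooth_on S (\<lambda>x. refl (u x) (f x))"
  unfolding refl_def using assms by (intro smooth_intros)

lemma smooth_on_mid_vec:
  fixes f :: "'a::euclidean_space \<Rightarrow> real ^ 'm::finite"
  assumes "open S" "smooth_on S f" "\<And>x. x \<in> S \<Longrightarrow> norm (f x) < 1"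
  shows "smooth_on S (\<lambda>x. mid_vec (f x))"
proof -
  have "smooth_on S (\<lambda>x. f x \<bullet> f x)"
    by (rule smooth_on_bilinear[OF assms(1) bounded_bilinear_inner assms(2,2)])
  then have "smooth_on S (\<lambda>x. (norm (f x))\<^sup>2)" by (simp add: power2_norm_eq_inner)
  then show ?thesis
    unfolding mid_vec_def using assms norm_square_less_1
    by (intro smooth_on_add smooth_on_homog smooth_on_scaleR smooth_on_sqrt smooth_on_diff smooth_on_const) auto
qed

lemma smooth_on_cboost:
  assumes "open S" "smooth_on S f" "smooth_on S g" "\<And>x. x \<in> S \<Longrightarrow> norm (f x) < 1"
  shows "smooth_on S (\<lambda>x. cboost (f x) (g x))"
proof -
  have m: "lor (mid_vec (f x)) (mid_vec (f x)) \<noteq> 0" if "x \<in> S" for x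
    using lor_mid_vec(2)[OF assms(4)[OF that]] by simp
  show ?thesis
    unfolding cboost_def boost_def using assms m
    by (intro smooth_on_cplx smooth_on_refl smooth_on_mid_vec smooth_on_const smooth_on_re_vec smooth_on_im_vec) auto
qed

lemma smooth_on_cunboost:
  assumes "open S" "smooth_on S f" "smooth_on S g" "\<And>x. x \<in> S \<Longrightarrow> norm (f x) < 1"
  shows "smooth_on S (\<lambda>x. cunboost (f x) (g x))"
proof -
  have m: "lor (mid_vec (f x)) (mid_vec (f x)) \<noteq> 0" if "x \<in> S" for x
    using lor_mid_vec(2)[OF assms(4)[OF that]] by simp
  show ?thesis
    unfolding cunboost_def unboost_def using assms m
    by (intro smooth_on_cplx smooth_on_refl smooth_on_mid_vec smooth_on_const smooth_on_re_vec smooth_on_im_vec) auto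
qed

section \<open>Moving points to and from the central fibre\<close>

lemma klein_zero_iff:
  assumes "z \<in> Omega_lift"
  shows "klein z = 0 \<longleftrightarrow> axis_of z tvec"
proof
  assume "klein z = 0"
  then show "axis_of z tvec" using axis_of_exists(1)[OF assms] by (simp add: homog_zero)
next
  assume "axis_of z tvec"
  then obtain r where "homog (klein z) = r *\<^sub>R homog 0" using axis_of_klein[OF assms] by (metis homog_zero)
  then show "klein z = 0" by (rule homog_eq_scale)
qed

text \<open>The inverse boost carries the axis \<open>homog k\<close> of z to a multiple of
  \<open>tvec\<close>.\<close>

lemma klein_cunboost:
  assumes "z \<in> Omega_lift"
  shows "cunboost (klein z) z \<in> Omega_lift" "klein (cunboost (klein z) z) = 0"
proof -
  define k where "k = klein z"
  have k: "norm k < 1" "axis_of z (homog k)" using axis_of_exists(1)[OF assms] by (simp_all add: k_def)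
  have l: "lorentz (lor_adj (boost_mat k))" using k by (simp add: lorentz_boost_mat lorentz_lor_adj)
  show O: "cunboost (klein z) z \<in> Omega_lift"
    using l assms k by (simp add: k_def[symmetric] cunboost_eq Omega_lift_lorentz)
  define r where "r = sqrt (1 - (norm k)\<^sup>2)"
  have r: "r > 0" using norm_square_less_1[OF k(1)] by (simp add: r_def)
  have "homog k = r *\<^sub>R (boost_mat k *v tvec)" using boost_tvec[OF k(1)] r by (simp add: boost_mat_mult r_def)
  then have "lor_adj (boost_mat k) *v homog k = r *\<^sub>R tvec"
    using lorentz_boost_mat[OF k(1)] by (simp add: matrix_vector_mult_scaleR)
  then have "axis_of (cunboost k z) (r *\<^sub>R tvec)" using axis_of_lorentz[OF l k(2)] k by (simp add: cunboost_eq)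
  then have "axis_of (cunboost k z) (inverse r *\<^sub>R (r *\<^sub>R tvec))"
    by (rule axis_of_scaleR[rotated]) (use r in simp)
  moreover have "inverse r *\<^sub>R (r *\<^sub>R tvec) = (tvec :: real ^ ('a option))" using r by (simp only: scaleR_scaleR) simp
  ultimately have "axis_of (cunboost k z) tvec" by (simp only:)
  then show "klein (cunboost (klein z) z) = 0" using klein_zero_iff[OF O] by (simp add: k_def)
qed

lemma klein_cboost:
  assumes "z \<in> Omega_lift" "klein z = 0" "norm k < 1"
  shows "cboost k z \<in> Omega_lift" "klein (cboost k z) = k"
proof -
  have l: "lorentz (boost_mat k)" using assms by (simp add: lorentz_boost_mat)
  show O: "cboost k z \<in> Omega_lift"
    using l assms by (simp add: cboost_eq Omega_lift_lorentz)
  have "axis_of z tvec" using klein_zero_iff assms by blast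
  then have "axis_of (cboost k z) (boost k tvec)"
    using axis_of_lorentz[OF l] by (fastforce simp: cboost_eq boost_mat_mult)
  then obtain r where "homog (klein (cboost k z)) = r *\<^sub>R boost k tvec"
    using axis_of_klein[OF O] by blast
  then have "homog (klein (cboost k z)) = (r * inverse (sqrt (1 - (norm k)\<^sup>2))) *\<^sub>R homog k"
    by (simp add: boost_tvec assms)
  then show "klein (cboost k z) = k" by (rule homog_eq_scale)
qed

section \<open>Manifolds given by charts with explicit inverses\<close>

text \<open>A chart of the space X with a given inverse \<tau>. It stands in for
  \<open>inv_into\<close>, about which no formula is known.\<close>

definition chart_inverse ::
  "'a::topological_space set \<Rightarrow> 'a set \<Rightarrow> ('a \<Rightarrow> 'e::euclidean_space) \<Rightarrow> ('e \<Rightarrow> 'a) \<Rightarrow> bool" where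
  "chart_inverse X U \<phi> \<tau> \<longleftrightarrow> openin (top_of_set X) U \<and> open (\<phi> ` U) \<and> continuous_on U \<phi> \<and>
     continuous_on (\<phi> ` U) \<tau> \<and> (\<forall>p\<in>U. \<tau> (\<phi> p) = p)"

lemma chart_inverse_subset: "chart_inverse X U \<phi> \<tau> \<Longrightarrow> U \<subseteq> X"
  by (auto simp: chart_inverse_def dest: openin_imp_subset)

lemma chart_inverse_homeomorphic_map:
  assumes "chart_inverse X U \<phi> \<tau>"
  shows "homeomorphic_map (subtopology (top_of_set X) U) (top_of_set (\<phi> ` U)) \<phi>"
proof -
  have "U \<subseteq> X" using assms by (rule chart_inverse_subset)
  then have "subtopology (top_of_set X) U = top_of_set U"
    by (simp add: subtopology_subtopology Int_absorb1)
  moreover have "homeomorphic_maps (top_of_set U) (top_of_set (\<phi> ` U)) \<phi> \<tau>"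
    using assms unfolding homeomorphic_maps_def chart_inverse_def by auto
  ultimately show ?thesis by (auto simp: homeomorphic_map_maps)
qed

lemma chart_inverse_open_image:
  assumes "chart_inverse X U \<phi> \<tau>" "openin (top_of_set X) W"
  shows "open (\<phi> ` (U \<inter> W))"
proof -
  obtain T where T: "open T" "W = X \<inter> T" using assms(2) by (auto simp: openin_open)
  have "\<phi> ` (U \<inter> W) = \<phi> ` U \<inter> \<tau> -` T"
    using chart_inverse_subset[OF assms(1)] assms(1) T by (auto simp: chart_inverse_def)
  then show ?thesis
    using assms(1) T(1) by (simp add: chart_inverse_def continuous_open_preimage)
qed

lemma smooth_on_chart:
  assumes "chart_inverse X U \<phi> \<tau>" "open S" "S \<subseteq> \<phi> ` U" "smooth_on S (\<lambda>y. g (\<tau> y))"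
  shows "smooth_on S (g \<circ> inv_into U \<phi>)"
proof (rule smooth_on_cong[OF assms(2) _ assms(4)])
  fix y assume "y \<in> S"
  then obtain p where p: "p \<in> U" "y = \<phi> p" using assms(3) by auto
  have "inj_on \<phi> U" using assms(1) by (metis chart_inverse_def inj_on_inverseI)
  then show "g (\<tau> y) = (g \<circ> inv_into U \<phi>) y" using p assms(1) by (simp add: chart_inverse_def)
qed

lemma second_countable_top_of_set: "second_countable (top_of_set (X :: 'a::second_countable_topology set))"
proof (rule second_countable_subtopology)
  obtain B :: "'a set set" where B: "countable B" "topological_basis B" using ex_countable_basis by blast
  show "second_countable (euclidean :: 'a topology)"
    unfolding second_countable_def
  proof (intro exI[of _ B] conjI allI impI ballI)
    show "openin euclidean V" if "V \<in> B" for V using that B(2) topological_basis_open by auto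
    show "\<exists>V\<in>B. x \<in> V \<and> V \<subseteq> U" if "openin euclidean U \<and> x \<in> U" for U x
      using that topological_basisE[OF B(2), of U x] by (metis open_openin)
  qed (rule B(1))
qed

lemma Hausdorff_top_of_set: "Hausdorff_space (top_of_set (X :: 'a::t2_space set))"
proof (rule Hausdorff_space_subtopology)
  show "Hausdorff_space (euclidean :: 'a topology)"
    unfolding Hausdorff_space_def disjnt_def using hausdorff by (metis open_openin)
qed

text \<open>Asking smoothness on every open S that \<tau> maps into V avoids computing the images of
  intersections of chart domains.\<close>

lemma smooth_manifoldI:
  fixes M :: "('a::{t2_space, second_countable_topology}, 'e::euclidean_space) mfd"
  assumes "mtop M = top_of_set X" "\<Union> (fst ` charts M) = X"
    and "\<And>U \<phi>. (U, \<phi>) \<in> charts M \<Longrightarrow> \<exists>\<tau>. chart_inverse X U \<phi> \<tau> \<and>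
      (\<forall>V \<psi> S. (V, \<psi>) \<in> charts M \<longrightarrow> open S \<longrightarrow> S \<subseteq> \<phi> ` U \<longrightarrow> (\<forall>y\<in>S. \<tau> y \<in> V) \<longrightarrow> smooth_on S (\<lambda>y. \<psi> (\<tau> y)))"
  shows "smooth_manifold M"
proof -
  have chart: "openin (top_of_set X) U \<and> open (\<phi> ` U) \<and> homeomorphic_map (subtopology (top_of_set X) U) (top_of_set (\<phi> ` U)) \<phi>"
    if "(U, \<phi>) \<in> charts M" for U \<phi>
    using assms(3)[OF that] chart_inverse_homeomorphic_map by (auto simp: chart_inverse_def)
  have trans: "smooth_on (\<phi> ` (U \<inter> V)) (\<psi> \<circ> inv_into U \<phi>)"
    if U: "(U, \<phi>) \<in> charts M" and V: "(V, \<psi>) \<in> charts M" for U \<phi> V \<psi>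
  proof -
    obtain \<tau> where \<tau>: "chart_inverse X U \<phi> \<tau>"
      "\<And>S. open S \<Longrightarrow> S \<subseteq> \<phi> ` U \<Longrightarrow> (\<forall>y\<in>S. \<tau> y \<in> V) \<Longrightarrow> smooth_on S (\<lambda>y. \<psi> (\<tau> y))"
      using assms(3)[OF U] V by metis
    have S: "open (\<phi> ` (U \<inter> V))" using chart_inverse_open_image[OF \<tau>(1)] chart[OF V] by blast
    have "\<forall>y\<in>\<phi> ` (U \<inter> V). \<tau> y \<in> V" using \<tau>(1) by (auto simp: chart_inverse_def)
    then show ?thesis using \<tau>(2)[OF S] by (intro smooth_on_chart[OF \<tau>(1) S]) auto
  qed
  show ?thesis
    unfolding smooth_manifold_def assms(1)
    using Hausdorff_top_of_set second_countable_top_of_set chart trans assms(2) by auto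
qed

text \<open>Continuity of f is glued from its coordinate expressions, the chart domains being
  relatively open; this also makes the preimages of chart domains open.\<close>

lemma smooth_mapI:
  fixes M :: "('a::topological_space, 'e::euclidean_space) mfd" and N :: "('b::topological_space, 'f::euclidean_space) mfd"
  assumes "mtop M = top_of_set X" "mtop N = top_of_set Y" "\<Union> (fst ` charts M) = X" "f ` X \<subseteq> Y"
    and N: "\<And>V \<psi>. (V, \<psi>) \<in> charts N \<Longrightarrow> openin (top_of_set Y) V"
    and M: "\<And>U \<phi>. (U, \<phi>) \<in> charts M \<Longrightarrow> \<exists>\<tau>. chart_inverse X U \<phi> \<tau> \<and> continuous_on (\<phi> ` U) (\<lambda>y. f (\<tau> y)) \<and>
      (\<forall>V \<psi> S. (V, \<psi>) \<in> charts N \<longrightarrow> open S \<longrightarrow> S \<subseteq> \<phi> ` U \<longrightarrow> (\<forall>y\<in>S. f (\<tau> y) \<in> V) \<longrightarrow> smooth_on S (\<lambda>y. \<psi> (f (\<tau> y))))"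
  shows "smooth_map M N f"
proof -
  have cont: "continuous_on X f"
    unfolding continuous_on_def
  proof
    fix x assume "x \<in> X"
    then obtain U \<phi> where U: "(U, \<phi>) \<in> charts M" "x \<in> U" using assms(3) by force
    then obtain \<tau> where \<tau>: "chart_inverse X U \<phi> \<tau>" "continuous_on (\<phi> ` U) (\<lambda>y. f (\<tau> y))" using M by blast
    have "continuous_on U (\<lambda>x. f (\<tau> (\<phi> x)))"
      using \<tau> by (intro continuous_on_compose2[OF \<tau>(2)]) (auto simp: chart_inverse_def)
    then have "continuous_on U f"
      by (rule continuous_on_eq) (use \<tau>(1) in \<open>auto simp: chart_inverse_def\<close>)
    moreover obtain T where T: "open T" "U = X \<inter> T" using \<tau>(1) by (auto simp: chart_inverse_def openin_open)
    have "at x within X = at x within U" using T U(2) by (intro at_within_nhd[of x T]) auto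
    ultimately show "(f \<longlongrightarrow> f x) (at x within X)"
      using U(2) by (simp add: continuous_on_def)
  qed
  then have "continuous_map (mtop M) (mtop N) f"
    using assms(1,2,4) by auto
  moreover have "smooth_on (\<phi> ` (U \<inter> f -` V)) (\<psi> \<circ> f \<circ> inv_into U \<phi>)"
    if U: "(U, \<phi>) \<in> charts M" and V: "(V, \<psi>) \<in> charts N" for U \<phi> V \<psi>
  proof -
    obtain \<tau> where \<tau>: "chart_inverse X U \<phi> \<tau>"
      "\<And>S. open S \<Longrightarrow> S \<subseteq> \<phi> ` U \<Longrightarrow> (\<forall>y\<in>S. f (\<tau> y) \<in> V) \<Longrightarrow> smooth_on S (\<lambda>y. \<psi> (f (\<tau> y)))"
      using M[OF U] V by metis
    have "openin (top_of_set X) (X \<inter> f -` V)"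
      using continuous_openin_preimage[OF cont _ N[OF V]] assms(4) by auto
    then have "open (\<phi> ` (U \<inter> (X \<inter> f -` V)))" by (rule chart_inverse_open_image[OF \<tau>(1)])
    moreover have "U \<inter> (X \<inter> f -` V) = U \<inter> f -` V" using chart_inverse_subset[OF \<tau>(1)] by auto
    ultimately have S: "open (\<phi> ` (U \<inter> f -` V))" by simp
    have "\<forall>y\<in>\<phi> ` (U \<inter> f -` V). f (\<tau> y) \<in> V" using \<tau>(1) by (auto simp: chart_inverse_def)
    then have "smooth_on (\<phi> ` (U \<inter> f -` V)) (\<lambda>y. (\<psi> \<circ> f) (\<tau> y))" using \<tau>(2)[OF S] by auto
    then show ?thesis by (intro smooth_on_chart[OF \<tau>(1) S]) auto
  qed
  ultimately show ?thesis unfolding smooth_map_def by auto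
qed

lemma chart_inverse_prod:
  assumes "chart_inverse X U \<phi> \<tau>" "chart_inverse Y V \<psi> \<sigma>"
  shows "chart_inverse (X \<times> Y) (U \<times> V) (map_prod \<phi> \<psi>) (map_prod \<tau> \<sigma>)"
proof -
  have im: "map_prod \<phi> \<psi> ` (U \<times> V) = \<phi> ` U \<times> \<psi> ` V" by auto
  obtain A B where "open A" "U = X \<inter> A" "open B" "V = Y \<inter> B"
    using assms by (auto simp: chart_inverse_def openin_open)
  then have "open (A \<times> B)" "U \<times> V = (X \<times> Y) \<inter> (A \<times> B)" by (auto intro: open_Times)
  then have "openin (top_of_set (X \<times> Y)) (U \<times> V)" by (auto simp: openin_open)
  moreover have "continuous_on (U \<times> V) (map_prod \<phi> \<psi>)" "continuous_on (\<phi> ` U \<times> \<psi> ` V) (map_prod \<tau> \<sigma>)"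
    using assms unfolding map_prod_def case_prod_beta chart_inverse_def
    by (auto intro!: continuous_on_Pair intro: continuous_on_compose2[OF _ continuous_on_fst[OF continuous_on_id]]
        continuous_on_compose2[OF _ continuous_on_snd[OF continuous_on_id]])
  ultimately show ?thesis
    using assms by (auto simp: chart_inverse_def im open_Times)
qed

section \<open>The manifolds of the bundle\<close>

lemma smooth_on_affine_lift: "open S \<Longrightarrow> smooth_on S (affine_lift i)"
proof -
  assume S: "open S"
  have "smooth_on S (\<lambda>y. if k = i then 1 else case k of None \<Rightarrow> y $ the i | Some j \<Rightarrow> y $ j)" for k
    using S by (cases "k = i"; cases k) (auto intro!: smooth_intros)
  then show ?thesis unfolding affine_lift_def[abs_def] by (intro smooth_on_vec_lambda S)
qed

lemma smooth_on_affine_chart_proj: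
  assumes "open S" "smooth_on S f" "\<And>x. x \<in> S \<Longrightarrow> f x $ i \<noteq> 0"
  shows "smooth_on S (\<lambda>x. affine_chart i (proj (f x)))"
proof (rule smooth_on_cong[OF assms(1)])
  show "smooth_on S (\<lambda>x. \<chi> j. f x $ (if Some j = i then None else Some j) / f x $ i)"
    using assms by (intro smooth_intros) auto
  fix x assume "x \<in> S"
  then have "f x \<noteq> 0" using assms(3)[of x] by auto
  then show "(\<chi> j. f x $ (if Some j = i then None else Some j) / f x $ i) = affine_chart i (proj (f x))"
    by (rule affine_chart_proj[symmetric])
qed

lemma continuous_on_imp_proj_compose:
  assumes "smooth_on S f" "\<And>x. x \<in> S \<Longrightarrow> f x \<noteq> 0"
  shows "continuous_on S (\<lambda>x. proj (f x))"
  using assms by (intro continuous_on_proj_compose smooth_on_imp_continuous_on)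

definition Omega_set :: "'m::finite cproj set" where
  "Omega_set = {proj z |z. z \<in> Omega_lift}"

lemma proj_in_Omega_set: "z \<noteq> 0 \<Longrightarrow> proj z \<in> Omega_set \<longleftrightarrow> z \<in> Omega_lift"
proof
  assume z: "z \<noteq> 0" "proj z \<in> Omega_set"
  then obtain w where w: "w \<in> Omega_lift" "proj w = proj z" by (auto simp: Omega_set_def)
  then obtain c where "c \<noteq> 0" "z = c *s w" using proj_eq_iff_nz[of w z] z Omega_lift_nonzero by blast
  then show "z \<in> Omega_lift" using w by (simp add: Omega_lift_scale)
qed (auto simp: Omega_set_def)

lemma open_Omega_set: "open (Omega_set :: 'm::finite cproj set)"
proof -
  have "{z :: complex ^ ('m option). z \<noteq> 0 \<and> proj z \<in> Omega_set} = Omega_lift"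
    using Omega_lift_nonzero by (auto simp: proj_in_Omega_set)
  then show ?thesis by (simp add: open_cproj_iff open_Omega_lift)
qed

lemma Omega_set_eq: "CARD('m::finite) \<ge> 2 \<Longrightarrow> (- tangent_set :: 'm cproj set) = Omega_set"
proof (intro equalityI subsetI)
  fix p :: "'m cproj" assume m: "CARD('m) \<ge> 2"
  obtain z where z: "z \<noteq> 0" "p = proj z" by (rule proj_cases)
  have "p \<in> - tangent_set \<longleftrightarrow> p \<in> Omega_set"
    unfolding z(2) proj_in_Omega_set[OF z(1)] Compl_iff notin_tangent_set_iff[OF m z(1)] by (simp add: Omega_lift_def)
  then show "p \<in> - tangent_set \<Longrightarrow> p \<in> Omega_set" "p \<in> Omega_set \<Longrightarrow> p \<in> - tangent_set" by auto
qed

lemma chart_inverse_affine: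
  assumes "open X"
  shows "chart_inverse X (affine_dom i \<inter> X) (affine_chart i) (\<lambda>y. proj (affine_lift i y))"
proof -
  have im: "affine_chart i ` (affine_dom i \<inter> X) = {y. proj (affine_lift i y) \<in> X}"
  proof (intro equalityI subsetI)
    fix y assume "y \<in> {y. proj (affine_lift i y) \<in> X}"
    then show "y \<in> affine_chart i ` (affine_dom i \<inter> X)"
      by (intro image_eqI[of _ _ "proj (affine_lift i y)"]) auto
  qed (auto simp: proj_affine_lift_chart)
  have c: "continuous_on UNIV (\<lambda>y. proj (affine_lift i y))"
    by (intro continuous_on_proj_compose continuous_on_affine_lift) auto
  have "open ((\<lambda>y. proj (affine_lift i y)) -` X)" using c assms by (simp add: continuous_on_open_vimage)
  then have "open (affine_chart i ` (affine_dom i \<inter> X))" unfolding im by (simp add: vimage_def)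
  moreover have "openin (top_of_set X) (affine_dom i \<inter> X)"
    using open_affine_dom by (metis Int_commute openin_open)
  ultimately show ?thesis
    unfolding chart_inverse_def
    using continuous_on_subset[OF continuous_on_affine_chart Int_lower1] continuous_on_subset[OF c]
    by (auto simp: proj_affine_lift_chart)
qed

lemma mtop_restrict_CP: "mtop (restrict_mfd CP_mfd X) = top_of_set X"
  by (simp add: restrict_mfd_def CP_mfd_def)

lemma charts_restrict_CP: "charts (restrict_mfd CP_mfd X) = range (\<lambda>i. (affine_dom i \<inter> X, affine_chart i))"
  by (auto simp: restrict_mfd_def CP_mfd_def affine_dom_def)

lemma ex_affine_dom: "\<exists>i. p \<in> affine_dom i"
proof -
  obtain z where z: "z \<noteq> 0" "p = proj z" by (rule proj_cases)
  then obtain i where "z $ i \<noteq> 0" by (auto simp: vec_eq_iff)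
  then show ?thesis using z by (auto simp: proj_in_affine_dom)
qed

lemma charts_cover_CP: "\<Union> (fst ` charts (restrict_mfd CP_mfd X)) = X"
  using ex_affine_dom by (fastforce simp: charts_restrict_CP)

lemma smooth_manifold_CP:
  assumes "open X"
  shows "smooth_manifold (restrict_mfd CP_mfd X)"
proof (rule smooth_manifoldI[OF mtop_restrict_CP charts_cover_CP])
  fix U :: "'a cproj set" and \<phi> :: "'a cproj \<Rightarrow> complex ^ 'a"
  assume "(U, \<phi>) \<in> charts (restrict_mfd CP_mfd X)"
  then obtain i where i: "U = affine_dom i \<inter> X" "\<phi> = affine_chart i" by (auto simp: charts_restrict_CP)
  show "\<exists>\<tau>. chart_inverse X U \<phi> \<tau> \<and> (\<forall>V \<psi> S. (V, \<psi>) \<in> charts (restrict_mfd CP_mfd X) \<longrightarrow> open S \<longrightarrow> S \<subseteq> \<phi> ` U \<longrightarrow>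
      (\<forall>y\<in>S. \<tau> y \<in> V) \<longrightarrow> smooth_on S (\<lambda>y. \<psi> (\<tau> y)))"
  proof (intro exI[of _ "\<lambda>y. proj (affine_lift i y)"] conjI allI impI)
    show "chart_inverse X U \<phi> (\<lambda>y. proj (affine_lift i y))" unfolding i by (rule chart_inverse_affine[OF assms])
    fix V S and \<psi> :: "'a cproj \<Rightarrow> complex ^ 'a"
    assume V: "(V, \<psi>) \<in> charts (restrict_mfd CP_mfd X)" "open S" "S \<subseteq> \<phi> ` U" "\<forall>y\<in>S. proj (affine_lift i y) \<in> V"
    then obtain j where j: "V = affine_dom j \<inter> X" "\<psi> = affine_chart j" by (auto simp: charts_restrict_CP)
    show "smooth_on S (\<lambda>y. \<psi> (proj (affine_lift i y)))"
      unfolding j(2) using V j by (intro smooth_on_affine_chart_proj smooth_on_affine_lift) (auto simp: proj_in_affine_dom)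
  qed
qed

definition klein_chart :: "'m::finite cproj \<Rightarrow> real ^ 'm" where
  "klein_chart p = re_vec (affine_chart None p)"

lemma HR_mfd_eq: "HR_mfd = \<lparr>mtop = top_of_set HR, charts = {(HR, klein_chart)}\<rparr>"
  by (simp add: HR_mfd_def klein_chart_def[abs_def] re_vec_def)

lemma klein_chart_homog [simp]: "klein_chart (proj (real_vec (homog k))) = k"
  by (simp add: klein_chart_def affine_chart_proj) (simp add: vec_eq_iff flip: one_complex.code)

lemma HR_homog: "HR = {proj (real_vec (homog k)) |k. norm k < 1}"
proof (intro equalityI subsetI)
  fix p :: "'a cproj" assume "p \<in> HR"
  then obtain x where x: "lor x x < 0" "p = proj (real_vec x)" by (auto simp: HR_real_vec)
  let ?k = "inverse (x $ None) *\<^sub>R space_part x"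
  have "proj (real_vec (x $ None *\<^sub>R homog ?k)) = proj (real_vec (homog ?k))"
    using timelike_homog(1)[OF x(1)] by (intro proj_real_vec_scale) auto
  then have "p = proj (real_vec (homog ?k))" using x(2) timelike_homog(2)[OF x(1)] by simp
  then show "p \<in> {proj (real_vec (homog k)) |k. norm k < 1}" using timelike_homog(3)[OF x(1)] by blast
next
  fix p :: "'a cproj" assume "p \<in> {proj (real_vec (homog k)) |k. norm k < 1}"
  then obtain k :: "real ^ 'a" where k: "norm k < 1" "p = proj (real_vec (homog k))" by blast
  then have "lor (homog k) (homog k) < 0" using norm_square_less_1[OF k(1)] by (simp add: lor_homog)
  then show "p \<in> HR" using k(2) by (auto simp: HR_real_vec)
qed

lemma klein_chart_image: "klein_chart ` HR = ball 0 1"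
  by (force simp: HR_homog image_iff)

lemma HR_subset_affine_dom: "HR \<subseteq> affine_dom None"
  by (auto simp: HR_homog proj_in_affine_dom complex_eq_iff)

lemma chart_inverse_HR: "chart_inverse HR HR klein_chart (\<lambda>k. proj (real_vec (homog k)))"
proof -
  have "continuous_on HR klein_chart"
    unfolding klein_chart_def
    by (intro bounded_linear.continuous_on[OF bounded_linear_re_vec]
        continuous_on_subset[OF continuous_on_affine_chart HR_subset_affine_dom])
  moreover have "continuous_on (ball 0 1) (\<lambda>k :: real ^ 'a. proj (real_vec (homog k)))"
    by (intro continuous_on_imp_proj_compose smooth_on_cplx smooth_on_homog smooth_on_id smooth_on_const) auto
  ultimately show ?thesis
    unfolding chart_inverse_def klein_chart_image by (auto simp: HR_homog)
qed

lemma smooth_manifold_HR: "smooth_manifold HR_mfd"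
proof (rule smooth_manifoldI[of _ HR])
  fix U :: "'a cproj set" and \<phi> :: "'a cproj \<Rightarrow> real ^ 'a"
  assume "(U, \<phi>) \<in> charts HR_mfd"
  then have U: "U = HR" "\<phi> = klein_chart" by (simp_all add: HR_mfd_eq)
  show "\<exists>\<tau>. chart_inverse HR U \<phi> \<tau> \<and> (\<forall>V \<psi> S. (V, \<psi>) \<in> charts HR_mfd \<longrightarrow> open S \<longrightarrow> S \<subseteq> \<phi> ` U \<longrightarrow>
      (\<forall>y\<in>S. \<tau> y \<in> V) \<longrightarrow> smooth_on S (\<lambda>y. \<psi> (\<tau> y)))"
    unfolding U using chart_inverse_HR
    by (intro exI[of _ "\<lambda>k. proj (real_vec (homog k))"]) (auto simp: HR_mfd_eq intro: smooth_on_id)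
qed (auto simp: HR_mfd_eq)

section \<open>The fibre\<close>

definition fibre :: "'m::finite cproj set" where
  "fibre = {proj z |z. z \<in> Omega_lift \<and> klein z = 0}"

definition fibre1 :: "'m::finite cproj set" where
  "fibre1 = {proj z |z. z \<in> Omega_lift \<and> klein z = 0 \<and> hnorm z < cmod (qform z)}"

definition fibre2 :: "'m::finite cproj set" where
  "fibre2 = {proj z |z. z \<in> Omega_lift \<and> klein z = 0 \<and> cmod (qform z) < hnorm z}"

definition chart1 :: "'m::finite cproj \<Rightarrow> real ^ 'm" where
  "chart1 p = im_vec (affine_chart None p)"

text \<open>For m = 2 the real and imaginary part of the ratio of the two space coordinates.\<close>

definition chart2 :: "'m::finite cproj \<Rightarrow> real ^ 'm" where
  "chart2 p = (\<chi> j. if j = idx1 then Re (affine_chart (Some idx2) p $ idx1) else Im (affine_chart (Some idx2) p $ idx1))"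

text \<open>One chart for each piece. \<open>fibre1\<close> is a copy of R^m; \<open>fibre2\<close>,
  present for m = 2, is a complex projective line without its real points, hence two half
  planes.\<close>

definition fibre_mfd :: "('m::finite cproj, real ^ 'm) mfd" where
  "fibre_mfd = \<lparr>mtop = top_of_set fibre,
     charts = insert (fibre1, chart1) (if CARD('m) = 2 then {(fibre2, chart2)} else {})\<rparr>"

text \<open>Time coordinate 1 and purely imaginary space part iv.\<close>

definition lift1 :: "real ^ 'm \<Rightarrow> complex ^ ('m::finite option)" where
  "lift1 v = cplx tvec (homog v - tvec)"

definition lift2 :: "real ^ 'm \<Rightarrow> complex ^ ('m::finite option)" where
  "lift2 y = (\<chi> i. if i = None then 0 else if i = Some idx1 then Complex (y $ idx1) (y $ idx2) else 1)"

lemma fibre_union: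
  "fibre = (fibre1 :: 'm::finite cproj set) \<union> (if CARD('m) = 2 then fibre2 else {})"
  unfolding fibre_def fibre1_def fibre2_def by (auto simp: Omega_lift_def)

lemma openin_fibre:
  "openin (top_of_set fibre) (fibre1 :: 'm::finite cproj set)"
  "openin (top_of_set fibre) (fibre2 :: 'm::finite cproj set)"
proof -
  have inv: "hnorm w < cmod (qform w) \<longleftrightarrow> hnorm z < cmod (qform z)" "cmod (qform w) < hnorm w \<longleftrightarrow> cmod (qform z) < hnorm z"
    if eq: "proj z = proj w" "z \<noteq> 0" "w \<noteq> 0" for z w :: "complex ^ ('m option)"
  proof -
    obtain c where "c \<noteq> 0" "w = c *s z" using proj_eq_iff_nz[OF eq(2,3)] eq(1) by blast
    then show "hnorm w < cmod (qform w) \<longleftrightarrow> hnorm z < cmod (qform z)" "cmod (qform w) < hnorm w \<longleftrightarrow> cmod (qform z) < hnorm z"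
      by (simp_all add: hnorm_scale cmod_qform_scale)
  qed
  have "fibre1 = fibre \<inter> proj ` ({z :: complex ^ ('m option). hnorm z < cmod (qform z)} - {0})" (is "_ = fibre \<inter> ?A")
  proof (intro equalityI subsetI)
    fix p :: "'m cproj" assume "p \<in> fibre \<inter> ?A"
    then obtain z w :: "complex ^ ('m option)" where "z \<in> Omega_lift" "klein z = 0" "p = proj z"
      "hnorm w < cmod (qform w)" "w \<noteq> 0" "p = proj w" by (auto simp: fibre_def)
    then show "p \<in> fibre1" using inv(1)[of z w] Omega_lift_nonzero unfolding fibre1_def by auto
  qed (use Omega_lift_nonzero in \<open>auto simp: fibre1_def fibre_def\<close>)
  then show "openin (top_of_set fibre) (fibre1 :: 'm cproj set)"
    using open_proj_image[OF open_lt] by (auto simp: openin_open)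
  have "fibre2 = fibre \<inter> proj ` ({z :: complex ^ ('m option). cmod (qform z) < hnorm z} - {0})" (is "_ = fibre \<inter> ?A")
  proof (intro equalityI subsetI)
    fix p :: "'m cproj" assume "p \<in> fibre \<inter> ?A"
    then obtain z w :: "complex ^ ('m option)" where "z \<in> Omega_lift" "klein z = 0" "p = proj z"
      "cmod (qform w) < hnorm w" "w \<noteq> 0" "p = proj w" by (auto simp: fibre_def)
    then show "p \<in> fibre2" using inv(2)[of z w] Omega_lift_nonzero unfolding fibre2_def by auto
  qed (use Omega_lift_nonzero in \<open>auto simp: fibre2_def fibre_def\<close>)
  then show "openin (top_of_set fibre) (fibre2 :: 'm cproj set)"
    using open_proj_image[OF open_gt] by (auto simp: openin_open)
qed

lemma lift1_props:
  "lift1 v \<in> Omega_lift" "klein (lift1 v) = 0" "hnorm (lift1 v) < cmod (qform (lift1 v))" "lift1 v \<noteq> 0"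
proof -
  define w where "w = tvec - homog v"
  \<comment> \<open>Multiplication by the imaginary unit brings the vector into the rotated form
    whose imaginary part is the timelike \<open>tvec\<close>.\<close>
  have i: "\<i> *s lift1 v = cplx w tvec"
    by (simp add: lift1_def w_def vec_eq_iff complex_eq_iff)
  have "lor w tvec = 0" "lor tvec tvec < 0" by (simp_all add: w_def)
  note rot = axis_of_rotated[OF this]
  have O: "\<i> *s lift1 v \<in> Omega_lift" using rot(2) by (simp add: i Omega_lift_def)
  then show O1: "lift1 v \<in> Omega_lift" by (simp add: Omega_lift_scale)
  have "klein (\<i> *s lift1 v) = 0" unfolding klein_zero_iff[OF O] unfolding i by (rule rot(1))
  then show "klein (lift1 v) = 0" using klein_scale[of \<i> "lift1 v"] O1 by simp
  have "hnorm (\<i> *s lift1 v) < cmod (qform (\<i> *s lift1 v))" unfolding i by (rule rot(2))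
  then show "hnorm (lift1 v) < cmod (qform (lift1 v))" by (simp add: hnorm_scale cmod_qform_scale)
  show "lift1 v \<noteq> 0" using O1 by (rule Omega_lift_nonzero)
qed

lemma chart1_lift1 [simp]: "chart1 (proj (lift1 v)) = v"
  using lift1_props(4)[of v]
  by (simp add: chart1_def affine_chart_proj) (simp add: vec_eq_iff lift1_def flip: one_complex.code)

text \<open>Over the centre a rotated representative x + iy has y = r \<open>tvec\<close>, so x has
  no time coordinate; dividing by i r leaves time coordinate 1 and an imaginary space part.\<close>

lemma fibre1_lift1: "fibre1 = range (\<lambda>v. proj (lift1 v))"
proof (intro equalityI subsetI)
  fix p :: "'a cproj" assume "p \<in> fibre1"
  then obtain z where z: "z \<in> Omega_lift" "klein z = 0" "hnorm z < cmod (qform z)" "p = proj z"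
    by (auto simp: fibre1_def)
  have z0: "z \<noteq> 0" using z(1) by (rule Omega_lift_nonzero)
  obtain c x y where c: "c \<noteq> 0" "c *s z = cplx x y" "lor x y = 0" "hnorm z < cmod (qform z) \<longleftrightarrow> lor y y < 0"
    by (rule rotated_representative[OF z0]) blast
  have y: "lor y y < 0" using c z by simp
  have O: "c *s z \<in> Omega_lift" using z(1) c(1) by (simp add: Omega_lift_scale)
  have "axis_of (c *s z) tvec" using klein_zero_iff[OF O] klein_scale[OF c(1) z(1)] z(2) by simp
  moreover have "axis_of (c *s z) y" unfolding c(2) by (rule axis_of_rotated[OF c(3) y])
  ultimately obtain r where r: "r \<noteq> 0" "y = r *\<^sub>R tvec"
    using axis_of_unique[OF Omega_lift_nonzero[OF O]] by metis
  then have xN: "x $ None = 0" using c(3) by (simp add: lor_simps)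
  define v where "v = (- inverse r) *\<^sub>R space_part x"
  have "(\<i> * of_real r) *s lift1 v = c *s z"
    unfolding c(2) vec_eq_iff
  proof
    fix i show "((\<i> * of_real r) *s lift1 v) $ i = cplx x y $ i"
      using r xN by (cases i) (auto simp: lift1_def v_def complex_eq_iff)
  qed
  then have "proj ((\<i> * of_real r) *s lift1 v) = proj (c *s z)" by simp
  then have "proj (lift1 v) = p" using z(4) z0 c(1) r(1) by (simp add: lift1_props(4))
  then show "p \<in> range (\<lambda>v. proj (lift1 v))" by blast
next
  fix p :: "'a cproj" assume "p \<in> range (\<lambda>v. proj (lift1 v))"
  then show "p \<in> fibre1" using lift1_props unfolding fibre1_def by blast
qed

lemma lift2_props:
  assumes "CARD('m::finite) = 2" "y $ idx2 \<noteq> 0"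
  shows "lift2 y \<in> (Omega_lift :: (complex ^ ('m option)) set)" "klein (lift2 y :: complex ^ ('m option)) = 0"
    "cmod (qform (lift2 y :: complex ^ ('m option))) < hnorm (lift2 y :: complex ^ ('m option))"
    "lift2 y \<noteq> (0 :: complex ^ ('m option))"
proof -
  let ?z = "lift2 y :: complex ^ ('m option)"
  have ne: "idx1 \<noteq> (idx2 :: 'm)" by (rule UNIV_idx(2)[OF assms(1)])
  have e: "lor (re_vec ?z) (re_vec ?z) = (y $ idx1)\<^sup>2 + 1" "lor (im_vec ?z) (im_vec ?z) = (y $ idx2)\<^sup>2"
    "lor (re_vec ?z) (im_vec ?z) = y $ idx1 * y $ idx2"
    using ne by (simp_all add: lor_2[OF assms(1)] lift2_def power2_eq_square)
  have h: "hnorm ?z \<ge> 0" by (simp add: hnorm_def e)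
  have "(hnorm ?z)\<^sup>2 - (cmod (qform ?z))\<^sup>2 = 4 * (y $ idx2)\<^sup>2"
    unfolding hnorm_qform_gram e by (simp add: power2_eq_square algebra_simps)
  then have "(cmod (qform ?z))\<^sup>2 < (hnorm ?z)\<^sup>2" using assms(2) by (simp add: algebra_simps)
  then show lt: "cmod (qform ?z) < hnorm ?z" using h by (rule power_less_imp_less_base)
  then show O: "?z \<in> Omega_lift" using assms(1) by (simp add: Omega_lift_def)
  have "axis_of ?z tvec" unfolding axis_of_def using lt assms(1) by (simp add: lift2_def)
  then show "klein ?z = 0" using klein_zero_iff[OF O] by simp
  show "?z \<noteq> 0" using O by (rule Omega_lift_nonzero)
qed

lemma chart2_lift2:
  assumes "CARD('m::finite) = 2" "y $ idx2 \<noteq> 0"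
  shows "chart2 (proj (lift2 y :: complex ^ ('m option))) = y"
proof -
  have ne: "idx1 \<noteq> (idx2 :: 'm)" by (rule UNIV_idx(2)[OF assms(1)])
  have j: "j = idx1 \<or> j = idx2" for j :: 'm using UNIV_idx(1)[OF assms(1)] by blast
  have "affine_chart (Some idx2) (proj (lift2 y :: complex ^ ('m option))) $ idx1 = Complex (y $ idx1) (y $ idx2)"
    unfolding affine_chart_proj[OF lift2_props(4)[OF assms]] using ne by (simp add: lift2_def)
  then show ?thesis unfolding chart2_def vec_eq_iff using j ne by auto
qed

text \<open>Orthogonality to \<open>tvec\<close> removes the time coordinate, and positivity of the
  Gram determinant says that the ratio of the space coordinates is defined and not real.\<close>

lemma fibre2_lift2:
  assumes "CARD('m::finite) = 2" "p \<in> (fibre2 :: 'm cproj set)"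
  shows "p \<in> affine_dom (Some idx2)" "chart2 p $ idx2 \<noteq> 0" "p = proj (lift2 (chart2 p))"
proof -
  have ne: "idx1 \<noteq> (idx2 :: 'm)" by (rule UNIV_idx(2)[OF assms(1)])
  have i: "i = None \<or> i = Some idx1 \<or> i = Some idx2" for i :: "'m option"
    using UNIV_idx(1)[OF assms(1)] by (cases i) auto
  obtain z where z: "z \<in> Omega_lift" "klein z = 0" "cmod (qform z) < hnorm z" "p = proj z"
    using assms(2) by (auto simp: fibre2_def)
  have z0: "z \<noteq> 0" using z(1) by (rule Omega_lift_nonzero)
  have "axis_of z tvec" using klein_zero_iff z by blast
  then have N: "z $ None = 0" using z(3) by (simp add: axis_of_def complex_eq_iff)
  have g: "0 < (Re (z $ Some idx1) * Im (z $ Some idx2) - Re (z $ Some idx2) * Im (z $ Some idx1))\<^sup>2"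
    using gram_pos[OF z(3)] N by (simp add: lor_2[OF assms(1)] power2_eq_square algebra_simps)
  have z2: "z $ Some idx2 \<noteq> 0" using g by auto
  then show "p \<in> affine_dom (Some idx2)" using z z0 by (simp add: proj_in_affine_dom)
  define \<zeta> where "\<zeta> = z $ Some idx1 / z $ Some idx2"
  have a: "affine_chart (Some idx2) p $ idx1 = \<zeta>"
    unfolding z(4) affine_chart_proj[OF z0] using ne by (simp add: \<zeta>_def)
  then have c: "chart2 p $ idx1 = Re \<zeta>" "chart2 p $ idx2 = Im \<zeta>" using ne by (simp_all add: chart2_def)
  have "z = z $ Some idx2 *s lift2 (chart2 p)"
    unfolding vec_eq_iff
  proof
    fix j show "z $ j = (z $ Some idx2 *s lift2 (chart2 p)) $ j"
      using i[of j] ne N z2 c by (auto simp: lift2_def \<zeta>_def)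
  qed
  moreover have nz: "lift2 (chart2 p) \<noteq> 0" using calculation z0 by auto
  ultimately show "p = proj (lift2 (chart2 p))" using z2 proj_scale[OF z2 nz] z(4) by simp
  show "chart2 p $ idx2 \<noteq> 0"
  proof
    assume "chart2 p $ idx2 = 0"
    then have "\<zeta> = of_real (Re \<zeta>)" using c by (simp add: complex_eq_iff)
    then have "z $ Some idx1 = of_real (Re \<zeta>) * z $ Some idx2" using z2 by (simp add: \<zeta>_def field_simps)
    then show False using g by simp
  qed
qed

text \<open>All that the bundle construction needs to know about a chart of the fibre: L parametrises the
  representing vectors.\<close>

definition fibre_chart ::
  "'m::finite cproj set \<Rightarrow> ('m cproj \<Rightarrow> real ^ 'm) \<Rightarrow> (real ^ 'm \<Rightarrow> complex ^ ('m option)) \<Rightarrow> 'm option \<Rightarrow>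
    (complex ^ 'm \<Rightarrow> real ^ 'm) \<Rightarrow> bool" where
  "fibre_chart U \<phi> L i A \<longleftrightarrow> openin (top_of_set fibre) U \<and> U \<subseteq> affine_dom i \<and> bounded_linear A \<and>
     \<phi> = (\<lambda>p. A (affine_chart i p)) \<and> open (\<phi> ` U) \<and> smooth_on (\<phi> ` U) L \<and>
     (\<forall>y\<in>\<phi> ` U. L y \<in> Omega_lift \<and> klein (L y) = 0) \<and> (\<forall>p\<in>U. proj (L (\<phi> p)) = p)"

lemma fibre_chart1: "fibre_chart (fibre1 :: 'm::finite cproj set) chart1 lift1 None im_vec"
proof -
  have im: "chart1 ` fibre1 = (UNIV :: (real ^ 'm) set)" by (auto simp: fibre1_lift1 image_iff intro!: exI[of _ "proj (lift1 _)"])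
  have "lift1 v $ None \<noteq> 0" for v :: "real ^ 'm" by (simp add: lift1_def complex_eq_iff)
  then have "(fibre1 :: 'm cproj set) \<subseteq> affine_dom None"
    by (auto simp: fibre1_lift1 proj_in_affine_dom lift1_props(4))
  moreover have "smooth_on UNIV (lift1 :: real ^ 'm \<Rightarrow> _)"
    unfolding lift1_def[abs_def] by (intro smooth_intros) auto
  ultimately show ?thesis
    unfolding fibre_chart_def im using openin_fibre(1) bounded_linear_im_vec
    by (auto simp: chart1_def[abs_def] lift1_props fibre1_lift1) (simp flip: chart1_def)
qed

lemma fibre_chart2:
  assumes "CARD('m::finite) = 2"
  shows "\<exists>A. fibre_chart (fibre2 :: 'm cproj set) chart2 lift2 (Some idx2) A"
proof -
  define A :: "complex ^ 'm \<Rightarrow> real ^ 'm" where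
    "A v = (\<chi> j. if j = idx1 then Re (v $ idx1) else Im (v $ idx1))" for v
  have im: "chart2 ` (fibre2 :: 'm cproj set) = {y. y $ idx2 \<noteq> 0}"
  proof (intro equalityI subsetI)
    fix y :: "real ^ 'm" assume "y \<in> {y. y $ idx2 \<noteq> 0}"
    then have y: "y $ idx2 \<noteq> 0" by simp
    then have "proj (lift2 y) \<in> (fibre2 :: 'm cproj set)" using lift2_props[OF assms y] unfolding fibre2_def by blast
    then show "y \<in> chart2 ` (fibre2 :: 'm cproj set)" using chart2_lift2[OF assms y] by (metis imageI)
  qed (use fibre2_lift2(2)[OF assms] in auto)
  have o: "open {y :: real ^ 'm. y $ idx2 \<noteq> 0}" by (intro open_Collect_neq continuous_intros)
  have "bounded_linear A"
    unfolding linear_conv_bounded_linear[symmetric] A_def by (rule linearI) (auto simp: vec_eq_iff)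
  moreover have "smooth_on {y :: real ^ 'm. y $ idx2 \<noteq> 0} lift2"
  proof -
    have "smooth_on {y :: real ^ 'm. y $ idx2 \<noteq> 0} (\<lambda>y. if i = None then 0 else if i = Some idx1 then Complex (y $ idx1) (y $ idx2) else 1)" for i
    proof -
      consider "i = None" | "i = Some idx1" | "i \<noteq> None" "i \<noteq> Some idx1" by blast
      then show ?thesis
        by cases (use o in \<open>simp_all add: smooth_on_const smooth_on_Complex smooth_on_vec_nth smooth_on_id del: not_None_eq\<close>)
    qed
    then show ?thesis unfolding lift2_def[abs_def] by (intro smooth_on_vec_lambda o)
  qed
  moreover have "chart2 = (\<lambda>p. A (affine_chart (Some idx2) p))" by (simp add: chart2_def[abs_def] A_def)
  ultimately have "fibre_chart (fibre2 :: 'm cproj set) chart2 lift2 (Some idx2) A"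
    unfolding fibre_chart_def im
    using openin_fibre(2) o fibre2_lift2[OF assms] lift2_props[OF assms] by auto
  then show ?thesis by blast
qed

lemma fibre_mfd_charts:
  assumes "(U, \<phi>) \<in> charts (fibre_mfd :: ('m::finite cproj, real ^ 'm) mfd)"
  obtains L i A where "fibre_chart U \<phi> L i A"
  using assms fibre_chart1 fibre_chart2 by (auto simp: fibre_mfd_def split: if_splits)

lemma fibre_cover: "\<Union> (fst ` charts fibre_mfd) = fibre"
  by (auto simp: fibre_mfd_def fibre_union)

lemma fibre_chart_inverse:
  assumes "fibre_chart U \<phi> L i A"
  shows "chart_inverse fibre U \<phi> (\<lambda>y. proj (L y))"
proof -
  have U: "U \<subseteq> affine_dom i" and A: "bounded_linear A" and phi: "\<phi> = (\<lambda>p. A (affine_chart i p))"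
    and L: "smooth_on (\<phi> ` U) L" "\<And>y. y \<in> \<phi> ` U \<Longrightarrow> L y \<in> Omega_lift"
    using assms unfolding fibre_chart_def by blast+
  have "continuous_on U \<phi>"
    unfolding phi by (intro bounded_linear.continuous_on[OF A] continuous_on_subset[OF continuous_on_affine_chart U])
  moreover have "continuous_on (\<phi> ` U) (\<lambda>y. proj (L y))"
    by (rule continuous_on_imp_proj_compose[OF L(1) Omega_lift_nonzero[OF L(2)]])
  ultimately show ?thesis using assms unfolding chart_inverse_def fibre_chart_def by blast
qed

lemma fibre_chart_smooth:
  assumes "fibre_chart U \<phi> L i A" "open S" "smooth_on S f" "\<And>x. x \<in> S \<Longrightarrow> f x \<noteq> 0" "\<And>x. x \<in> S \<Longrightarrow> proj (f x) \<in> U"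
  shows "smooth_on S (\<lambda>x. \<phi> (proj (f x)))"
proof -
  have "f x $ i \<noteq> 0" if "x \<in> S" for x
    using assms(1) assms(4,5)[OF that] by (auto simp: fibre_chart_def proj_in_affine_dom subset_iff)
  then have "smooth_on S (\<lambda>x. affine_chart i (proj (f x)))"
    by (rule smooth_on_affine_chart_proj[OF assms(2,3)])
  moreover have "bounded_linear A" using assms(1) by (simp add: fibre_chart_def)
  ultimately have "smooth_on S (\<lambda>x. A (affine_chart i (proj (f x))))"
    by (rule smooth_on_linear[OF assms(2), rotated])
  then show ?thesis using assms(1) by (simp add: fibre_chart_def)
qed

lemma smooth_manifold_fibre: "smooth_manifold (fibre_mfd :: ('m::finite cproj, real ^ 'm) mfd)"
proof (rule smooth_manifoldI[OF _ fibre_cover])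
  show "mtop fibre_mfd = top_of_set fibre" by (simp add: fibre_mfd_def)
  fix U :: "'m cproj set" and \<phi> :: "'m cproj \<Rightarrow> real ^ 'm"
  assume "(U, \<phi>) \<in> charts fibre_mfd"
  then obtain L i A where U: "fibre_chart U \<phi> L i A" by (rule fibre_mfd_charts)
  show "\<exists>\<tau>. chart_inverse fibre U \<phi> \<tau> \<and> (\<forall>V \<psi> S. (V, \<psi>) \<in> charts fibre_mfd \<longrightarrow> open S \<longrightarrow> S \<subseteq> \<phi> ` U \<longrightarrow>
      (\<forall>y\<in>S. \<tau> y \<in> V) \<longrightarrow> smooth_on S (\<lambda>y. \<psi> (\<tau> y)))"
  proof (intro exI[of _ "\<lambda>y. proj (L y)"] conjI allI impI fibre_chart_inverse[OF U])
    fix V S and \<psi> :: "'m cproj \<Rightarrow> real ^ 'm"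
    assume V: "(V, \<psi>) \<in> charts fibre_mfd" "open S" "S \<subseteq> \<phi> ` U" "\<forall>y\<in>S. proj (L y) \<in> V"
    obtain L' i' A' where V': "fibre_chart V \<psi> L' i' A'" using V(1) by (rule fibre_mfd_charts)
    have "smooth_on S L" using U V(3) smooth_on_subset by (auto simp: fibre_chart_def)
    moreover have "L y \<noteq> 0" if "y \<in> S" for y using U V(3) that Omega_lift_nonzero by (auto simp: fibre_chart_def)
    ultimately show "smooth_on S (\<lambda>y. \<psi> (proj (L y)))" using V by (intro fibre_chart_smooth[OF V']) auto
  qed
qed

section \<open>The bundle\<close>

text \<open>On \<open>Omega_set\<close> the choice of representative is immaterial, as
  \<open>klein\<close> is invariant under scaling there.\<close>

definition bundle_proj :: "'m::finite cproj \<Rightarrow> 'm cproj" where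
  "bundle_proj p = proj (real_vec (homog (klein (rep_cproj p))))"

text \<open>Global over the whole ball, because the boosts are defined and smooth for every base
  point.\<close>

definition trivialisation :: "'m::finite cproj \<Rightarrow> 'm cproj \<times> 'm cproj" where
  "trivialisation p = (bundle_proj p, proj (cunboost (klein (rep_cproj p)) (rep_cproj p)))"

definition trivialisation_inv :: "'m::finite cproj \<times> 'm cproj \<Rightarrow> 'm cproj" where
  "trivialisation_inv = (\<lambda>(b, f). proj (cboost (klein_chart b) (rep_cproj f)))"

lemma rep_cproj_proj:
  assumes "z \<noteq> 0"
  obtains c where "c \<noteq> 0" "rep_cproj (proj z) = c *s z"
  using proj_eq_iff_nz[of z "rep_cproj (proj z)"] assms by auto

lemma bundle_proj_proj:
  assumes "z \<in> Omega_lift"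
  shows "bundle_proj (proj z) = proj (real_vec (homog (klein z)))"
proof -
  obtain c where "c \<noteq> 0" "rep_cproj (proj z) = c *s z"
    using rep_cproj_proj[OF Omega_lift_nonzero[OF assms]] .
  then show ?thesis using assms by (simp add: bundle_proj_def klein_scale)
qed

lemma trivialisation_proj:
  assumes "z \<in> Omega_lift"
  shows "trivialisation (proj z) = (proj (real_vec (homog (klein z))), proj (cunboost (klein z) z))"
proof -
  obtain c where c: "c \<noteq> 0" "rep_cproj (proj z) = c *s z"
    using rep_cproj_proj[OF Omega_lift_nonzero[OF assms]] .
  have k: "norm (klein z) < 1" using axis_of_exists(1)[OF assms] by simp
  have "cunboost (klein z) z \<noteq> 0" using cunboost_eq_0_iff[OF k] Omega_lift_nonzero[OF assms] by simp
  then show ?thesis using assms c k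
    by (simp add: trivialisation_def bundle_proj_proj klein_scale cunboost_scale)
qed

lemma trivialisation_inv_proj:
  assumes "norm k < 1" "z \<noteq> 0"
  shows "trivialisation_inv (proj (real_vec (homog k)), proj z) = proj (cboost k z)"
proof -
  obtain c where c: "c \<noteq> 0" "rep_cproj (proj z) = c *s z" using rep_cproj_proj[OF assms(2)] .
  have "cboost k z \<noteq> 0" using cboost_eq_0_iff[OF assms(1)] assms(2) by simp
  then show ?thesis using c by (simp add: trivialisation_inv_def cboost_scale)
qed

lemma trivialisation_mem:
  assumes "p \<in> Omega_set"
  shows "trivialisation p \<in> HR \<times> fibre" "trivialisation_inv (trivialisation p) = p"
proof -
  obtain z where z: "z \<in> Omega_lift" "p = proj z" using assms by (auto simp: Omega_set_def)
  have k: "norm (klein z) < 1" using axis_of_exists(1)[OF z(1)] by simp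
  have nz: "cunboost (klein z) z \<noteq> 0" using cunboost_eq_0_iff[OF k] Omega_lift_nonzero[OF z(1)] by simp
  show "trivialisation p \<in> HR \<times> fibre"
    unfolding z(2) trivialisation_proj[OF z(1)] using k klein_cunboost[OF z(1)]
    by (auto simp: HR_homog fibre_def)
  show "trivialisation_inv (trivialisation p) = p"
    unfolding z(2) trivialisation_proj[OF z(1)] trivialisation_inv_proj[OF k nz] cboost_cunboost(1)[OF k] ..
qed

lemma trivialisation_inv_mem:
  assumes "x \<in> HR \<times> fibre"
  shows "trivialisation_inv x \<in> Omega_set" "trivialisation (trivialisation_inv x) = x"
proof -
  obtain k z where kz: "norm k < 1" "z \<in> Omega_lift" "klein z = 0" "x = (proj (real_vec (homog k)), proj z)"
    using assms by (auto simp: HR_homog fibre_def)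
  have e: "trivialisation_inv x = proj (cboost k z)"
    unfolding kz(4) using kz(1) Omega_lift_nonzero[OF kz(2)] by (rule trivialisation_inv_proj)
  note c = klein_cboost[OF kz(2,3,1)]
  show "trivialisation_inv x \<in> Omega_set" unfolding e using c(1) by (auto simp: Omega_set_def)
  have t: "trivialisation (proj (cboost k z)) = x"
    by (simp only: trivialisation_proj[OF c(1)] c(2) kz(4) cboost_cunboost(2)[OF kz(1)])
  show "trivialisation (trivialisation_inv x) = x" by (simp only: e t)
qed

lemma affine_lift_in_Omega_lift:
  assumes "y \<in> affine_chart i ` (affine_dom i \<inter> Omega_set)"
  shows "affine_lift i y \<in> Omega_lift"
proof -
  obtain p where "p \<in> affine_dom i \<inter> Omega_set" "y = affine_chart i p" using assms by auto
  then have "proj (affine_lift i y) \<in> Omega_set" by (simp add: proj_affine_lift_chart)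
  then show ?thesis by (simp add: proj_in_Omega_set)
qed

lemma open_affine_image: "open (affine_chart i ` (affine_dom i \<inter> Omega_set))"
  using chart_inverse_affine[OF open_Omega_set] by (auto simp: chart_inverse_def)

lemma smooth_on_klein_compose [smooth_intros]:
  assumes "open S" "smooth_on S f" "\<And>x. x \<in> S \<Longrightarrow> f x \<in> Omega_lift"
  shows "smooth_on S (\<lambda>x. klein (f x))"
  by (rule smooth_on_compose[OF assms(1) open_Omega_lift assms(3,2) smooth_on_klein])

lemma smooth_map_bundle_proj: "smooth_map (restrict_mfd CP_mfd Omega_set) HR_mfd bundle_proj"
proof (rule smooth_mapI[OF mtop_restrict_CP _ charts_cover_CP])
  show "mtop HR_mfd = top_of_set HR" by (simp add: HR_mfd_eq)
  show "bundle_proj ` Omega_set \<subseteq> HR"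
    using axis_of_exists(1) by (force simp: Omega_set_def bundle_proj_proj HR_homog)
  show "openin (top_of_set HR) V" if "(V, \<psi>) \<in> charts HR_mfd" for V and \<psi> :: "'a cproj \<Rightarrow> real ^ 'a"
    using that by (simp add: HR_mfd_eq)
  fix U :: "'a cproj set" and \<phi> :: "'a cproj \<Rightarrow> complex ^ 'a"
  assume "(U, \<phi>) \<in> charts (restrict_mfd CP_mfd Omega_set)"
  then obtain i where i: "U = affine_dom i \<inter> Omega_set" "\<phi> = affine_chart i" by (auto simp: charts_restrict_CP)
  let ?\<tau> = "\<lambda>y. proj (affine_lift i y)"
  have b: "bundle_proj (?\<tau> y) = proj (real_vec (homog (klein (affine_lift i y))))" if "y \<in> \<phi> ` U" for y
    using that affine_lift_in_Omega_lift unfolding i by (intro bundle_proj_proj) blast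
  have o: "open (\<phi> ` U)" unfolding i by (rule open_affine_image)
  have s: "smooth_on (\<phi> ` U) (\<lambda>y. klein (affine_lift i y))"
    using affine_lift_in_Omega_lift unfolding i by (intro smooth_on_klein_compose open_affine_image smooth_on_affine_lift) blast
  show "\<exists>\<tau>. chart_inverse Omega_set U \<phi> \<tau> \<and> continuous_on (\<phi> ` U) (\<lambda>y. bundle_proj (\<tau> y)) \<and>
     (\<forall>V \<psi> S. (V, \<psi>) \<in> charts HR_mfd \<longrightarrow> open S \<longrightarrow> S \<subseteq> \<phi> ` U \<longrightarrow> (\<forall>y\<in>S. bundle_proj (\<tau> y) \<in> V) \<longrightarrow>
       smooth_on S (\<lambda>y. \<psi> (bundle_proj (\<tau> y))))"
  proof (intro exI[of _ ?\<tau>] conjI allI impI)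
    show "chart_inverse Omega_set U \<phi> ?\<tau>" unfolding i by (rule chart_inverse_affine[OF open_Omega_set])
    have "continuous_on (\<phi> ` U) (\<lambda>y. proj (real_vec (homog (klein (affine_lift i y)))))"
      using s o by (intro continuous_on_imp_proj_compose smooth_on_cplx smooth_on_homog smooth_on_const) auto
    then show "continuous_on (\<phi> ` U) (\<lambda>y. bundle_proj (?\<tau> y))"
      by (rule continuous_on_eq) (simp add: b)
    fix V S and \<psi> :: "'a cproj \<Rightarrow> real ^ 'a"
    assume V: "(V, \<psi>) \<in> charts HR_mfd" "open S" "S \<subseteq> \<phi> ` U"
    then have psi: "\<psi> = klein_chart" by (simp add: HR_mfd_eq)
    show "smooth_on S (\<lambda>y. \<psi> (bundle_proj (?\<tau> y)))"
    proof (rule smooth_on_cong[OF V(2)])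
      show "smooth_on S (\<lambda>y. klein (affine_lift i y))" using smooth_on_subset[OF s V(3)] .
      show "klein (affine_lift i y) = \<psi> (bundle_proj (?\<tau> y))" if "y \<in> S" for y
        using that V(3) b[of y] by (auto simp: psi)
    qed
  qed
qed

abbreviation product_mfd :: "('m::finite cproj \<times> 'm cproj, (real ^ 'm) \<times> (real ^ 'm)) mfd" where
  "product_mfd \<equiv> prod_mfd HR_mfd fibre_mfd"

lemma mtop_product: "mtop product_mfd = top_of_set (HR \<times> fibre)"
  by (simp add: prod_mfd_def HR_mfd_eq fibre_mfd_def)

lemma charts_product:
  "charts product_mfd = (\<lambda>(V, \<psi>). (HR \<times> V, map_prod klein_chart \<psi>)) ` charts fibre_mfd"
  by (auto simp: prod_mfd_def HR_mfd_eq image_iff split: prod.splits) force+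

lemma charts_cover_product: "\<Union> (fst ` charts product_mfd) = HR \<times> fibre"
  unfolding charts_product fibre_cover[symmetric] by force

section \<open>Smoothness of the trivialisation and of its inverse\<close>

lemma smooth_map_trivialisation: "smooth_map (restrict_mfd CP_mfd Omega_set) product_mfd trivialisation"
proof (rule smooth_mapI[OF mtop_restrict_CP mtop_product charts_cover_CP])
  show "trivialisation ` Omega_set \<subseteq> HR \<times> fibre" using trivialisation_mem(1) by blast
  show "openin (top_of_set (HR \<times> fibre)) W" if W: "(W, \<psi>) \<in> charts product_mfd"
    for W and \<psi> :: "'a cproj \<times> 'a cproj \<Rightarrow> (real ^ 'a) \<times> (real ^ 'a)"
  proof -
    obtain V \<psi>' where V: "(V, \<psi>') \<in> charts fibre_mfd" "W = HR \<times> V" using W unfolding charts_product by auto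
    obtain L i A where fc: "fibre_chart V \<psi>' L i A" using V(1) by (rule fibre_mfd_charts)
    have "chart_inverse (HR \<times> fibre) (HR \<times> V) (map_prod (klein_chart :: 'a cproj \<Rightarrow> _) \<psi>')
       (map_prod (\<lambda>k. proj (real_vec (homog k))) (\<lambda>y. proj (L y)))"
      by (rule chart_inverse_prod[OF chart_inverse_HR fibre_chart_inverse[OF fc]])
    then show ?thesis unfolding V(2) by (simp add: chart_inverse_def)
  qed
  fix U :: "'a cproj set" and \<phi> :: "'a cproj \<Rightarrow> complex ^ 'a"
  assume "(U, \<phi>) \<in> charts (restrict_mfd CP_mfd Omega_set)"
  then obtain i where i: "U = affine_dom i \<inter> Omega_set" "\<phi> = affine_chart i" by (auto simp: charts_restrict_CP)
  let ?\<tau> = "\<lambda>y. proj (affine_lift i y)"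
  let ?k = "\<lambda>y. klein (affine_lift i y)"
  have O: "affine_lift i y \<in> Omega_lift" if "y \<in> \<phi> ` U" for y
    using that affine_lift_in_Omega_lift unfolding i by blast
  have b: "trivialisation (?\<tau> y) = (proj (real_vec (homog (?k y))), proj (cunboost (?k y) (affine_lift i y)))" if "y \<in> \<phi> ` U" for y
    using O[OF that] by (rule trivialisation_proj)
  have kn: "norm (?k y) < 1" if "y \<in> \<phi> ` U" for y using axis_of_exists(1)[OF O[OF that]] by simp
  have nz: "cunboost (?k y) (affine_lift i y) \<noteq> 0" if "y \<in> \<phi> ` U" for y
    using cunboost_eq_0_iff[OF kn[OF that]] by simp
  have o: "open (\<phi> ` U)" unfolding i by (rule open_affine_image)
  have s: "smooth_on (\<phi> ` U) ?k"
    using O o by (intro smooth_on_klein_compose smooth_on_affine_lift)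
  have s2: "smooth_on (\<phi> ` U) (\<lambda>y. cunboost (?k y) (affine_lift i y))"
    using o s kn by (intro smooth_on_cunboost smooth_on_affine_lift)
  show "\<exists>\<tau>. chart_inverse Omega_set U \<phi> \<tau> \<and> continuous_on (\<phi> ` U) (\<lambda>y. trivialisation (\<tau> y)) \<and>
     (\<forall>V \<psi> S. (V, \<psi>) \<in> charts product_mfd \<longrightarrow> open S \<longrightarrow> S \<subseteq> \<phi> ` U \<longrightarrow> (\<forall>y\<in>S. trivialisation (\<tau> y) \<in> V) \<longrightarrow>
       smooth_on S (\<lambda>y. \<psi> (trivialisation (\<tau> y))))"
  proof (intro exI[of _ ?\<tau>] conjI allI impI)
    show "chart_inverse Omega_set U \<phi> ?\<tau>" unfolding i by (rule chart_inverse_affine[OF open_Omega_set])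
    have "continuous_on (\<phi> ` U) (\<lambda>y. (proj (real_vec (homog (?k y))), proj (cunboost (?k y) (affine_lift i y))))"
      using s s2 o nz
      by (intro continuous_on_Pair continuous_on_imp_proj_compose smooth_on_cplx smooth_on_homog smooth_on_const) auto
    then show "continuous_on (\<phi> ` U) (\<lambda>y. trivialisation (?\<tau> y))"
      by (rule continuous_on_eq) (simp add: b)
    fix W S and \<psi> :: "'a cproj \<times> 'a cproj \<Rightarrow> (real ^ 'a) \<times> (real ^ 'a)"
    assume W: "(W, \<psi>) \<in> charts product_mfd" "open S" "S \<subseteq> \<phi> ` U" "\<forall>y\<in>S. trivialisation (?\<tau> y) \<in> W"
    obtain V \<psi>' where V: "(V, \<psi>') \<in> charts fibre_mfd" "W = HR \<times> V" "\<psi> = map_prod klein_chart \<psi>'"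
      using W(1) unfolding charts_product by auto
    obtain L j A where fc: "fibre_chart V \<psi>' L j A" using V(1) by (rule fibre_mfd_charts)
    show "smooth_on S (\<lambda>y. \<psi> (trivialisation (?\<tau> y)))"
    proof (rule smooth_on_cong[OF W(2)])
      have "smooth_on S (\<lambda>y. \<psi>' (proj (cunboost (?k y) (affine_lift i y))))"
      proof (rule fibre_chart_smooth[OF fc W(2)])
        show "smooth_on S (\<lambda>y. cunboost (?k y) (affine_lift i y))" using smooth_on_subset[OF s2 W(3)] .
        show "cunboost (?k y) (affine_lift i y) \<noteq> 0" if "y \<in> S" for y using nz W(3) that by blast
        show "proj (cunboost (?k y) (affine_lift i y)) \<in> V" if "y \<in> S" for y
        proof -
          have "y \<in> \<phi> ` U" using W(3) that by blast
          then show ?thesis using W(4) that b[of y] by (auto simp: V(2))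
        qed
      qed
      then show "smooth_on S (\<lambda>y. (?k y, \<psi>' (proj (cunboost (?k y) (affine_lift i y)))))"
        using W(2) smooth_on_subset[OF s W(3)] by (intro smooth_on_Pair)
      show "(?k y, \<psi>' (proj (cunboost (?k y) (affine_lift i y)))) = \<psi> (trivialisation (?\<tau> y))" if "y \<in> S" for y
      proof -
        have "y \<in> \<phi> ` U" using W(3) that by blast
        then show ?thesis by (simp only: b V(3) map_prod_simp klein_chart_homog)
      qed
    qed
  qed
qed

text \<open>Formulated for any f that agrees with \<open>trivialisation_inv\<close> on the product,
  since \<open>diffeo\<close> speaks of \<open>inv_into\<close>.\<close>

lemma smooth_map_trivialisation_inv:
  assumes "\<And>x. x \<in> HR \<times> fibre \<Longrightarrow> f x = trivialisation_inv x"
  shows "smooth_map product_mfd (restrict_mfd CP_mfd Omega_set) f"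
proof (rule smooth_mapI[OF mtop_product mtop_restrict_CP charts_cover_product])
  show "f ` (HR \<times> fibre) \<subseteq> Omega_set" using assms trivialisation_inv_mem(1) by auto
  show "openin (top_of_set Omega_set) V" if "(V, \<psi>) \<in> charts (restrict_mfd CP_mfd Omega_set)"
    for V and \<psi> :: "'a cproj \<Rightarrow> complex ^ 'a"
    using that chart_inverse_affine[OF open_Omega_set] by (auto simp: charts_restrict_CP chart_inverse_def)
  fix W and \<phi> :: "'a cproj \<times> 'a cproj \<Rightarrow> (real ^ 'a) \<times> (real ^ 'a)"
  assume "(W, \<phi>) \<in> charts product_mfd"
  then obtain U \<phi>' where U: "(U, \<phi>') \<in> charts fibre_mfd" "W = HR \<times> U" "\<phi> = map_prod klein_chart \<phi>'"
    unfolding charts_product by auto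
  obtain L j A where fc: "fibre_chart U \<phi>' L j A" using U(1) by (rule fibre_mfd_charts)
  let ?\<tau> = "map_prod (\<lambda>k. proj (real_vec (homog k))) (\<lambda>y. proj (L y))"
  have ci: "chart_inverse (HR \<times> fibre) W \<phi> ?\<tau>"
    unfolding U(2,3) by (rule chart_inverse_prod[OF chart_inverse_HR fibre_chart_inverse[OF fc]])
  have im: "\<phi> ` W = ball 0 1 \<times> \<phi>' ` U" unfolding U(2,3) klein_chart_image[symmetric] by auto
  have L: "smooth_on (\<phi>' ` U) L" "open (\<phi>' ` U)" "\<And>y. y \<in> \<phi>' ` U \<Longrightarrow> L y \<in> Omega_lift" "\<And>y. y \<in> \<phi>' ` U \<Longrightarrow> klein (L y) = 0"
    using fc by (auto simp: fibre_chart_def)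
  let ?g = "\<lambda>x. cboost (fst x) (L (snd x))"
  have k: "norm (fst x) < 1" if "x \<in> \<phi> ` W" for x using that unfolding im by auto
  have y: "snd x \<in> \<phi>' ` U" if "x \<in> \<phi> ` W" for x using that unfolding im by auto
  have b: "f (?\<tau> x) = proj (?g x)" if "x \<in> \<phi> ` W" for x
  proof -
    have "?\<tau> x \<in> HR \<times> fibre" using that chart_inverse_subset[OF ci] ci by (auto simp: chart_inverse_def)
    then have "f (?\<tau> x) = trivialisation_inv (?\<tau> x)" by (rule assms)
    also have "\<dots> = trivialisation_inv (proj (real_vec (homog (fst x))), proj (L (snd x)))"
      by (simp add: map_prod_def split_beta)
    also have "\<dots> = proj (?g x)"
      using k[OF that] Omega_lift_nonzero[OF L(3)[OF y[OF that]]] by (rule trivialisation_inv_proj)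
    finally show ?thesis .
  qed
  have nz: "?g x \<noteq> 0" if "x \<in> \<phi> ` W" for x
    using cboost_eq_0_iff[OF k[OF that]] Omega_lift_nonzero[OF L(3)[OF y[OF that]]] by simp
  have o: "open (\<phi> ` W)" using ci by (simp add: chart_inverse_def)
  have "smooth_on (\<phi> ` W) (\<lambda>x. L (snd x))"
    by (rule smooth_on_compose[OF o L(2) y smooth_on_snd[OF o smooth_on_id[OF o]] L(1)])
  then have s: "smooth_on (\<phi> ` W) ?g"
    using o k by (intro smooth_on_cboost smooth_on_fst smooth_on_id)
  show "\<exists>\<tau>. chart_inverse (HR \<times> fibre) W \<phi> \<tau> \<and> continuous_on (\<phi> ` W) (\<lambda>y. f (\<tau> y)) \<and>
     (\<forall>V \<psi> S. (V, \<psi>) \<in> charts (restrict_mfd CP_mfd Omega_set) \<longrightarrow> open S \<longrightarrow> S \<subseteq> \<phi> ` W \<longrightarrow> (\<forall>y\<in>S. f (\<tau> y) \<in> V) \<longrightarrow>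
       smooth_on S (\<lambda>y. \<psi> (f (\<tau> y))))"
  proof (intro exI[of _ ?\<tau>] conjI allI impI ci)
    have "continuous_on (\<phi> ` W) (\<lambda>x. proj (?g x))" using s nz by (rule continuous_on_imp_proj_compose)
    then show "continuous_on (\<phi> ` W) (\<lambda>y. f (?\<tau> y))"
      by (rule continuous_on_eq) (simp add: b)
    fix V S and \<psi> :: "'a cproj \<Rightarrow> complex ^ 'a"
    assume V: "(V, \<psi>) \<in> charts (restrict_mfd CP_mfd Omega_set)" "open S" "S \<subseteq> \<phi> ` W" "\<forall>y\<in>S. f (?\<tau> y) \<in> V"
    then obtain i where i: "V = affine_dom i \<inter> Omega_set" "\<psi> = affine_chart i" by (auto simp: charts_restrict_CP)
    show "smooth_on S (\<lambda>y. \<psi> (f (?\<tau> y)))"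
    proof (rule smooth_on_cong[OF V(2)])
      show "smooth_on S (\<lambda>x. affine_chart i (proj (?g x)))"
      proof (rule smooth_on_affine_chart_proj[OF V(2) smooth_on_subset[OF s V(3)]])
        fix x assume "x \<in> S"
        then have xW: "x \<in> \<phi> ` W" and "f (?\<tau> x) \<in> affine_dom i" using V(3,4) i by blast+
        then have "proj (?g x) \<in> affine_dom i" using b[OF xW] by (simp only:)
        then show "?g x $ i \<noteq> 0" using proj_in_affine_dom[OF nz[OF xW]] by blast
      qed
      show "affine_chart i (proj (?g x)) = \<psi> (f (?\<tau> x))" if "x \<in> S" for x
        using that V(3) b[of x] by (auto simp: i)
    qed
  qed
qed

lemma diffeo_trivialisation:
  "diffeo (restrict_mfd CP_mfd Omega_set) product_mfd (trivialisation :: 'm::finite cproj \<Rightarrow> _)"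
proof -
  have bij: "bij_betw (trivialisation :: 'm cproj \<Rightarrow> _) Omega_set (HR \<times> fibre)"
  proof (rule bij_betw_byWitness[where f' = trivialisation_inv])
    show "trivialisation ` Omega_set \<subseteq> HR \<times> fibre" by (rule image_subsetI) (rule trivialisation_mem(1))
    show "trivialisation_inv ` (HR \<times> fibre) \<subseteq> Omega_set" by (rule image_subsetI) (rule trivialisation_inv_mem(1))
    show "\<forall>p\<in>Omega_set. trivialisation_inv (trivialisation p) = p" by (rule ballI) (rule trivialisation_mem(2))
    show "\<forall>x\<in>HR \<times> fibre. trivialisation (trivialisation_inv x) = x" by (rule ballI) (rule trivialisation_inv_mem(2))
  qed
  have "inv_into Omega_set trivialisation x = trivialisation_inv x" if "x \<in> HR \<times> fibre" for x :: "'m cproj \<times> 'm cproj"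
    using bij trivialisation_inv_mem[OF that] by (metis bij_betw_inv_into_left)
  note inv = smooth_map_trivialisation_inv[OF this]
  then show ?thesis
    unfolding diffeo_def mtop_product mtop_restrict_CP
    using bij smooth_map_trivialisation inv by simp
qed

text \<open>The trivialising neighbourhood is the whole base, and restricting to it changes neither
  manifold.\<close>

lemma smooth_fibre_bundle_Omega: 
  "smooth_fibre_bundle (restrict_mfd CP_mfd Omega_set) HR_mfd (fibre_mfd :: ('m::finite cproj, real ^ 'm) mfd) (bundle_proj :: 'm cproj \<Rightarrow> _)"
proof -
  have into: "bundle_proj x \<in> HR" if "x \<in> Omega_set" for x
    using trivialisation_mem(1)[OF that] by (simp add: trivialisation_def)
  have onto: "b \<in> bundle_proj ` Omega_set" if b: "b \<in> HR" for b :: "'m cproj"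
  proof -
    \<comment> \<open>Surjectivity needs one point of the fibre; this one exists for every
      m.\<close>
    have "proj (lift1 0) \<in> fibre" using lift1_props unfolding fibre_def by blast
    then have x: "(b, proj (lift1 0)) \<in> HR \<times> fibre" using b by simp
    have "fst (trivialisation (trivialisation_inv (b, proj (lift1 0)))) = b"
      using trivialisation_inv_mem(2)[OF x] by simp
    then have "bundle_proj (trivialisation_inv (b, proj (lift1 0))) = b" by (simp add: trivialisation_def)
    then show ?thesis using trivialisation_inv_mem(1)[OF x] by (metis imageI)
  qed
  have pre: "{x \<in> Omega_set. bundle_proj x \<in> HR} = Omega_set" using into by auto
  have r1: "restrict_mfd (restrict_mfd CP_mfd Omega_set) Omega_set = (restrict_mfd CP_mfd Omega_set :: ('m cproj, complex ^ 'm) mfd)"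
    by (simp add: restrict_mfd_def subtopology_subtopology image_image split_beta Int_assoc)
  have r2: "restrict_mfd HR_mfd HR = (HR_mfd :: ('m cproj, real ^ 'm) mfd)"
    by (simp add: restrict_mfd_def HR_mfd_eq subtopology_subtopology)
  have triv: "\<exists>U h. openin (top_of_set HR) U \<and> b \<in> U \<and>
     diffeo (restrict_mfd (restrict_mfd CP_mfd Omega_set) {x \<in> Omega_set. bundle_proj x \<in> U}) (prod_mfd (restrict_mfd HR_mfd U) (fibre_mfd :: ('m cproj, real ^ 'm) mfd)) h \<and>
     (\<forall>x\<in>Omega_set. bundle_proj x \<in> U \<longrightarrow> fst (h x) = bundle_proj x)" if "b \<in> HR" for b :: "'m cproj"
  proof (rule exI[of _ HR], rule exI[of _ trivialisation], intro conjI)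
    show "diffeo (restrict_mfd (restrict_mfd CP_mfd Omega_set) {x \<in> Omega_set. bundle_proj x \<in> HR})
       (prod_mfd (restrict_mfd HR_mfd HR) fibre_mfd) (trivialisation :: 'm cproj \<Rightarrow> _)"
      unfolding pre r1 r2 by (rule diffeo_trivialisation)
  qed (use that in \<open>simp_all add: trivialisation_def\<close>)
  have tops: "topspace (mtop (restrict_mfd CP_mfd Omega_set)) = (Omega_set :: 'm cproj set)" "mtop HR_mfd = top_of_set (HR :: 'm cproj set)"
    by (simp_all add: mtop_restrict_CP HR_mfd_eq)
  show ?thesis
    unfolding smooth_fibre_bundle_def tops topspace_euclidean_subtopology
  proof (intro conjI)
    show "bundle_proj ` Omega_set = (HR :: 'm cproj set)" using into onto by auto
  qed (use smooth_manifold_CP[OF open_Omega_set] smooth_manifold_HR smooth_manifold_fibre smooth_map_bundle_proj triv in blast)+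
qed

text \<open>Lorentz matrices carry axes to axes; the factor from renormalising the time coordinate
  disappears projectively.\<close>

lemma SO_equivariant_bundle_proj: "SO_equivariant Omega_set bundle_proj"
  unfolding SO_equivariant_def
proof (intro ballI)
  fix g :: "real ^ ('a option) ^ ('a option)" and x :: "'a cproj" assume g: "g \<in> carrier SO_plus" and x: "x \<in> Omega_set"
  have l: "lorentz g" using g by (simp add: SO_plus_def lorentz_def)
  obtain z where z: "z \<in> Omega_lift" "x = proj z" using x by (auto simp: Omega_set_def)
  have z0: "z \<noteq> 0" using z(1) by (rule Omega_lift_nonzero)
  have gz: "pact (cmat g) x = proj (cmat g *v z)" unfolding z(2) using l z0 by (rule pact_cmat)
  have O: "cmat g *v z \<in> Omega_lift" using z(1) l by (simp add: Omega_lift_lorentz)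
  obtain r where r: "r \<noteq> 0" "homog (klein (cmat g *v z)) = r *\<^sub>R (g *v homog (klein z))"
    using klein_lorentz[OF l z(1)] .
  have "bundle_proj (pact (cmat g) x) = proj (real_vec (g *v homog (klein z)))"
    unfolding gz bundle_proj_proj[OF O] r(2) using r(1) l by (intro proj_real_vec_scale) auto
  also have "\<dots> = pact (cmat g) (bundle_proj x)"
    unfolding z(2) bundle_proj_proj[OF z(1)] using l by (simp add: pact_real_vec)
  finally have "bundle_proj (pact (cmat g) x) = pact (cmat g) (bundle_proj x)" .
  then show "pact (cmat g) x \<in> Omega_set \<and> bundle_proj (pact (cmat g) x) = pact (cmat g) (bundle_proj x)"
    using O by (auto simp: gz Omega_set_def)
qed

section \<open>Discrete subgroups\<close>

lemma SO_plus_simps: "carrier SO_plus = {A. lorentz A \<and> det A = 1 \<and> A $ None $ None > 0}"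
  "A \<otimes>\<^bsub>SO_plus\<^esub> B = A ** B" "\<one>\<^bsub>SO_plus\<^esub> = mat 1"
  by (simp_all add: SO_plus_def lorentz_def)

text \<open>The adjoint keeps the last diagonal entry, so it stays in the group.\<close>

lemma SO_plus_inv:
  assumes "A \<in> carrier SO_plus"
  shows "inv\<^bsub>SO_plus\<^esub> A = lor_adj A"
proof -
  have A: "lorentz A" "det A = 1" "A $ None $ None > 0" using assms by (auto simp: SO_plus_simps)
  have "det (lor_adj A) * det A = 1" using lorentz_adj_left[OF A(1)] by (metis det_I det_mul)
  then have "lor_adj A \<in> carrier SO_plus" using A by (simp add: SO_plus_simps lorentz_lor_adj) (simp add: lor_adj_def)
  then show ?thesis
    unfolding m_inv_def SO_plus_simps(2,3)
    using lorentz_adj_left[OF A(1)] lorentz_adj_right[OF A(1)]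
    by (intro the_equality) (auto, metis matrix_mul_assoc matrix_mul_lid matrix_mul_rid)
qed

lemma full_limit_group_of_subgroup:
  fixes \<Gamma> :: "(real ^ ('m::finite option) ^ ('m option)) set"
  assumes "CARD('m) \<ge> 2" "discrete_subgroup \<Gamma>" "limit_set \<Gamma> = bdHR"
  shows "full_limit_group \<Gamma>"
proof
  have sub: "subgroup \<Gamma> SO_plus" and dis: "discrete \<Gamma>" using assms(2) by (auto simp: discrete_subgroup_def)
  have car: "A \<in> carrier SO_plus" if "A \<in> \<Gamma>" for A using subgroup.mem_carrier[OF sub that] .
  show "lorentz A" if "A \<in> \<Gamma>" for A using car[OF that] by (simp add: SO_plus_simps)
  show one: "mat 1 \<in> \<Gamma>" using subgroup.one_closed[OF sub] by (simp add: SO_plus_simps)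
  show "A ** B \<in> \<Gamma>" if "A \<in> \<Gamma>" "B \<in> \<Gamma>" for A B
    using subgroup.m_closed[OF sub that] by (simp add: SO_plus_simps)
  show "lor_adj A \<in> \<Gamma>" if "A \<in> \<Gamma>" for A
    using subgroup.m_inv_closed[OF sub that] SO_plus_inv[OF car[OF that]] by simp
  have "\<forall>\<^sub>F B in at (mat 1). B \<notin> \<Gamma>" using dis one by (simp add: discrete_altdef)
  then show "\<exists>e>0. \<forall>A\<in>\<Gamma>. norm (A - mat 1) < e \<longrightarrow> A = mat 1"
    unfolding eventually_at dist_norm by blast
  show "CARD('m) \<ge> 2" by (rule assms(1))
  show "\<exists>z\<in>HR. proj (real_vec p) islimpt ((\<lambda>g. pact (cmat g) z) ` \<Gamma>)" if "null_vec p" for p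
  proof -
    have "proj (real_vec p) \<in> limit_set \<Gamma>" using that unfolding assms(3) by (auto simp: bdHR_real_vec null_vec_def)
    then show ?thesis by (simp add: limit_set_def)
  qed
qed

theorem theorem1p1:
  fixes \<Gamma> :: "(real ^ ('m::finite option) ^ ('m option)) set"
  assumes "CARD('m) \<ge> 2"
    and "discrete_subgroup \<Gamma>"
    and "limit_set \<Gamma> = bdHR"
  shows "\<exists>(\<pi> :: 'm cproj \<Rightarrow> 'm cproj) (F :: ('m cproj, real ^ 'm) mfd).
           smooth_fibre_bundle (restrict_mfd CP_mfd (Kul_region (cmat ` \<Gamma>))) HR_mfd F \<pi> \<and>
           SO_equivariant (Kul_region (cmat ` \<Gamma>)) \<pi>"
proof -
  interpret full_limit_group \<Gamma> using assms by (rule full_limit_group_of_subgroup)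
  have "Kul_region (cmat ` \<Gamma>) = Omega_set"
    unfolding Kul_region_def Kul_limit_set_eq by (rule Omega_set_eq[OF assms(1)])
  then show ?thesis using smooth_fibre_bundle_Omega SO_equivariant_bundle_proj by metis
qed

end
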